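(* The category of $\ominus$-algebras and homomorphisms is dually equivalent to the category of $\ominus$-spaces and morphisms of $\ominus$-spaces.
   Context: **$\ominus$-algebras.** A $\ominus$-algebra $(A,\ominus)$ is a bounded distributive lattice $A$ with a binary operation $\ominus$ such that for all $a,b,c\in A$: (1) $(a\wedge b)\ominus c=(a\ominus c)\wedge(b\ominus c)$, $(a\vee b)\ominus c=(a\ominus c)\vee(b\ominus c)$, $a\ominus(b\wedge c)=(a\ominus b)\vee(a\ominus c)$, $a\ominus(b\vee c)=(a\ominus b)\wedge(a\ominus c)$; (2) $0\ominus a=0$ and $a\ominus 1=0$; (3) $a\ominus 0=a$. Homomorphisms of $\ominus$-algebras are bounded lattice homomorphisms preserving $\ominus$. **Priestley spaces.** A Priestley space is a compact ordered topological space $X$ such that whenever $x\not\leq y$ there is a clopen down-set $U$ with $y\in U$, $x\notin U$. If $\tau$ is the topology of $X$, then $\tau^\uparrow$ is the topology of $\tau$-open up-sets and $\tau^\downarrow$ is the topology of $\tau$-open down-sets. **$\ominus$-spaces.** A $\ominus$-space is a tuple $(X,i,+,\star)$ where: (1) $X$ is a Priestley space; (2) $i\colon X\to X$ is continuous and order-reversing; (3) $+$ is a partial binary function on $X$ with $\mathrm{dom}(+)=\{(x,y)\in X^2\mid y\leq i(x)\}$, which is upper continuous: continuous from $\mathrm{dom}(+)$, with the subspace topology of $(X,\tau^\uparrow)\times(X,\tau^\uparrow)$, to $(X,\tau^\uparrow)$; (4) $\star$ is a partial binary function on $X$ with $\mathrm{dom}(\star)=\{(x,y)\in X^2\mid i(x)\nleq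 y\}$, which is lower continuous: continuous from $\mathrm{dom}(\star)$, with the subspace topology of $(X,\tau^\downarrow)\times(X,\tau^\downarrow)$, to $(X,\tau^\downarrow)$; (5) $+$ and $\star$ are order-preserving in both coordinates (on their domains); (6) for any $(x,y)\in\mathrm{dom}(\star)$, $x\star y=\inf\{x+w\mid (x,w)\in\mathrm{dom}(+)\text{ and }w\nleq y\}$ (infimum in $X$); (7) for any $x\in X$, the map $L_x\colon w\mapsto x+w$ is a map ${\downarrow}i(x)\to{\uparrow}x$ (in particular $x\leq x+w$) with totally ordered image, and it has an upper adjoint $L_x^\sharp\colon{\uparrow}x\to{\downarrow}i(x)$, i.e. $L_x(w)\leq z\iff w\leq L_x^\sharp(z)$ for all $w\in{\downarrow}i(x)$, $z\in{\uparrow}x$. **Morphisms.** A morphism from a $\ominus$-space $(X_1,i_1,+_1,\star_1)$ to a $\ominus$-space $(X_2,i_2,+_2,\star_2)$ is a continuous order-preserving function $f\colon X_1\to X_2$ such that: (1) $f(i_1(x))=i_2(f(x))$ for all $x\in X_1$; (2) for all $x,y\in X_1$, if $(x,y)\in\mathrm{dom}(+_1)$ then $f(x)+_2f(y)\leq f(x+_1y)$; (3) for all $x\in X_1$, $z\in X_2$, if $(f(x),z)\in\mathrm{dom}(+_2)$ then there exists $w'\in X_1$ with $(x,w')\in\mathrm{dom}(+_1)$, $z\leq f(w')$, and $f(x+_1w')=f(x)+_2z$. *)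

theory Defs
  imports
    "HOL-Algebra.Lattice"
    "HOL-Analysis.Product_Topology"
    "HOL-Library.Equipollence"
begin

section \<open>Categories\<close>

text \<open>
  Arrows carry no domain and codomain of their own, so composition takes the three objects
  involved: for \<open>f \<in> Hom C a b\<close> and \<open>g \<in> Hom C b c\<close>, the composite of \<open>g\<close> after \<open>f\<close> is
  \<open>Comp C a b c g f\<close>. For the same reason functors take the domain and the codomain of the
  arrow they are applied to.
\<close>

record ('o, 'm) cat =
  Ob :: "'o set"
  Hom :: "'o \<Rightarrow> 'o \<Rightarrow> 'm set"
  Ident :: "'o \<Rightarrow> 'm"
  Comp :: "'o \<Rightarrow> 'o \<Rightarrow> 'o \<Rightarrow> 'm \<Rightarrow> 'm \<Rightarrow> 'm"

locale category =
  fixes C :: "('o, 'm) cat"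
  assumes ident_hom: "a \<in> Ob C \<Longrightarrow> Ident C a \<in> Hom C a a"
    and comp_hom: "\<lbrakk>a \<in> Ob C; b \<in> Ob C; c \<in> Ob C; f \<in> Hom C a b; g \<in> Hom C b c\<rbrakk>
      \<Longrightarrow> Comp C a b c g f \<in> Hom C a c"
    and comp_ident_right: "\<lbrakk>a \<in> Ob C; b \<in> Ob C; f \<in> Hom C a b\<rbrakk>
      \<Longrightarrow> Comp C a a b f (Ident C a) = f"
    and comp_ident_left: "\<lbrakk>a \<in> Ob C; b \<in> Ob C; f \<in> Hom C a b\<rbrakk>
      \<Longrightarrow> Comp C a b b (Ident C b) f = f"
    and comp_assoc: "\<lbrakk>a \<in> Ob C; b \<in> Ob C; c \<in> Ob C; d \<in> Ob C;
        f \<in> Hom C a b; g \<in> Hom C b c; h \<in> Hom C c d\<rbrakk>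
      \<Longrightarrow> Comp C a c d h (Comp C a b c g f) = Comp C a b d (Comp C b c d h g) f"

definition opposite :: "('o, 'm) cat \<Rightarrow> ('o, 'm) cat" where
  "opposite C =
    \<lparr>Ob = Ob C, Hom = (\<lambda>a b. Hom C b a), Ident = Ident C,
     Comp = (\<lambda>a b c g f. Comp C c b a f g)\<rparr>"

definition full_subcat :: "('o, 'm) cat \<Rightarrow> ('o \<Rightarrow> bool) \<Rightarrow> ('o, 'm) cat" where
  "full_subcat C P = C\<lparr>Ob := {a \<in> Ob C. P a}\<rparr>"

record ('o, 'm, 'p, 'n) functor_data =
  on_ob :: "'o \<Rightarrow> 'p"
  on_hom :: "'o \<Rightarrow> 'o \<Rightarrow> 'm \<Rightarrow> 'n"

locale cat_functor = C: category C + D: category D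
  for C :: "('o, 'm) cat" and D :: "('p, 'n) cat" +
  fixes F :: "('o, 'm, 'p, 'n) functor_data"
  assumes on_ob_closed: "a \<in> Ob C \<Longrightarrow> on_ob F a \<in> Ob D"
    and on_hom_closed: "\<lbrakk>a \<in> Ob C; b \<in> Ob C; f \<in> Hom C a b\<rbrakk>
      \<Longrightarrow> on_hom F a b f \<in> Hom D (on_ob F a) (on_ob F b)"
    and on_hom_ident: "a \<in> Ob C \<Longrightarrow> on_hom F a a (Ident C a) = Ident D (on_ob F a)"
    and on_hom_comp: "\<lbrakk>a \<in> Ob C; b \<in> Ob C; c \<in> Ob C; f \<in> Hom C a b; g \<in> Hom C b c\<rbrakk>
      \<Longrightarrow> on_hom F a c (Comp C a b c g f) =
          Comp D (on_ob F a) (on_ob F b) (on_ob F c) (on_hom F b c g) (on_hom F a b f)"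

definition functor_id :: "('o, 'm, 'o, 'm) functor_data" where
  "functor_id = \<lparr>on_ob = (\<lambda>a. a), on_hom = (\<lambda>a b f. f)\<rparr>"

definition functor_comp ::
  "('p, 'n, 'q, 'l) functor_data \<Rightarrow> ('o, 'm, 'p, 'n) functor_data \<Rightarrow> ('o, 'm, 'q, 'l) functor_data"
  where
  "functor_comp G F =
    \<lparr>on_ob = (\<lambda>a. on_ob G (on_ob F a)),
     on_hom = (\<lambda>a b f. on_hom G (on_ob F a) (on_ob F b) (on_hom F a b f))\<rparr>"

definition iso_arrow :: "('o, 'm) cat \<Rightarrow> 'o \<Rightarrow> 'o \<Rightarrow> 'm \<Rightarrow> bool" where
  "iso_arrow C a b f \<longleftrightarrow>
    f \<in> Hom C a b \<and>
    (\<exists>g \<in> Hom C b a. Comp C a b a g f = Ident C a \<and> Comp C b a b f g = Ident C b)"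

definition natural_iso ::
  "('o, 'm) cat \<Rightarrow> ('p, 'n) cat \<Rightarrow> ('o, 'm, 'p, 'n) functor_data \<Rightarrow> ('o, 'm, 'p, 'n) functor_data
    \<Rightarrow> ('o \<Rightarrow> 'n) \<Rightarrow> bool" where
  "natural_iso C D F G \<eta> \<longleftrightarrow>
    (\<forall>a \<in> Ob C. iso_arrow D (on_ob F a) (on_ob G a) (\<eta> a)) \<and>
    (\<forall>a \<in> Ob C. \<forall>b \<in> Ob C. \<forall>f \<in> Hom C a b.
      Comp D (on_ob F a) (on_ob F b) (on_ob G b) (\<eta> b) (on_hom F a b f) =
      Comp D (on_ob F a) (on_ob G a) (on_ob G b) (on_hom G a b f) (\<eta> a))"

definition equivalent_cats :: "('o, 'm) cat \<Rightarrow> ('p, 'n) cat \<Rightarrow> bool" where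
  "equivalent_cats C D \<longleftrightarrow>
    (\<exists>F G \<eta> \<epsilon>. cat_functor C D F \<and> cat_functor D C G \<and>
      natural_iso C C functor_id (functor_comp G F) \<eta> \<and>
      natural_iso D D (functor_comp F G) functor_id \<epsilon>)"

definition dually_equivalent :: "('o, 'm) cat \<Rightarrow> ('p, 'n) cat \<Rightarrow> bool" where
  "dually_equivalent C D \<longleftrightarrow> category C \<and> category D \<and> equivalent_cats (opposite C) D"


section \<open>\<open>\<ominus>\<close>-algebras\<close>

record 'a ominus_alg = "'a gorder" +
  ominus :: "'a \<Rightarrow> 'a \<Rightarrow> 'a" (infixl \<open>\<ominus>\<index>\<close> 65)

text \<open>The one-element algebra, in which the bounds coincide, is included.\<close>

locale ominus_algebra = bounded_lattice A for A :: "'a ominus_alg" (structure) +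
  assumes meet_join_distrib: "\<lbrakk>a \<in> carrier A; b \<in> carrier A; c \<in> carrier A\<rbrakk>
      \<Longrightarrow> a \<sqinter> (b \<squnion> c) = (a \<sqinter> b) \<squnion> (a \<sqinter> c)"
    and ominus_closed: "\<lbrakk>a \<in> carrier A; b \<in> carrier A\<rbrakk> \<Longrightarrow> a \<ominus> b \<in> carrier A"
    and meet_ominus: "\<lbrakk>a \<in> carrier A; b \<in> carrier A; c \<in> carrier A\<rbrakk>
      \<Longrightarrow> (a \<sqinter> b) \<ominus> c = (a \<ominus> c) \<sqinter> (b \<ominus> c)"
    and join_ominus: "\<lbrakk>a \<in> carrier A; b \<in> carrier A; c \<in> carrier A\<rbrakk>
      \<Longrightarrow> (a \<squnion> b) \<ominus> c = (a \<ominus> c) \<squnion> (b \<ominus> c)"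
    and ominus_meet: "\<lbrakk>a \<in> carrier A; b \<in> carrier A; c \<in> carrier A\<rbrakk>
      \<Longrightarrow> a \<ominus> (b \<sqinter> c) = (a \<ominus> b) \<squnion> (a \<ominus> c)"
    and ominus_join: "\<lbrakk>a \<in> carrier A; b \<in> carrier A; c \<in> carrier A\<rbrakk>
      \<Longrightarrow> a \<ominus> (b \<squnion> c) = (a \<ominus> b) \<sqinter> (a \<ominus> c)"
    and bottom_ominus: "a \<in> carrier A \<Longrightarrow> \<bottom> \<ominus> a = \<bottom>"
    and ominus_top: "a \<in> carrier A \<Longrightarrow> a \<ominus> \<top> = \<bottom>"
    and ominus_bottom: "a \<in> carrier A \<Longrightarrow> a \<ominus> \<bottom> = a"

definition ominus_alg_hom :: "'a ominus_alg \<Rightarrow> 'b ominus_alg \<Rightarrow> ('a \<Rightarrow> 'b) \<Rightarrow> bool" where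
  "ominus_alg_hom A B f \<longleftrightarrow>
    f \<in> carrier A \<rightarrow> carrier B \<and>
    f \<bottom>\<^bsub>A\<^esub> = \<bottom>\<^bsub>B\<^esub> \<and> f \<top>\<^bsub>A\<^esub> = \<top>\<^bsub>B\<^esub> \<and>
    (\<forall>a \<in> carrier A. \<forall>b \<in> carrier A.
      f (a \<sqinter>\<^bsub>A\<^esub> b) = f a \<sqinter>\<^bsub>B\<^esub> f b \<and>
      f (a \<squnion>\<^bsub>A\<^esub> b) = f a \<squnion>\<^bsub>B\<^esub> f b \<and>
      f (a \<ominus>\<^bsub>A\<^esub> b) = f a \<ominus>\<^bsub>B\<^esub> f b)"

text \<open>
  Arrows are extensional functions (\<open>undefined\<close> outside the carrier), so that equality of
  arrows is equality of maps between the carriers.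
\<close>

definition ominus_alg_cat :: "('a ominus_alg, 'a \<Rightarrow> 'a) cat" where
  "ominus_alg_cat =
    \<lparr>Ob = {A. ominus_algebra A},
     Hom = (\<lambda>A B. {f \<in> extensional (carrier A). ominus_alg_hom A B f}),
     Ident = (\<lambda>A. \<lambda>x \<in> carrier A. x),
     Comp = (\<lambda>A B C g f. compose (carrier A) g f)\<rparr>"


section \<open>Priestley spaces\<close>

record 'a ord_space = "'a gorder" +
  topol :: "'a topology"

definition up_set :: "('a, 'b) gorder_scheme \<Rightarrow> 'a set \<Rightarrow> bool" where
  "up_set X U \<longleftrightarrow> U \<subseteq> carrier X \<and> (\<forall>x \<in> U. \<forall>y \<in> carrier X. x \<sqsubseteq>\<^bsub>X\<^esub> y \<longrightarrow> y \<in> U)"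

definition down_set :: "('a, 'b) gorder_scheme \<Rightarrow> 'a set \<Rightarrow> bool" where
  "down_set X U \<longleftrightarrow> U \<subseteq> carrier X \<and> (\<forall>x \<in> U. \<forall>y \<in> carrier X. y \<sqsubseteq>\<^bsub>X\<^esub> x \<longrightarrow> y \<in> U)"

locale priestley_space = partial_order X for X :: "('a, 'b) ord_space_scheme" (structure) +
  assumes topspace_eq: "topspace (topol X) = carrier X"
    and compact: "compact_space (topol X)"
    and separation: "\<lbrakk>x \<in> carrier X; y \<in> carrier X; \<not> x \<sqsubseteq> y\<rbrakk>
      \<Longrightarrow> \<exists>U. openin (topol X) U \<and> closedin (topol X) U \<and> down_set X U \<and> y \<in> U \<and> x \<notin> U"

definition up_topology :: "('a, 'b) ord_space_scheme \<Rightarrow> 'a topology" where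
  "up_topology X = topology (\<lambda>U. openin (topol X) U \<and> up_set X U)"

definition down_topology :: "('a, 'b) ord_space_scheme \<Rightarrow> 'a topology" where
  "down_topology X = topology (\<lambda>U. openin (topol X) U \<and> down_set X U)"

lemma openin_up_topology:
  "openin (up_topology X) U \<longleftrightarrow> openin (topol X) U \<and> up_set X U"
proof -
  have "istopology (\<lambda>U. openin (topol X) U \<and> up_set X U)"
    unfolding istopology_def up_set_def by blast
  then show ?thesis
    by (simp add: up_topology_def topology_inverse')
qed

lemma openin_down_topology:
  "openin (down_topology X) U \<longleftrightarrow> openin (topol X) U \<and> down_set X U"
proof -
  have "istopology (\<lambda>U. openin (topol X) U \<and> down_set X U)"
    unfolding istopology_def down_set_def by blast
  then show ?thesis
    by (simp add: down_topology_def topology_inverse')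
qed

definition clopen_up_sets :: "('a, 'b) ord_space_scheme \<Rightarrow> 'a set set" where
  "clopen_up_sets X = {U. openin (topol X) U \<and> closedin (topol X) U \<and> up_set X U}"


section \<open>\<open>\<ominus>\<close>-spaces\<close>

text \<open>
  The partial operations are total functions whose values matter only on \<open>plus_dom\<close> and
  \<open>star_dom\<close>; these domains are determined by the order and \<open>neg\<close>, the map written \<open>i\<close> in the
  literature.
\<close>

record 'a ominus_sp = "'a ord_space" +
  neg :: "'a \<Rightarrow> 'a"
  splus :: "'a \<Rightarrow> 'a \<Rightarrow> 'a" (infixl \<open>\<oplus>\<index>\<close> 65)
  sstar :: "'a \<Rightarrow> 'a \<Rightarrow> 'a" (infixl \<open>\<star>\<index>\<close> 70)

definition plus_dom :: "'a ominus_sp \<Rightarrow> ('a \<times> 'a) set" where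
  "plus_dom X = {(x, y). x \<in> carrier X \<and> y \<in> carrier X \<and> y \<sqsubseteq>\<^bsub>X\<^esub> neg X x}"

definition star_dom :: "'a ominus_sp \<Rightarrow> ('a \<times> 'a) set" where
  "star_dom X = {(x, y). x \<in> carrier X \<and> y \<in> carrier X \<and> \<not> neg X x \<sqsubseteq>\<^bsub>X\<^esub> y}"

definition mono_on_dom ::
  "('a, 'b) gorder_scheme \<Rightarrow> ('a \<times> 'a) set \<Rightarrow> ('a \<Rightarrow> 'a \<Rightarrow> 'a) \<Rightarrow> bool" where
  "mono_on_dom X S f \<longleftrightarrow>
    (\<forall>x x' y. (x, y) \<in> S \<and> (x', y) \<in> S \<and> x \<sqsubseteq>\<^bsub>X\<^esub> x' \<longrightarrow> f x y \<sqsubseteq>\<^bsub>X\<^esub> f x' y) \<and>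
    (\<forall>x y y'. (x, y) \<in> S \<and> (x, y') \<in> S \<and> y \<sqsubseteq>\<^bsub>X\<^esub> y' \<longrightarrow> f x y \<sqsubseteq>\<^bsub>X\<^esub> f x y')"

locale ominus_space = priestley_space X for X :: "'a ominus_sp" (structure) +
  assumes neg_continuous: "continuous_map (topol X) (topol X) (neg X)"
    and neg_antitone: "\<lbrakk>x \<in> carrier X; y \<in> carrier X; x \<sqsubseteq> y\<rbrakk> \<Longrightarrow> neg X y \<sqsubseteq> neg X x"
    and plus_upper_continuous:
      "continuous_map
        (subtopology (prod_topology (up_topology X) (up_topology X)) (plus_dom X))
        (up_topology X) (\<lambda>(x, y). x \<oplus> y)"
    and star_lower_continuous:
      "continuous_map
        (subtopology (prod_topology (down_topology X) (down_topology X)) (star_dom X))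
        (down_topology X) (\<lambda>(x, y). x \<star> y)"
    and plus_mono: "mono_on_dom X (plus_dom X) (\<oplus>)"
    and star_mono: "mono_on_dom X (star_dom X) (\<star>)"
    and star_is_inf: "(x, y) \<in> star_dom X
      \<Longrightarrow> is_glb X (x \<star> y) {x \<oplus> w | w. (x, w) \<in> plus_dom X \<and> \<not> w \<sqsubseteq> y}"
    and plus_above: "(x, w) \<in> plus_dom X \<Longrightarrow> x \<sqsubseteq> x \<oplus> w"
    and plus_total: "\<lbrakk>(x, w) \<in> plus_dom X; (x, w') \<in> plus_dom X\<rbrakk>
      \<Longrightarrow> x \<oplus> w \<sqsubseteq> x \<oplus> w' \<or> x \<oplus> w' \<sqsubseteq> x \<oplus> w"
    and plus_upper_adjoint: "x \<in> carrier X \<Longrightarrow>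
      \<exists>R \<in> {z \<in> carrier X. x \<sqsubseteq> z} \<rightarrow> {w \<in> carrier X. w \<sqsubseteq> neg X x}.
        \<forall>w \<in> {w \<in> carrier X. w \<sqsubseteq> neg X x}. \<forall>z \<in> {z \<in> carrier X. x \<sqsubseteq> z}.
          x \<oplus> w \<sqsubseteq> z \<longleftrightarrow> w \<sqsubseteq> R z"

definition ominus_sp_hom :: "'a ominus_sp \<Rightarrow> 'b ominus_sp \<Rightarrow> ('a \<Rightarrow> 'b) \<Rightarrow> bool" where
  "ominus_sp_hom X Y f \<longleftrightarrow>
    continuous_map (topol X) (topol Y) f \<and>
    (\<forall>x \<in> carrier X. \<forall>y \<in> carrier X. x \<sqsubseteq>\<^bsub>X\<^esub> y \<longrightarrow> f x \<sqsubseteq>\<^bsub>Y\<^esub> f y) \<and>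
    (\<forall>x \<in> carrier X. f (neg X x) = neg Y (f x)) \<and>
    (\<forall>x y. (x, y) \<in> plus_dom X \<longrightarrow> f x \<oplus>\<^bsub>Y\<^esub> f y \<sqsubseteq>\<^bsub>Y\<^esub> f (x \<oplus>\<^bsub>X\<^esub> y)) \<and>
    (\<forall>x \<in> carrier X. \<forall>z \<in> carrier Y. (f x, z) \<in> plus_dom Y \<longrightarrow>
      (\<exists>w \<in> carrier X. (x, w) \<in> plus_dom X \<and> z \<sqsubseteq>\<^bsub>Y\<^esub> f w \<and>
        f (x \<oplus>\<^bsub>X\<^esub> w) = f x \<oplus>\<^bsub>Y\<^esub> z))"

definition ominus_sp_cat :: "('a ominus_sp, 'a \<Rightarrow> 'a) cat" where
  "ominus_sp_cat =
    \<lparr>Ob = {X. ominus_space X},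
     Hom = (\<lambda>X Y. {f \<in> extensional (carrier X). ominus_sp_hom X Y f}),
     Ident = (\<lambda>X. \<lambda>x \<in> carrier X. x),
     Comp = (\<lambda>X Y Z g f. compose (carrier X) g f)\<rparr>"


section \<open>Size\<close>

text \<open>
  An object is a structure on a subset of a type, and the dual of an algebra lives on a set of
  subsets of that algebra, so all objects over one type cannot in general form both sides of
  the duality. There are two readings of ``the category of all'' objects.

  With universes: \<open>'u\<close> is closed under power sets of small sets, where a set is small if it is
  less numerous than \<open>'u\<close> (Grothendieck universes are closed in this sense; nothing else is
  needed of them), and both categories consist of the small objects in \<open>'u\<close>.

  Without universes: for an arbitrary type \<open>'a\<close>, all algebras with carrier in \<open>'a\<close> correspond
  to the spaces whose clopen up-sets are at most as many as the elements of \<open>'a\<close>. Such a space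
  has a copy with carrier in \<open>'a set\<close>, since a point of a Priestley space is determined by the
  clopen up-sets that contain it. Every algebra and every space is covered when \<open>'a\<close> is large
  enough.
\<close>

definition power_closed_universe :: "'u set \<Rightarrow> bool" where
  "power_closed_universe U \<longleftrightarrow> (\<forall>S. S \<subseteq> U \<and> S \<prec> U \<longrightarrow> Pow S \<prec> U)"

definition small_carrier :: "('u, 'b) partial_object_scheme \<Rightarrow> bool" where
  "small_carrier A \<longleftrightarrow> carrier A \<prec> (UNIV :: 'u set)"

end

theory Submission
  imports Defs
begin

text \<open>
  The points of the dual space of an algebra \<open>A\<close> are its prime ideals, ordered by inclusion, and
  \<open>a \<in> A\<close> corresponds to the clopen down-set of the prime ideals that do not contain \<open>a\<close>. On
  prime ideals, \<open>i(I) = {b. \<top> \<ominus> b \<notin> I}\<close>, \<open>I + J = {a. \<exists>b \<in> J. a \<ominus> b \<in> I}\<close> and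
  \<open>I \<star> J = {a. \<forall>b \<notin> J. a \<ominus> b \<in> I}\<close>; the upper adjoint of \<open>J \<mapsto> I + J\<close> sends \<open>K\<close> to
  \<open>{b. \<forall>a \<notin> K. a \<ominus> b \<notin> I}\<close>. In the other direction, clopen down-sets of a space are subtracted by
  \<open>U \<ominus> V = {x. \<exists>w \<le> i(x). w \<notin> V \<and> x + w \<in> U}\<close>. This set is closed by upper continuity of \<open>+\<close>. It is
  open by lower continuity of \<open>\<star>\<close>, because membership of \<open>x\<close> is detected by \<open>x \<star> y \<in> U\<close> for all
  \<open>y \<in> V\<close>: compactness of \<open>V\<close>, the chain condition and the adjoint combine the witnesses for the
  various \<open>y\<close> into one \<open>w\<close>.
\<close>

section \<open>Dual equivalences from spans\<close>

text \<open>Everything rests on one symmetric notion, \<open>dual_pair\<close>: a bijection from the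
  carrier of an algebra onto the clopen down-sets of a space that turns the order into inclusion and
  \<open>\<ominus>\<close> into subtraction of down-sets. Both constructions of a dual produce such
  a pair, and arrows are dualised between arbitrary pairs, so neither construction has to be made
  functorial by itself. The obstacle behind this form is size: the points of a dual space are sets
  of elements, and the two readings of the theorem house them in different types. Hence pairs are
  built along arbitrary bijections with an index set, and objects are matched by choice. Unit and
  counit are then dual to identities, between two pairs that share a component. The delicate axioms
  on the side of spaces have a common source: given a prime ideal \<open>I\<close> and a suitable
  set \<open>M\<close>, there is a largest prime ideal \<open>J\<close> whose sum with
  \<open>I\<close> misses \<open>M\<close> (\<open>prime_residual\<close>). It supplies the upper
  adjoint, the infimum formula for \<open>\<star>\<close>, the representation of
  \<open>\<ominus>\<close> and the lifting condition for morphisms.\<close>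

lemma category_opposite: "category C \<Longrightarrow> category (opposite C)"
  by (simp add: category_def opposite_def)

lemma category_full_subcat: "category C \<Longrightarrow> category (full_subcat C P)"
  by (simp add: category_def full_subcat_def)

text \<open>
  The elements of \<open>P\<close> are the pairs of an object of \<open>C\<close> and an object of \<open>D\<close> together with a
  witness that they are dual to each other; \<open>T p q h f\<close> says that the arrows \<open>h\<close> and \<open>f\<close> are
  dual with respect to the witnesses \<open>p\<close> and \<open>q\<close>. Functors in both directions arise by choosing
  a pair for every object.
\<close>

locale duality_span = C: category C + D: category D
  for C :: "('o, 'm) cat" and D :: "('p, 'n) cat" +
  fixes P :: "'r set" and left :: "'r \<Rightarrow> 'o" and right :: "'r \<Rightarrow> 'p"
    and T :: "'r \<Rightarrow> 'r \<Rightarrow> 'm \<Rightarrow> 'n \<Rightarrow> bool"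
  assumes left_ob: "p \<in> P \<Longrightarrow> left p \<in> Ob C"
    and right_ob: "p \<in> P \<Longrightarrow> right p \<in> Ob D"
    and left_surj: "a \<in> Ob C \<Longrightarrow> \<exists>p \<in> P. left p = a"
    and right_surj: "x \<in> Ob D \<Longrightarrow> \<exists>p \<in> P. right p = x"
    and dual_ex1: "\<lbrakk>p \<in> P; q \<in> P; h \<in> Hom C (left p) (left q)\<rbrakk>
      \<Longrightarrow> \<exists>!f. f \<in> Hom D (right q) (right p) \<and> T p q h f"
    and codual_ex1: "\<lbrakk>p \<in> P; q \<in> P; f \<in> Hom D (right q) (right p)\<rbrakk>
      \<Longrightarrow> \<exists>!h. h \<in> Hom C (left p) (left q) \<and> T p q h f"
    and T_ident: "p \<in> P \<Longrightarrow> T p p (Ident C (left p)) (Ident D (right p))"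
    and T_comp: "\<lbrakk>p \<in> P; q \<in> P; r \<in> P;
        h \<in> Hom C (left p) (left q); k \<in> Hom C (left q) (left r);
        f \<in> Hom D (right q) (right p); g \<in> Hom D (right r) (right q);
        T p q h f; T q r k g\<rbrakk>
      \<Longrightarrow> T p r (Comp C (left p) (left q) (left r) k h)
            (Comp D (right r) (right q) (right p) f g)"
begin

definition dual :: "'r \<Rightarrow> 'r \<Rightarrow> 'm \<Rightarrow> 'n" where
  "dual p q h = (THE f. f \<in> Hom D (right q) (right p) \<and> T p q h f)"

definition codual :: "'r \<Rightarrow> 'r \<Rightarrow> 'n \<Rightarrow> 'm" where
  "codual p q f = (THE h. h \<in> Hom C (left p) (left q) \<and> T p q h f)"

lemma
  assumes "p \<in> P" "q \<in> P" "h \<in> Hom C (left p) (left q)"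
  shows dual_hom: "dual p q h \<in> Hom D (right q) (right p)"
    and T_dual: "T p q h (dual p q h)"
  using theI'[OF dual_ex1[OF assms]] by (simp_all add: dual_def)

lemma dual_eq:
  assumes "p \<in> P" "q \<in> P" "h \<in> Hom C (left p) (left q)"
    and "f \<in> Hom D (right q) (right p)" "T p q h f"
  shows "dual p q h = f"
  using assms dual_ex1[OF assms(1-3)] dual_hom[OF assms(1-3)] T_dual[OF assms(1-3)] by blast

lemma
  assumes "p \<in> P" "q \<in> P" "f \<in> Hom D (right q) (right p)"
  shows codual_hom: "codual p q f \<in> Hom C (left p) (left q)"
    and T_codual: "T p q (codual p q f) f"
  using theI'[OF codual_ex1[OF assms]] by (simp_all add: codual_def)

lemma codual_eq:
  assumes "p \<in> P" "q \<in> P" "h \<in> Hom C (left p) (left q)"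
    and "f \<in> Hom D (right q) (right p)" "T p q h f"
  shows "codual p q f = h"
  using assms codual_ex1[OF assms(1,2,4)] codual_hom[OF assms(1,2,4)]
    T_codual[OF assms(1,2,4)] by blast

lemma dual_codual:
  assumes "p \<in> P" "q \<in> P" "f \<in> Hom D (right q) (right p)"
  shows "dual p q (codual p q f) = f"
  using assms by (intro dual_eq codual_hom T_codual)

lemma codual_dual:
  assumes "p \<in> P" "q \<in> P" "h \<in> Hom C (left p) (left q)"
  shows "codual p q (dual p q h) = h"
  using assms by (intro codual_eq dual_hom T_dual)

lemma dual_ident: "p \<in> P \<Longrightarrow> dual p p (Ident C (left p)) = Ident D (right p)"
  by (intro dual_eq T_ident C.ident_hom D.ident_hom left_ob right_ob)

lemma codual_ident: "p \<in> P \<Longrightarrow> codual p p (Ident D (right p)) = Ident C (left p)"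
  by (intro codual_eq T_ident C.ident_hom D.ident_hom left_ob right_ob)

lemma dual_comp:
  assumes "p \<in> P" "q \<in> P" "r \<in> P"
    and "h \<in> Hom C (left p) (left q)" "k \<in> Hom C (left q) (left r)"
  shows "dual p r (Comp C (left p) (left q) (left r) k h) =
    Comp D (right r) (right q) (right p) (dual p q h) (dual q r k)"
  using assms
  by (intro dual_eq T_comp T_dual dual_hom C.comp_hom D.comp_hom left_ob right_ob)

lemma codual_comp:
  assumes "p \<in> P" "q \<in> P" "r \<in> P"
    and "f \<in> Hom D (right q) (right p)" "g \<in> Hom D (right r) (right q)"
  shows "codual p r (Comp D (right r) (right q) (right p) f g) =
    Comp C (left p) (left q) (left r) (codual q r g) (codual p q f)"
  using assms
  by (intro codual_eq T_comp T_codual codual_hom C.comp_hom D.comp_hom left_ob right_ob)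

text \<open>One algebra may occur in several pairs with different spaces. Its identity has a dual in
  each direction between the two spaces, and by \<open>dual_comp\<close> and
  \<open>dual_ident\<close> these are mutually inverse. The counit of the equivalence consists of
  such arrows.\<close>

lemma dual_ident_iso:
  assumes "p \<in> P" "q \<in> P" "left p = left q"
  shows "iso_arrow D (right p) (right q) (dual q p (Ident C (left p)))"
proof -
  define i where "i = Ident C (left p)"
  have i: "i \<in> Hom C (left p) (left q)" "i \<in> Hom C (left q) (left p)"
    "i = Ident C (left p)" "i = Ident C (left q)"
    "Comp C (left p) (left q) (left p) i i = i" "Comp C (left q) (left p) (left q) i i = i"
    using assms left_ob[of p] C.ident_hom[of "left p"]
      C.comp_ident_left[of "left p" "left p" "Ident C (left p)"]
    by (simp_all add: i_def)
  show ?thesis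
    unfolding iso_arrow_def i(3)[symmetric]
    using assms i dual_comp[of p q p i i] dual_comp[of q p q i i] dual_ident[of p]
    by (auto intro!: dual_hom bexI[of _ "dual p q i"] simp: dual_ident)
qed

text \<open>The mirror image for two pairs that share a space, which provides the unit. Passing to
  the opposite category keeps invertibility and only turns the arrow around.\<close>

lemma codual_ident_iso:
  assumes "p \<in> P" "q \<in> P" "right p = right q"
  shows "iso_arrow (opposite C) (left p) (left q) (codual q p (Ident D (right p)))"
proof -
  define i where "i = Ident D (right p)"
  have i: "i \<in> Hom D (right p) (right q)" "i \<in> Hom D (right q) (right p)"
    "i = Ident D (right p)" "i = Ident D (right q)"
    "Comp D (right p) (right q) (right p) i i = i" "Comp D (right q) (right p) (right q) i i = i"
    using assms right_ob[of p] D.ident_hom[of "right p"]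
      D.comp_ident_left[of "right p" "right p" "Ident D (right p)"]
    by (simp_all add: i_def)
  show ?thesis
    unfolding iso_arrow_def i(3)[symmetric] opposite_def
    using assms i codual_comp[of p q p i i] codual_comp[of q p q i i] codual_ident[of p]
    by (auto intro!: codual_hom bexI[of _ "codual p q i"] simp: codual_ident)
qed

theorem dually_equivalent: "dually_equivalent C D"
proof -
  obtain l where l: "\<And>a. a \<in> Ob C \<Longrightarrow> l a \<in> P" "\<And>a. a \<in> Ob C \<Longrightarrow> left (l a) = a"
    using left_surj by metis
  obtain r where r: "\<And>x. x \<in> Ob D \<Longrightarrow> r x \<in> P" "\<And>x. x \<in> Ob D \<Longrightarrow> right (r x) = x"
    using right_surj by metis
  define F where "F = \<lparr>on_ob = (\<lambda>a. right (l a)), on_hom = (\<lambda>a b. dual (l b) (l a))\<rparr>"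
  define G where "G = \<lparr>on_ob = (\<lambda>x. left (r x)), on_hom = (\<lambda>x y. codual (r y) (r x))\<rparr>"
  \<comment> \<open>The pair chosen for \<open>a\<close> and the pair chosen for its space
    \<open>right (l a)\<close> share that space but need not coincide; \<open>\<eta> a\<close> is
    dual to the identity of the shared space. For \<open>\<epsilon> x\<close> the shared component
    is the algebra \<open>left (r x)\<close>.\<close>
  define \<eta> where "\<eta> a = codual (r (right (l a))) (l a) (Ident D (right (l a)))" for a
  define \<epsilon> where "\<epsilon> x = dual (r x) (l (left (r x))) (Ident C (left (r x)))" for x
  have Fob: "a \<in> Ob C \<Longrightarrow> right (l a) \<in> Ob D" for a
    by (simp add: l right_ob)
  have Gob: "x \<in> Ob D \<Longrightarrow> left (r x) \<in> Ob C" for x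
    by (simp add: r left_ob)
  have id: "a \<in> Ob C \<Longrightarrow> dual (l a) (l a) (Ident C a) = Ident D (right (l a))"
    "x \<in> Ob D \<Longrightarrow> codual (r x) (r x) (Ident D x) = Ident C (left (r x))" for a x
    using dual_ident[of "l a"] codual_ident[of "r x"] by (simp_all add: l r)
  have F: "cat_functor (opposite C) D F"
  proof (rule cat_functor.intro)
    show "category (opposite C)" "category D"
      by (simp_all add: category_opposite C.category_axioms D.category_axioms)
    show "cat_functor_axioms (opposite C) D F"
    proof
      fix a b c f g
      assume "a \<in> Ob (opposite C)" "b \<in> Ob (opposite C)" "c \<in> Ob (opposite C)"
        "f \<in> Hom (opposite C) a b" "g \<in> Hom (opposite C) b c"
      then show "on_hom F a c (Comp (opposite C) a b c g f) =
          Comp D (on_ob F a) (on_ob F b) (on_ob F c) (on_hom F b c g) (on_hom F a b f)"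
        using dual_comp[of "l c" "l b" "l a" g f] by (simp add: F_def opposite_def l)
    qed (auto simp: F_def opposite_def l Fob id intro!: dual_hom)
  qed
  have G: "cat_functor D (opposite C) G"
  proof (rule cat_functor.intro)
    show "category (opposite C)" "category D"
      by (simp_all add: category_opposite C.category_axioms D.category_axioms)
    show "cat_functor_axioms D (opposite C) G"
    proof
      fix a b c f g
      assume "a \<in> Ob D" "b \<in> Ob D" "c \<in> Ob D" "f \<in> Hom D a b" "g \<in> Hom D b c"
      then show "on_hom G a c (Comp D a b c g f) =
          Comp (opposite C) (on_ob G a) (on_ob G b) (on_ob G c) (on_hom G b c g) (on_hom G a b f)"
        using codual_comp[of "r c" "r b" "r a" g f] by (simp add: G_def opposite_def r)
    qed (auto simp: G_def opposite_def r Gob id intro!: codual_hom)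
  qed
  have \<eta>: "natural_iso (opposite C) (opposite C) functor_id (functor_comp G F) \<eta>"
    unfolding natural_iso_def
  proof (intro conjI ballI)
    fix a assume a: "a \<in> Ob (opposite C)"
    then have "a \<in> Ob C" by (simp add: opposite_def)
    then show "iso_arrow (opposite C) (on_ob functor_id a) (on_ob (functor_comp G F) a) (\<eta> a)"
      using codual_ident_iso[of "l a" "r (right (l a))"]
      by (simp add: functor_id_def functor_comp_def F_def G_def \<eta>_def l r Fob)
    fix b f assume "b \<in> Ob (opposite C)" "f \<in> Hom (opposite C) a b"
    then have b: "b \<in> Ob C" and f: "f \<in> Hom C b a" by (simp_all add: opposite_def)
    note ab = \<open>a \<in> Ob C\<close> b
    let ?x = "right (l a)" and ?y = "right (l b)"
    have g: "dual (l b) (l a) f \<in> Hom D ?x ?y"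
      using ab f by (intro dual_hom) (simp_all add: l)
    \<comment> \<open>Naturality: both sides are the codual of one arrow of \<open>D\<close>,
      composed once with the identity after it and once with the identity before it.\<close>
    have "Comp C (left (r ?y)) b a f (\<eta> b) =
        codual (r ?y) (l a) (Comp D ?x ?y ?y (Ident D ?y) (dual (l b) (l a) f))"
      using codual_comp[of "r ?y" "l b" "l a" "Ident D ?y" "dual (l b) (l a) f"] ab f g
      by (simp add: \<eta>_def l r Fob D.ident_hom codual_dual)
    also have "\<dots> = codual (r ?y) (l a) (Comp D ?x ?x ?y (dual (l b) (l a) f) (Ident D ?x))"
      using ab g by (simp add: D.comp_ident_left D.comp_ident_right Fob)
    also have "\<dots> = Comp C (left (r ?y)) (left (r ?x)) a (\<eta> a)
        (codual (r ?y) (r ?x) (dual (l b) (l a) f))"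
      using codual_comp[of "r ?y" "r ?x" "l a" "dual (l b) (l a) f" "Ident D ?x"] ab g
      by (simp add: \<eta>_def l r Fob D.ident_hom)
    finally show "Comp (opposite C) (on_ob functor_id a) (on_ob functor_id b)
          (on_ob (functor_comp G F) b) (\<eta> b) (on_hom functor_id a b f) =
        Comp (opposite C) (on_ob functor_id a) (on_ob (functor_comp G F) a)
          (on_ob (functor_comp G F) b) (on_hom (functor_comp G F) a b f) (\<eta> a)"
      by (simp add: opposite_def functor_id_def functor_comp_def F_def G_def)
  qed
  have \<epsilon>: "natural_iso D D (functor_comp F G) functor_id \<epsilon>"
    unfolding natural_iso_def
  proof (intro conjI ballI)
    fix x assume x: "x \<in> Ob D"
    then show "iso_arrow D (on_ob (functor_comp F G) x) (on_ob functor_id x) (\<epsilon> x)"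
      using dual_ident_iso[of "l (left (r x))" "r x"]
      by (simp add: functor_id_def functor_comp_def F_def G_def \<epsilon>_def l r Gob)
    fix y f assume y: "y \<in> Ob D" and f: "f \<in> Hom D x y"
    let ?a = "left (r x)" and ?b = "left (r y)"
    have h: "codual (r y) (r x) f \<in> Hom C ?b ?a"
      using x y f by (intro codual_hom) (simp_all add: r)
    have "Comp D (right (l ?a)) (right (l ?b)) y (\<epsilon> y) (dual (l ?b) (l ?a) (codual (r y) (r x) f)) =
        dual (r y) (l ?a) (Comp C ?b ?b ?a (codual (r y) (r x) f) (Ident C ?b))"
      using dual_comp[of "r y" "l ?b" "l ?a" "Ident C ?b" "codual (r y) (r x) f"] x y h
      by (simp add: \<epsilon>_def l r Gob C.ident_hom)
    also have "\<dots> = dual (r y) (l ?a) (Comp C ?b ?a ?a (Ident C ?a) (codual (r y) (r x) f))"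
      using x y h by (simp add: C.comp_ident_left C.comp_ident_right Gob)
    also have "\<dots> = Comp D (right (l ?a)) x y f (\<epsilon> x)"
      using dual_comp[of "r y" "r x" "l ?a" "codual (r y) (r x) f" "Ident C ?a"] x y f h
      by (simp add: \<epsilon>_def l r Gob C.ident_hom dual_codual)
    finally show "Comp D (on_ob (functor_comp F G) x) (on_ob (functor_comp F G) y)
          (on_ob functor_id y) (\<epsilon> y) (on_hom (functor_comp F G) x y f) =
        Comp D (on_ob (functor_comp F G) x) (on_ob functor_id x) (on_ob functor_id y)
          (on_hom functor_id x y f) (\<epsilon> x)"
      by (simp add: functor_id_def functor_comp_def F_def G_def)
  qed
  show ?thesis
    unfolding dually_equivalent_def equivalent_cats_def
    using C.category_axioms D.category_axioms F G \<eta> \<epsilon> by blast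
qed

end

section \<open>The categories of algebras and of spaces\<close>

lemma category_ominus_alg: "category (ominus_alg_cat :: ('a ominus_alg, 'a \<Rightarrow> 'a) cat)"
proof (rule category.intro)
  fix A :: "'a ominus_alg" assume "A \<in> Ob ominus_alg_cat"
  then interpret ominus_algebra A by (simp add: ominus_alg_cat_def)
  show "Ident ominus_alg_cat A \<in> Hom ominus_alg_cat A A"
    by (simp add: ominus_alg_cat_def ominus_alg_hom_def ominus_closed)
next
  fix A B C :: "'a ominus_alg" and f g
  assume "A \<in> Ob ominus_alg_cat" and f: "f \<in> Hom ominus_alg_cat A B"
    and g: "g \<in> Hom ominus_alg_cat B C"
  then interpret ominus_algebra A by (simp add: ominus_alg_cat_def)
  show "Comp ominus_alg_cat A B C g f \<in> Hom ominus_alg_cat A C"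
    using f g by (auto simp: ominus_alg_cat_def ominus_alg_hom_def compose_def Pi_iff ominus_closed)
next
  fix A B :: "'a ominus_alg" and f assume f: "f \<in> Hom ominus_alg_cat A B"
  then show "Comp ominus_alg_cat A A B f (Ident ominus_alg_cat A) = f"
    "Comp ominus_alg_cat A B B (Ident ominus_alg_cat B) f = f"
    by (auto simp: ominus_alg_cat_def ominus_alg_hom_def
        intro!: compose_Id Id_compose[of _ "carrier A" "carrier B"])
next
  fix A B C D :: "'a ominus_alg" and f g h
  assume "f \<in> Hom ominus_alg_cat A B"
  then show "Comp ominus_alg_cat A C D h (Comp ominus_alg_cat A B C g f) =
      Comp ominus_alg_cat A B D (Comp ominus_alg_cat B C D h g) f"
    by (auto simp: ominus_alg_cat_def ominus_alg_hom_def compose_def Pi_iff)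
qed

lemma (in priestley_space) continuous_map_carrier:
  assumes "continuous_map T (topol X) f" "x \<in> topspace T"
  shows "f x \<in> carrier X"
  using assms continuous_map_funspace topspace_eq by blast

lemma (in priestley_space) topspace_up_topology: "topspace (up_topology X) = carrier X"
proof -
  have "openin (up_topology X) (carrier X)"
    using openin_topspace[of "topol X"] by (auto simp: openin_up_topology up_set_def topspace_eq)
  moreover have "U \<subseteq> carrier X" if "openin (up_topology X) U" for U
    using that by (simp add: openin_up_topology up_set_def)
  ultimately show ?thesis
    by (metis openin_subset openin_topspace subset_antisym)
qed

lemma (in priestley_space) topspace_down_topology: "topspace (down_topology X) = carrier X"
proof -
  have "openin (down_topology X) (carrier X)"
    using openin_topspace[of "topol X"] by (auto simp: openin_down_topology down_set_def topspace_eq)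
  moreover have "U \<subseteq> carrier X" if "openin (down_topology X) U" for U
    using that by (simp add: openin_down_topology down_set_def)
  ultimately show ?thesis
    by (metis openin_subset openin_topspace subset_antisym)
qed

context ominus_space
begin

lemma neg_closed: "x \<in> carrier X \<Longrightarrow> neg X x \<in> carrier X"
  using continuous_map_carrier[OF neg_continuous] by (simp add: topspace_eq)

lemma plus_closed: assumes "(x, y) \<in> plus_dom X" shows "x \<oplus> y \<in> carrier X"
proof -
  have "plus_dom X \<subseteq> carrier X \<times> carrier X"
    by (auto simp: plus_dom_def)
  then show ?thesis
    using funcset_mem[OF continuous_map_funspace[OF plus_upper_continuous], of "(x, y)"] assms
    by (auto simp: topspace_up_topology)
qed

lemma star_closed: assumes "(x, y) \<in> star_dom X" shows "x \<star> y \<in> carrier X"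
proof -
  have "star_dom X \<subseteq> carrier X \<times> carrier X"
    by (auto simp: star_dom_def)
  then show ?thesis
    using funcset_mem[OF continuous_map_funspace[OF star_lower_continuous], of "(x, y)"] assms
    by (auto simp: topspace_down_topology)
qed

text \<open>Lowering the first argument raises its image under \<open>neg\<close>, so the smaller
  pair is in the domain automatically; \<open>plus_mono\<close> by itself presupposes both pairs
  there.\<close>

lemma plus_mono_left:
  assumes "(x', y) \<in> plus_dom X" "x \<in> carrier X" "x \<sqsubseteq> x'"
  shows "(x, y) \<in> plus_dom X" "x \<oplus> y \<sqsubseteq> x' \<oplus> y"
proof -
  show "(x, y) \<in> plus_dom X"
    using assms neg_antitone[of x x'] neg_closed
    unfolding plus_dom_def by (auto intro: le_trans)
  then show "x \<oplus> y \<sqsubseteq> x' \<oplus> y"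
    using assms plus_mono unfolding mono_on_dom_def by blast
qed

end

lemma ominus_sp_hom_closed:
  assumes "ominus_space X" "ominus_space Y" "ominus_sp_hom X Y f" "x \<in> carrier X"
  shows "f x \<in> carrier Y"
proof -
  interpret X: ominus_space X by fact
  interpret Y: ominus_space Y by fact
  show ?thesis
    using assms(3,4) Y.continuous_map_carrier[of "topol X" f x]
    by (simp add: ominus_sp_hom_def X.topspace_eq)
qed

text \<open>Monotonicity and compatibility with \<open>neg\<close> carry
  \<open>y \<sqsubseteq> neg X x\<close> over to \<open>Y\<close>. This is why the sum
  \<open>f x \<oplus> f y\<close> in the definition of a morphism is a genuine value.\<close>

lemma ominus_sp_hom_plus_dom:
  assumes "ominus_space X" "ominus_space Y" "ominus_sp_hom X Y f" "(x, y) \<in> plus_dom X"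
  shows "(f x, f y) \<in> plus_dom Y"
proof -
  interpret X: ominus_space X by fact
  have xy: "x \<in> carrier X" "y \<in> carrier X" "y \<sqsubseteq>\<^bsub>X\<^esub> neg X x"
    using assms(4) by (auto simp: plus_dom_def)
  then have "f y \<sqsubseteq>\<^bsub>Y\<^esub> f (neg X x)" "f (neg X x) = neg Y (f x)"
    using assms(3) X.neg_closed[of x] unfolding ominus_sp_hom_def by blast+
  then show ?thesis
    using xy ominus_sp_hom_closed[OF assms(1-3)] by (simp add: plus_dom_def)
qed

lemma ominus_sp_hom_compose:
  assumes "ominus_space X" "ominus_space Y" "ominus_space Z"
    and f: "ominus_sp_hom X Y f" and g: "ominus_sp_hom Y Z g"
  shows "ominus_sp_hom X Z (compose (carrier X) g f)"
proof -
  interpret X: ominus_space X by fact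
  interpret Y: ominus_space Y by fact
  interpret Z: ominus_space Z by fact
  note fc = ominus_sp_hom_closed[OF assms(1,2) f] and gc = ominus_sp_hom_closed[OF assms(2,3) g]
  note fd = ominus_sp_hom_plus_dom[OF assms(1,2) f] and gd = ominus_sp_hom_plus_dom[OF assms(2,3) g]
  have eq: "compose (carrier X) g f x = g (f x)" if "x \<in> carrier X" for x
    using that by (simp add: compose_def)
  show ?thesis
    unfolding ominus_sp_hom_def
  proof (intro conjI ballI allI impI)
    show "continuous_map (topol X) (topol Z) (compose (carrier X) g f)"
      by (rule continuous_map_eq[of _ _ "g \<circ> f"])
        (use f g eq in \<open>auto simp: ominus_sp_hom_def X.topspace_eq intro: continuous_map_compose\<close>)
  next
    fix x y assume "x \<in> carrier X" "y \<in> carrier X" "x \<sqsubseteq>\<^bsub>X\<^esub> y"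
    then show "compose (carrier X) g f x \<sqsubseteq>\<^bsub>Z\<^esub> compose (carrier X) g f y"
      using f g fc by (simp add: eq ominus_sp_hom_def)
  next
    fix x assume "x \<in> carrier X"
    then show "compose (carrier X) g f (neg X x) = neg Z (compose (carrier X) g f x)"
      using f g fc X.neg_closed by (simp add: eq ominus_sp_hom_def)
  next
    fix x y assume xy: "(x, y) \<in> plus_dom X"
    then have c: "x \<in> carrier X" "y \<in> carrier X" "x \<oplus>\<^bsub>X\<^esub> y \<in> carrier X"
      using X.plus_closed by (auto simp: plus_dom_def)
    have "g (f x) \<oplus>\<^bsub>Z\<^esub> g (f y) \<sqsubseteq>\<^bsub>Z\<^esub> g (f x \<oplus>\<^bsub>Y\<^esub> f y)"
      using g fd[OF xy] by (simp add: ominus_sp_hom_def)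
    moreover have "f x \<oplus>\<^bsub>Y\<^esub> f y \<sqsubseteq>\<^bsub>Y\<^esub> f (x \<oplus>\<^bsub>X\<^esub> y)"
      using f xy by (simp add: ominus_sp_hom_def)
    then have "g (f x \<oplus>\<^bsub>Y\<^esub> f y) \<sqsubseteq>\<^bsub>Z\<^esub> g (f (x \<oplus>\<^bsub>X\<^esub> y))"
      using g fc c Y.plus_closed[OF fd[OF xy]] by (simp add: ominus_sp_hom_def)
    ultimately show "compose (carrier X) g f x \<oplus>\<^bsub>Z\<^esub> compose (carrier X) g f y
        \<sqsubseteq>\<^bsub>Z\<^esub> compose (carrier X) g f (x \<oplus>\<^bsub>X\<^esub> y)"
      using Z.le_trans c gc fc Z.plus_closed[OF gd[OF fd[OF xy]]]
        Y.plus_closed[OF fd[OF xy]] by (metis eq)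
  next
    fix x z assume x: "x \<in> carrier X" and z: "z \<in> carrier Z"
      and d: "(compose (carrier X) g f x, z) \<in> plus_dom Z"
    have "(g (f x), z) \<in> plus_dom Z"
      using d by (simp add: eq[OF x])
    \<comment> \<open>The lifting property is used twice: \<open>z\<close> is lifted along
      \<open>g\<close> to \<open>w\<close>, and \<open>w\<close> along \<open>f\<close> to
      \<open>v\<close>.\<close>
    then obtain w where w: "w \<in> carrier Y" "(f x, w) \<in> plus_dom Y" "z \<sqsubseteq>\<^bsub>Z\<^esub> g w"
      "g (f x \<oplus>\<^bsub>Y\<^esub> w) = g (f x) \<oplus>\<^bsub>Z\<^esub> z"
      using g fc[OF x] z unfolding ominus_sp_hom_def by blast
    obtain v where v: "v \<in> carrier X" "(x, v) \<in> plus_dom X" "w \<sqsubseteq>\<^bsub>Y\<^esub> f v"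
      "f (x \<oplus>\<^bsub>X\<^esub> v) = f x \<oplus>\<^bsub>Y\<^esub> w"
      using f x w(1,2) unfolding ominus_sp_hom_def by blast
    have "g w \<sqsubseteq>\<^bsub>Z\<^esub> g (f v)"
      using g w v fc by (simp add: ominus_sp_hom_def)
    then have "z \<sqsubseteq>\<^bsub>Z\<^esub> g (f v)"
      using w v z gc fc by (meson Z.le_trans)
    then show "\<exists>w\<in>carrier X. (x, w) \<in> plus_dom X \<and> z \<sqsubseteq>\<^bsub>Z\<^esub> compose (carrier X) g f w \<and>
        compose (carrier X) g f (x \<oplus>\<^bsub>X\<^esub> w) = compose (carrier X) g f x \<oplus>\<^bsub>Z\<^esub> z"
      using v w x X.plus_closed[OF v(2)] by (auto simp: eq intro!: bexI[of _ v])
  qed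
qed

lemma category_ominus_sp: "category (ominus_sp_cat :: ('a ominus_sp, 'a \<Rightarrow> 'a) cat)"
proof (rule category.intro)
  fix X :: "'a ominus_sp" assume "X \<in> Ob ominus_sp_cat"
  then interpret ominus_space X by (simp add: ominus_sp_cat_def)
  have "continuous_map (topol X) (topol X) (\<lambda>x\<in>carrier X. x)"
    by (rule continuous_map_eq[of _ _ "\<lambda>x. x"]) (auto simp: topspace_eq)
  then show "Ident ominus_sp_cat X \<in> Hom ominus_sp_cat X X"
    by (auto simp: ominus_sp_cat_def ominus_sp_hom_def plus_closed neg_closed)
      (auto simp: plus_dom_def plus_closed neg_closed)
next
  fix X Y Z :: "'a ominus_sp" and f g
  assume "X \<in> Ob ominus_sp_cat" "Y \<in> Ob ominus_sp_cat" "Z \<in> Ob ominus_sp_cat"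
    and "f \<in> Hom ominus_sp_cat X Y" and "g \<in> Hom ominus_sp_cat Y Z"
  then show "Comp ominus_sp_cat X Y Z g f \<in> Hom ominus_sp_cat X Z"
    by (auto simp: ominus_sp_cat_def intro: ominus_sp_hom_compose)
next
  fix X Y :: "'a ominus_sp" and f
  assume "X \<in> Ob ominus_sp_cat" "Y \<in> Ob ominus_sp_cat" "f \<in> Hom ominus_sp_cat X Y"
  then show "Comp ominus_sp_cat X X Y f (Ident ominus_sp_cat X) = f"
    "Comp ominus_sp_cat X Y Y (Ident ominus_sp_cat Y) f = f"
    using ominus_sp_hom_closed[of X Y f]
    by (auto simp: ominus_sp_cat_def
        intro!: compose_Id Id_compose[of _ "carrier X" "carrier Y"])
next
  fix X Y Z W :: "'a ominus_sp" and f g h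
  assume "X \<in> Ob ominus_sp_cat" "Y \<in> Ob ominus_sp_cat" "f \<in> Hom ominus_sp_cat X Y"
  then show "Comp ominus_sp_cat X Z W h (Comp ominus_sp_cat X Y Z g f) =
      Comp ominus_sp_cat X Y W (Comp ominus_sp_cat Y Z W h g) f"
    using ominus_sp_hom_closed[of X Y f] by (auto simp: ominus_sp_cat_def compose_def)
qed

section \<open>Separation in Priestley spaces\<close>

text \<open>The extra factor \<open>S\<close> gives the empty family a value in \<open>B\<close>,
  since the intersection of no sets is the whole type.\<close>

lemma finite_Int_closed:
  assumes "finite F" "F \<subseteq> B" "S \<in> B" "\<And>U V. \<lbrakk>U \<in> B; V \<in> B\<rbrakk> \<Longrightarrow> U \<inter> V \<in> B"
  shows "S \<inter> \<Inter>F \<in> B"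
  using assms(1,2)
proof (induction F)
  case (insert U F)
  then have "U \<inter> (S \<inter> \<Inter>F) \<in> B" using assms(4) by simp
  then show ?case by (simp add: Int_left_commute)
qed (simp add: assms(3))

lemma finite_Un_closed:
  assumes "finite F" "F \<subseteq> B" "{} \<in> B" "\<And>U V. \<lbrakk>U \<in> B; V \<in> B\<rbrakk> \<Longrightarrow> U \<union> V \<in> B"
  shows "\<Union>F \<in> B"
  using assms(1,2) by (induction F) (auto simp: assms(3,4))

text \<open>Compactness is used twice: for fixed \<open>x\<close>, finitely many members of
  \<open>B\<close> containing \<open>x\<close> together exclude \<open>C\<close>; then finitely many
  of the resulting neighbourhoods cover \<open>K\<close>. The family \<open>B\<close> is left open
  because the lemma is applied to clopen down-sets, to families closed under complement, and to the
  sets \<open>\<phi> a\<close> of a spectrum before these are known to be all its clopen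
  down-sets.\<close>

lemma compact_space_separation:
  assumes T: "compact_space T" and K: "closedin T K" and C: "closedin T C"
    and clopen: "\<And>U. U \<in> B \<Longrightarrow> openin T U \<and> closedin T U"
    and B: "{} \<in> B" "topspace T \<in> B"
      "\<And>U V. \<lbrakk>U \<in> B; V \<in> B\<rbrakk> \<Longrightarrow> U \<union> V \<in> B" "\<And>U V. \<lbrakk>U \<in> B; V \<in> B\<rbrakk> \<Longrightarrow> U \<inter> V \<in> B"
    and sep: "\<And>x y. \<lbrakk>x \<in> K; y \<in> C\<rbrakk> \<Longrightarrow> \<exists>U \<in> B. x \<in> U \<and> y \<notin> U"
  shows "\<exists>U \<in> B. K \<subseteq> U \<and> U \<inter> C = {}"
proof -
  have K': "compactin T K" and C': "compactin T C"
    using T K C closedin_compact_space by blast+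
  have "\<exists>U \<in> B. x \<in> U \<and> U \<inter> C = {}" if x: "x \<in> K" for x
  proof -
    let ?\<V> = "(\<lambda>U. topspace T - U) ` {U \<in> B. x \<in> U}"
    have "C \<subseteq> \<Union>?\<V>"
      using sep[OF x] closedin_subset[OF C] by fastforce
    then obtain \<F> where \<F>: "finite \<F>" "\<F> \<subseteq> ?\<V>" "C \<subseteq> \<Union>\<F>"
      using compactinD[OF C', of ?\<V>] clopen by blast
    from finite_subset_image[OF this(1,2)]
    obtain F where F: "F \<subseteq> {U \<in> B. x \<in> U}" "finite F" "\<F> = (\<lambda>U. topspace T - U) ` F"
      by blast
    have "topspace T \<inter> \<Inter>F \<in> B"
      by (rule finite_Int_closed) (use F B in auto)
    moreover have "x \<in> topspace T \<inter> \<Inter>F"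
      using x F(1) closedin_subset[OF K] by auto
    moreover have "(topspace T \<inter> \<Inter>F) \<inter> C = {}"
      using \<F>(3) F(3) by auto
    ultimately show ?thesis by blast
  qed
  then have "K \<subseteq> \<Union>{U \<in> B. U \<inter> C = {}}" by blast
  then obtain F where F: "finite F" "F \<subseteq> {U \<in> B. U \<inter> C = {}}" "K \<subseteq> \<Union>F"
    using compactinD[OF K', of "{U \<in> B. U \<inter> C = {}}"] clopen by blast
  have "\<Union>F \<in> B"
    by (rule finite_Un_closed) (use F B in auto)
  then show ?thesis using F by blast
qed

text \<open>Down-sets, although the size condition of the theorem counts
  \<open>clopen_up_sets\<close>: prime ideals are ordered by inclusion, so those omitting
  \<open>a\<close> form a down-set, and this set grows with \<open>a\<close>. Complementation
  mediates in \<open>clopen_up_sets_eq_complements\<close>.\<close>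

definition clopen_down_sets :: "('a, 'b) ord_space_scheme \<Rightarrow> 'a set set" where
  "clopen_down_sets X = {U. openin (topol X) U \<and> closedin (topol X) U \<and> down_set X U}"

context priestley_space
begin

lemma openin_subset_carrier: "openin (topol X) U \<Longrightarrow> U \<subseteq> carrier X"
  using openin_subset topspace_eq by metis

lemma closedin_carrier_iff:
  "closedin (topol X) U \<longleftrightarrow> U \<subseteq> carrier X \<and> openin (topol X) (carrier X - U)"
  by (simp add: closedin_def topspace_eq)

lemma clopen_down_sets_simps [simp]:
  "{} \<in> clopen_down_sets X" "carrier X \<in> clopen_down_sets X"
  "\<lbrakk>U \<in> clopen_down_sets X; V \<in> clopen_down_sets X\<rbrakk> \<Longrightarrow> U \<union> V \<in> clopen_down_sets X"
  "\<lbrakk>U \<in> clopen_down_sets X; V \<in> clopen_down_sets X\<rbrakk> \<Longrightarrow> U \<inter> V \<in> clopen_down_sets X"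
  using topspace_eq openin_topspace[of "topol X"] closedin_topspace[of "topol X"]
  by (auto simp: clopen_down_sets_def down_set_def)

lemma clopen_down_setsD:
  assumes "U \<in> clopen_down_sets X"
  shows "openin (topol X) U" "closedin (topol X) U" "U \<subseteq> carrier X"
    "openin (topol X) (carrier X - U)" "closedin (topol X) (carrier X - U)"
    "up_set X (carrier X - U)"
    "\<And>x y. \<lbrakk>y \<in> U; x \<in> carrier X; x \<sqsubseteq> y\<rbrakk> \<Longrightarrow> x \<in> U"
  using assms by (auto simp: clopen_down_sets_def down_set_def up_set_def closedin_carrier_iff
      double_diff)

text \<open>Another point is separated from \<open>x\<close> by a clopen down-set around it or, if
  it lies above \<open>x\<close>, by the complement of a clopen down-set around \<open>x\<close>;
  antisymmetry makes the second case work.\<close>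

lemma closedin_singleton: assumes "x \<in> carrier X" shows "closedin (topol X) {x}"
proof -
  have "\<exists>U. openin (topol X) U \<and> y \<in> U \<and> U \<subseteq> carrier X - {x}" if y: "y \<in> carrier X - {x}" for y
  proof (cases "x \<sqsubseteq> y")
    case False
    then obtain U where "openin (topol X) U" "y \<in> U" "x \<notin> U"
      using separation[of x y] assms y by blast
    then show ?thesis using openin_subset_carrier by blast
  next
    case True
    then have "\<not> y \<sqsubseteq> x" using assms y le_antisym by blast
    then obtain U where U: "closedin (topol X) U" "x \<in> U" "y \<notin> U"
      using separation[of y x] assms y by blast
    then have "openin (topol X) (carrier X - U)" by (simp add: closedin_carrier_iff)
    then show ?thesis using U y by blast
  qed
  then have "openin (topol X) (carrier X - {x})"
    by (subst openin_subopen) blast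
  then show ?thesis using assms by (simp add: closedin_carrier_iff)
qed

lemma clopen_down_separation:
  assumes "closedin (topol X) K" "closedin (topol X) C"
    and "\<And>x y. \<lbrakk>x \<in> K; y \<in> C\<rbrakk> \<Longrightarrow> \<not> y \<sqsubseteq> x"
  shows "\<exists>U \<in> clopen_down_sets X. K \<subseteq> U \<and> U \<inter> C = {}"
proof (rule compact_space_separation[OF compact assms(1,2)])
  show "\<exists>U \<in> clopen_down_sets X. x \<in> U \<and> y \<notin> U" if "x \<in> K" "y \<in> C" for x y
    using separation[of y x] assms that unfolding clopen_down_sets_def closedin_carrier_iff by blast
qed (auto simp: clopen_down_setsD topspace_eq)

text \<open>Meant for families given by a property such as having a clopen preimage under a map. If
  the property holds for clopen down-sets and survives Boolean operations, there are enough sets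
  with it to test continuity.\<close>

lemma clopen_basis:
  assumes "openin (topol X) W" "x \<in> W"
    and clopen: "\<And>U. U \<in> B \<Longrightarrow> openin (topol X) U \<and> closedin (topol X) U"
    and B: "\<And>U V. \<lbrakk>U \<in> B; V \<in> B\<rbrakk> \<Longrightarrow> U \<union> V \<in> B" "\<And>U V. \<lbrakk>U \<in> B; V \<in> B\<rbrakk> \<Longrightarrow> U \<inter> V \<in> B"
      "\<And>U. U \<in> B \<Longrightarrow> carrier X - U \<in> B"
      "clopen_down_sets X \<subseteq> B"
  shows "\<exists>U \<in> B. x \<in> U \<and> U \<subseteq> W"
proof -
  have W: "W \<subseteq> carrier X" using assms(1) by (rule openin_subset_carrier)
  have "\<exists>U \<in> B. {x} \<subseteq> U \<and> U \<inter> (carrier X - W) = {}"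
  proof (rule compact_space_separation[OF compact])
    show "closedin (topol X) {x}" using W assms(2) closedin_singleton by blast
    show "closedin (topol X) (carrier X - W)"
      using assms(1) W by (simp add: closedin_carrier_iff double_diff)
    fix x' y assume xy: "x' \<in> {x}" "y \<in> carrier X - W"
    show "\<exists>U \<in> B. x' \<in> U \<and> y \<notin> U"
    proof (cases "y \<sqsubseteq> x")
      case False
      then obtain U where "U \<in> clopen_down_sets X" "x \<in> U" "y \<notin> U"
        using separation[of y x] W assms(2) xy unfolding clopen_down_sets_def by blast
      then show ?thesis using B(4) xy by blast
    next
      case True
      then have "\<not> x \<sqsubseteq> y" using W assms(2) xy le_antisym by blast
      then obtain U where "U \<in> clopen_down_sets X" "x \<notin> U" "y \<in> U"
        using separation[of x y] W assms(2) xy unfolding clopen_down_sets_def by blast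
      then have "carrier X - U \<in> B" "x \<in> carrier X - U" "y \<notin> carrier X - U"
        using B W assms(2) by auto
      then show ?thesis using xy by blast
    qed
  qed (use clopen B topspace_eq clopen_down_sets_simps in auto)
  then obtain U where "U \<in> B" "x \<in> U" "U \<inter> (carrier X - W) = {}" by blast
  moreover have "U \<subseteq> carrier X" using clopen[OF \<open>U \<in> B\<close>] openin_subset_carrier by blast
  ultimately show ?thesis by (intro bexI[of _ U]) auto
qed

end

text \<open>Reduces continuity of a partial binary operation to boxes around single points. The same
  form serves to exploit the axioms of a given space and to prove them for the spectrum.\<close>

lemma continuous_map_rectangles:
  "continuous_map (subtopology (prod_topology S T) D) Z f \<longleftrightarrow>
    (\<forall>p \<in> (topspace S \<times> topspace T) \<inter> D. f p \<in> topspace Z) \<and>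
    (\<forall>W x y. openin Z W \<and> x \<in> topspace S \<and> y \<in> topspace T \<and> (x, y) \<in> D \<and> f (x, y) \<in> W \<longrightarrow>
      (\<exists>U V. openin S U \<and> openin T V \<and> x \<in> U \<and> y \<in> V \<and>
        (\<forall>x' \<in> U. \<forall>y' \<in> V. (x', y') \<in> D \<longrightarrow> f (x', y') \<in> W)))" (is "?l \<longleftrightarrow> ?r1 \<and> ?r2")
proof (intro iffI conjI)
  assume l: ?l
  then show ?r1
    using funcset_mem[OF continuous_map_funspace[OF l]] by auto
  show ?r2
  proof (intro allI impI)
    fix W x y
    assume a: "openin Z W \<and> x \<in> topspace S \<and> y \<in> topspace T \<and> (x, y) \<in> D \<and> f (x, y) \<in> W"
    then have "openin (subtopology (prod_topology S T) D)
        {p \<in> topspace (subtopology (prod_topology S T) D). f p \<in> W}"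
      using l by (auto simp: continuous_map_def)
    then obtain R where R: "openin (prod_topology S T) R"
      "{p \<in> topspace (subtopology (prod_topology S T) D). f p \<in> W} = R \<inter> D"
      by (auto simp: openin_subtopology)
    have "(x, y) \<in> R" using R(2) a by auto
    from openin_prod_topology_alt[THEN iffD1, OF R(1), rule_format, OF this]
    obtain U V where UV: "openin S U" "openin T V" "x \<in> U" "y \<in> V" "U \<times> V \<subseteq> R"
      by blast
    have "f p \<in> W" if "p \<in> (U \<times> V) \<inter> D" for p
      using R(2) UV(5) that by blast
    with UV show "\<exists>U V. openin S U \<and> openin T V \<and> x \<in> U \<and> y \<in> V \<and>
        (\<forall>x' \<in> U. \<forall>y' \<in> V. (x', y') \<in> D \<longrightarrow> f (x', y') \<in> W)"
      by (intro exI[of _ U] exI[of _ V]) simp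
  qed
next
  assume r: "?r1 \<and> ?r2"
  show ?l
    unfolding continuous_map_def
  proof (intro conjI allI impI)
    show "f \<in> topspace (subtopology (prod_topology S T) D) \<rightarrow> topspace Z"
      using r by auto
    fix W assume W: "openin Z W"
    let ?P = "{p \<in> topspace (subtopology (prod_topology S T) D). f p \<in> W}"
    show "openin (subtopology (prod_topology S T) D) ?P"
    proof (subst openin_subopen, intro ballI)
      fix p assume p: "p \<in> ?P"
      obtain x y where xy: "p = (x, y)" by (cases p)
      obtain U V where UV: "openin S U" "openin T V" "x \<in> U" "y \<in> V"
        "\<forall>x' \<in> U. \<forall>y' \<in> V. (x', y') \<in> D \<longrightarrow> f (x', y') \<in> W"
        using conjunct2[OF r, rule_format, of W x y] W p xy by auto
      have "openin (subtopology (prod_topology S T) D) ((U \<times> V) \<inter> D)"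
        unfolding openin_subtopology using UV
        by (intro exI[of _ "U \<times> V"]) (simp add: openin_prod_Times_iff)
      moreover have "(U \<times> V) \<inter> D \<subseteq> ?P"
        using UV openin_subset[of S U] openin_subset[of T V] by auto
      moreover have "p \<in> (U \<times> V) \<inter> D" using p xy UV by auto
      ultimately show "\<exists>T'. openin (subtopology (prod_topology S T) D) T' \<and> p \<in> T' \<and> T' \<subseteq> ?P"
        by blast
    qed
  qed
qed

section \<open>The algebra of clopen down-sets\<close>

text \<open>\<open>R\<close> is a ring of subsets of \<open>S\<close>, and \<open>\<phi>\<close> an
  order isomorphism onto it. The carrier is kept apart from \<open>R\<close> because the algebra has
  to live on a prescribed type. Bounds, joins and meets exist because \<open>R\<close> contains the
  corresponding sets.\<close>

locale set_lattice = partial_order A for A :: "('a, 'b) gorder_scheme" (structure) +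
  fixes \<phi> :: "'a \<Rightarrow> 's set" and R :: "'s set set" and S :: "'s set"
  assumes bij: "bij_betw \<phi> (carrier A) R"
    and le_iff: "\<lbrakk>a \<in> carrier A; b \<in> carrier A\<rbrakk> \<Longrightarrow> a \<sqsubseteq> b \<longleftrightarrow> \<phi> a \<subseteq> \<phi> b"
    and R_empty: "{} \<in> R" and R_full: "S \<in> R"
    and R_subset: "U \<in> R \<Longrightarrow> U \<subseteq> S"
    and R_Un: "\<lbrakk>U \<in> R; V \<in> R\<rbrakk> \<Longrightarrow> U \<union> V \<in> R"
    and R_Int: "\<lbrakk>U \<in> R; V \<in> R\<rbrakk> \<Longrightarrow> U \<inter> V \<in> R"
begin

lemma rep_closed: "a \<in> carrier A \<Longrightarrow> \<phi> a \<in> R"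
  using bij bij_betwE by blast

lemma rep_inject: "\<lbrakk>a \<in> carrier A; b \<in> carrier A\<rbrakk> \<Longrightarrow> \<phi> a = \<phi> b \<longleftrightarrow> a = b"
  using bij by (auto simp: bij_betw_def inj_on_def)

lemma rep_surj: assumes "U \<in> R" obtains a where "a \<in> carrier A" "\<phi> a = U"
  using assms bij by (auto simp: bij_betw_def)

lemma
  assumes ab: "a \<in> carrier A" "b \<in> carrier A"
  shows rep_join_exists: "\<exists>c. is_lub A c {a, b}" and rep_meet_exists: "\<exists>c. is_glb A c {a, b}"
proof -
  obtain c where c: "c \<in> carrier A" "\<phi> c = \<phi> a \<union> \<phi> b"
    using rep_surj[OF R_Un] rep_closed ab by metis
  have "is_lub A c {a, b}"
    using ab c by (auto simp: least_def Upper_def le_iff) blast+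
  then show "\<exists>c. is_lub A c {a, b}" ..
  obtain d where d: "d \<in> carrier A" "\<phi> d = \<phi> a \<inter> \<phi> b"
    using rep_surj[OF R_Int] rep_closed ab by metis
  have "is_glb A d {a, b}"
    using ab d by (auto simp: greatest_def Lower_def le_iff) blast+
  then show "\<exists>c. is_glb A c {a, b}" ..
qed

lemma rep_bottom_exists: "\<exists>x. least A x (carrier A)"
proof -
  obtain c where "c \<in> carrier A" "\<phi> c = {}" by (rule rep_surj[OF R_empty])
  then show ?thesis by (intro exI[of _ c]) (auto simp: least_def le_iff)
qed

lemma rep_top_exists: "\<exists>x. greatest A x (carrier A)"
proof -
  obtain c where c: "c \<in> carrier A" "\<phi> c = S" by (rule rep_surj[OF R_full])
  then show ?thesis
    using R_subset rep_closed by (intro exI[of _ c]) (auto simp: greatest_def le_iff)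
qed

sublocale bounded_lattice A
  using rep_join_exists rep_meet_exists rep_bottom_exists rep_top_exists by unfold_locales

lemma rep_bottom: "\<phi> \<bottom> = {}"
proof -
  obtain c where "c \<in> carrier A" "\<phi> c = {}" by (rule rep_surj[OF R_empty])
  then show ?thesis using bottom_lower[of c] le_iff[of \<bottom> c] by simp
qed

lemma rep_top: "\<phi> \<top> = S"
proof -
  obtain c where "c \<in> carrier A" "\<phi> c = S" by (rule rep_surj[OF R_full])
  then show ?thesis
    using top_higher[of c] le_iff[of c \<top>] R_subset[OF rep_closed[of \<top>]] by auto
qed

lemma rep_join:
  assumes ab: "a \<in> carrier A" "b \<in> carrier A"
  shows "\<phi> (a \<squnion> b) = \<phi> a \<union> \<phi> b"
proof -
  obtain c where c: "c \<in> carrier A" "\<phi> c = \<phi> a \<union> \<phi> b"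
    using rep_surj[OF R_Un] rep_closed ab by metis
  have "a \<squnion> b \<sqsubseteq> c" using ab c by (intro join_le) (auto simp: le_iff)
  then show ?thesis
    using ab c join_left[of a b] join_right[of a b] by (auto simp: le_iff)
qed

lemma rep_meet:
  assumes ab: "a \<in> carrier A" "b \<in> carrier A"
  shows "\<phi> (a \<sqinter> b) = \<phi> a \<inter> \<phi> b"
proof -
  obtain c where c: "c \<in> carrier A" "\<phi> c = \<phi> a \<inter> \<phi> b"
    using rep_surj[OF R_Int] rep_closed ab by metis
  have "c \<sqsubseteq> a \<sqinter> b" using ab c by (intro meet_le) (auto simp: le_iff)
  then show ?thesis
    using ab c meet_left[of a b] meet_right[of a b] by (auto simp: le_iff)
qed

end

section \<open>Subtraction of down-sets and its lattice laws\<close>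

definition down_set_minus :: "'a ominus_sp \<Rightarrow> 'a set \<Rightarrow> 'a set \<Rightarrow> 'a set" where
  "down_set_minus X U V =
    {x \<in> carrier X. \<exists>w. (x, w) \<in> plus_dom X \<and> w \<notin> V \<and> x \<oplus>\<^bsub>X\<^esub> w \<in> U}"

context ominus_space
begin

lemma plus_domD: "(x, w) \<in> plus_dom X \<Longrightarrow> x \<in> carrier X \<and> w \<in> carrier X \<and> w \<sqsubseteq> neg X x"
  by (simp add: plus_dom_def)

text \<open>The witness is the value of the upper adjoint at \<open>z\<close>.\<close>

lemma plus_common_bound:
  assumes x: "x \<in> carrier X" and W: "finite W" "\<And>w. w \<in> W \<Longrightarrow> (x, w) \<in> plus_dom X"
    and z: "z \<in> carrier X" "x \<sqsubseteq> z" "\<And>w. w \<in> W \<Longrightarrow> x \<oplus> w \<sqsubseteq> z"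
  shows "\<exists>w'. (x, w') \<in> plus_dom X \<and> x \<oplus> w' \<sqsubseteq> z \<and> (\<forall>w \<in> W. w \<sqsubseteq> w')"
proof -
  obtain r where r: "r \<in> {z \<in> carrier X. x \<sqsubseteq> z} \<rightarrow> {w \<in> carrier X. w \<sqsubseteq> neg X x}"
    and adj: "\<And>w z. \<lbrakk>w \<in> carrier X; w \<sqsubseteq> neg X x; z \<in> carrier X; x \<sqsubseteq> z\<rbrakk>
      \<Longrightarrow> x \<oplus> w \<sqsubseteq> z \<longleftrightarrow> w \<sqsubseteq> r z"
    using plus_upper_adjoint[OF x] by auto
  have rz: "r z \<in> carrier X" "r z \<sqsubseteq> neg X x" using r z by auto
  then have "(x, r z) \<in> plus_dom X" "x \<oplus> r z \<sqsubseteq> z"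
    using adj[of "r z" z] z x by (auto simp: plus_dom_def)
  moreover have "w \<sqsubseteq> r z" if "w \<in> W" for w
    using adj[of w z] W(2)[OF that] z that by (auto dest: plus_domD)
  ultimately show ?thesis by blast
qed

text \<open>The values \<open>x \<oplus> w\<close> form a chain, so one of them bounds the others and lies in \<open>U\<close>.\<close>

lemma plus_common_bound_in:
  assumes U: "down_set X U" and x: "x \<in> U" and W: "finite W"
    and d: "\<And>w. w \<in> W \<Longrightarrow> (x, w) \<in> plus_dom X \<and> x \<oplus> w \<in> U"
  shows "\<exists>w'. (x, w') \<in> plus_dom X \<and> x \<oplus> w' \<in> U \<and> (\<forall>w \<in> W. w \<sqsubseteq> w')"
proof -
  have xc: "x \<in> carrier X" and Uc: "U \<subseteq> carrier X" using U x by (auto simp: down_set_def)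
  \<comment> \<open>The alternative \<open>z = x\<close> covers the empty family; since
    \<open>x\<close> lies below every sum, it also keeps \<open>z\<close> comparable with the next
    sum.\<close>
  have "\<exists>z \<in> U. x \<sqsubseteq> z \<and> (\<forall>w \<in> W. x \<oplus> w \<sqsubseteq> z) \<and> (z = x \<or> z \<in> (\<lambda>w. x \<oplus> w) ` W)"
    using W d
  proof (induction W)
    case empty
    then show ?case using x xc by auto
  next
    case (insert v W)
    then obtain z where z: "z \<in> U" "x \<sqsubseteq> z" "\<forall>w \<in> W. x \<oplus> w \<sqsubseteq> z"
      "z = x \<or> z \<in> (\<lambda>w. x \<oplus> w) ` W" by auto
    have v: "(x, v) \<in> plus_dom X" "x \<oplus> v \<in> U" using insert.prems by auto
    have "x \<oplus> v \<sqsubseteq> z \<or> z \<sqsubseteq> x \<oplus> v"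
      using z(4) plus_above[OF v(1)] plus_total[OF v(1)] insert.prems by auto
    then show ?case
    proof
      assume "x \<oplus> v \<sqsubseteq> z"
      then show ?thesis using z by (intro bexI[of _ z]) auto
    next
      assume le: "z \<sqsubseteq> x \<oplus> v"
      have "x \<oplus> w \<sqsubseteq> x \<oplus> v" if "w \<in> W" for w
        using z that le insert.prems v Uc by (meson insertI2 le_trans subsetD)
      then show ?thesis
        using v plus_above Uc by (intro bexI[of _ "x \<oplus> v"]) auto
    qed
  qed
  then obtain z where z: "z \<in> U" "x \<sqsubseteq> z" "\<And>w. w \<in> W \<Longrightarrow> x \<oplus> w \<sqsubseteq> z" by blast
  have "z \<in> carrier X" using z Uc by blast
  with plus_common_bound[OF xc W _ this z(2,3)] d obtain w' where
    w': "(x, w') \<in> plus_dom X" "x \<oplus> w' \<sqsubseteq> z" "\<forall>w \<in> W. w \<sqsubseteq> w'" by blast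
  moreover have "x \<oplus> w' \<in> U"
    using U z(1) w' plus_closed unfolding down_set_def by blast
  ultimately show ?thesis by blast
qed

lemma down_set_minus_subset:
  assumes "down_set X U" shows "down_set_minus X U V \<subseteq> U"
proof
  fix x assume "x \<in> down_set_minus X U V"
  then obtain w where "x \<in> carrier X" "(x, w) \<in> plus_dom X" "x \<oplus> w \<in> U"
    by (auto simp: down_set_minus_def)
  then show "x \<in> U" using plus_above assms unfolding down_set_def by blast
qed

lemma down_set_minusD:
  assumes "x \<in> down_set_minus X U V"
  obtains w where "x \<in> carrier X" "(x, w) \<in> plus_dom X" "w \<notin> V" "x \<oplus> w \<in> U"
  using assms by (auto simp: down_set_minus_def)

lemma down_set_minusI:
  "\<lbrakk>(x, w) \<in> plus_dom X; w \<notin> V; x \<oplus> w \<in> U\<rbrakk> \<Longrightarrow> x \<in> down_set_minus X U V"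
  by (auto simp: down_set_minus_def plus_dom_def)

text \<open>The sums \<open>x \<oplus> v\<close> and \<open>x \<oplus> v'\<close> are comparable, so
  the smaller one lies in both down-sets, and its summand is the required witness. Here the chain
  condition makes subtraction preserve meets in the first argument.\<close>

lemma down_set_minus_Int_left:
  assumes "down_set X U" "down_set X V"
  shows "down_set_minus X (U \<inter> V) W = down_set_minus X U W \<inter> down_set_minus X V W"
proof (intro equalityI subsetI)
  fix x assume x: "x \<in> down_set_minus X U W \<inter> down_set_minus X V W"
  obtain v where v: "(x, v) \<in> plus_dom X" "v \<notin> W" "x \<oplus> v \<in> U"
    using x by (auto elim: down_set_minusD)
  obtain v' where v': "(x, v') \<in> plus_dom X" "v' \<notin> W" "x \<oplus> v' \<in> V"
    using x by (auto elim: down_set_minusD)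
  have "x \<oplus> v \<in> carrier X" "x \<oplus> v' \<in> carrier X" using v v' plus_closed by auto
  then have "x \<oplus> v \<in> V \<or> x \<oplus> v' \<in> U"
    using plus_total[OF v(1) v'(1)] v v' assms unfolding down_set_def by blast
  then show "x \<in> down_set_minus X (U \<inter> V) W"
    using v v' down_set_minusI by blast
qed (auto simp: down_set_minus_def)

lemma down_set_minus_Un_left:
  "down_set_minus X (U \<union> V) W = down_set_minus X U W \<union> down_set_minus X V W"
  by (auto simp: down_set_minus_def)

lemma down_set_minus_Int_right:
  "down_set_minus X U (V \<inter> W) = down_set_minus X U V \<union> down_set_minus X U W"
  by (auto simp: down_set_minus_def)

text \<open>A common upper bound of the two witnesses stays outside both \<open>V\<close> and
  \<open>W\<close>; the adjoint provides one whose sum with \<open>x\<close> is still in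
  \<open>U\<close>.\<close>

lemma down_set_minus_Un_right:
  assumes U: "down_set X U" and VW: "down_set X V" "down_set X W"
  shows "down_set_minus X U (V \<union> W) = down_set_minus X U V \<inter> down_set_minus X U W"
proof (intro equalityI subsetI)
  fix x assume x: "x \<in> down_set_minus X U V \<inter> down_set_minus X U W"
  obtain v where v: "(x, v) \<in> plus_dom X" "v \<notin> V" "x \<oplus> v \<in> U"
    using x by (auto elim: down_set_minusD)
  obtain w where w: "(x, w) \<in> plus_dom X" "w \<notin> W" "x \<oplus> w \<in> U"
    using x by (auto elim: down_set_minusD)
  have "x \<in> U" using x down_set_minus_subset[OF U] by blast
  then obtain u where u: "(x, u) \<in> plus_dom X" "x \<oplus> u \<in> U" "v \<sqsubseteq> u" "w \<sqsubseteq> u"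
    using plus_common_bound_in[OF U, of x "{v, w}"] v w by auto
  have "u \<notin> V \<union> W"
    using u v w VW unfolding down_set_def by (auto dest: plus_domD)
  then show "x \<in> down_set_minus X U (V \<union> W)"
    using u down_set_minusI by blast
qed (auto simp: down_set_minus_def)

lemma down_set_minus_empty_left: "down_set_minus X {} V = {}"
  by (auto simp: down_set_minus_def)

lemma down_set_minus_full: "down_set_minus X U (carrier X) = {}"
  by (auto simp: down_set_minus_def plus_dom_def)

text \<open>The common bound of no summands at all: it still yields some \<open>w'\<close> with
  \<open>x \<oplus> w' \<in> U\<close>.\<close>

lemma down_set_minus_empty_right:
  assumes "down_set X U" shows "down_set_minus X U {} = U"
proof (rule equalityI[OF down_set_minus_subset[OF assms]], rule subsetI)
  fix x assume "x \<in> U"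
  with plus_common_bound_in[OF assms, of x "{}"]
  show "x \<in> down_set_minus X U {}" by (auto intro: down_set_minusI)
qed

lemma down_set_down_set_minus:
  assumes U: "down_set X U" and V: "down_set X V"
  shows "down_set X (down_set_minus X U V)"
  unfolding down_set_def
proof (intro conjI ballI impI)
  fix x y assume x: "x \<in> down_set_minus X U V" and y: "y \<in> carrier X" "y \<sqsubseteq> x"
  obtain w where w: "(x, w) \<in> plus_dom X" "w \<notin> V" "x \<oplus> w \<in> U"
    using x by (rule down_set_minusD)
  note m = plus_mono_left[OF w(1) y]
  have "y \<oplus> w \<in> U" using m plus_closed[OF m(1)] w(3) U unfolding down_set_def by blast
  then show "y \<in> down_set_minus X U V" using m(1) w(2) down_set_minusI by blast
qed (auto simp: down_set_minus_def)

section \<open>Differences of clopen down-sets are clopen\<close>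

lemma plus_upper_nbhd:
  assumes "(x, w) \<in> plus_dom X" "openin (topol X) C" "up_set X C" "x \<oplus> w \<in> C"
  shows "\<exists>P Q. openin (topol X) P \<and> up_set X P \<and> openin (topol X) Q \<and> up_set X Q \<and>
    x \<in> P \<and> w \<in> Q \<and> (\<forall>x' \<in> P. \<forall>w' \<in> Q. (x', w') \<in> plus_dom X \<longrightarrow> x' \<oplus> w' \<in> C)"
proof -
  have "\<exists>P Q. openin (up_topology X) P \<and> openin (up_topology X) Q \<and> x \<in> P \<and> w \<in> Q \<and>
      (\<forall>x' \<in> P. \<forall>w' \<in> Q. (x', w') \<in> plus_dom X \<longrightarrow> x' \<oplus> w' \<in> C)"
    using assms plus_domD[OF assms(1)]
      plus_upper_continuous[unfolded continuous_map_rectangles, THEN conjunct2, rule_format, of C x w]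
    by (auto simp: openin_up_topology topspace_up_topology)
  then show ?thesis
    by (simp only: openin_up_topology conj_assoc)
qed

lemma star_lower_nbhd:
  assumes "(x, w) \<in> star_dom X" "openin (topol X) C" "down_set X C" "x \<star> w \<in> C"
  shows "\<exists>P Q. openin (topol X) P \<and> down_set X P \<and> openin (topol X) Q \<and> down_set X Q \<and>
    x \<in> P \<and> w \<in> Q \<and> (\<forall>x' \<in> P. \<forall>w' \<in> Q. (x', w') \<in> star_dom X \<longrightarrow> x' \<star> w' \<in> C)"
proof -
  have "x \<in> carrier X" "w \<in> carrier X" using assms(1) by (auto simp: star_dom_def)
  then have "\<exists>P Q. openin (down_topology X) P \<and> openin (down_topology X) Q \<and> x \<in> P \<and> w \<in> Q \<and>
      (\<forall>x' \<in> P. \<forall>w' \<in> Q. (x', w') \<in> star_dom X \<longrightarrow> x' \<star> w' \<in> C)"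
    using assms
      star_lower_continuous[unfolded continuous_map_rectangles, THEN conjunct2, rule_format, of C x w]
    by (auto simp: openin_down_topology topspace_down_topology)
  then show ?thesis
    by (simp only: openin_down_topology conj_assoc)
qed

lemma closedin_principal_down: assumes "y \<in> carrier X" shows "closedin (topol X) {x \<in> carrier X. x \<sqsubseteq> y}"
  unfolding closedin_carrier_iff
proof (intro conjI)
  show "openin (topol X) (carrier X - {x \<in> carrier X. x \<sqsubseteq> y})"
  proof (subst openin_subopen, intro ballI)
    fix x assume x: "x \<in> carrier X - {x \<in> carrier X. x \<sqsubseteq> y}"
    then obtain U where U: "U \<in> clopen_down_sets X" "y \<in> U" "x \<notin> U"
      using separation[of x y] assms by (auto simp: clopen_down_sets_def)
    note D = clopen_down_setsD[OF U(1)]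
    have "carrier X - U \<subseteq> carrier X - {x \<in> carrier X. x \<sqsubseteq> y}"
      using D(7) U(2) by blast
    then show "\<exists>T. openin (topol X) T \<and> x \<in> T \<and> T \<subseteq> carrier X - {x \<in> carrier X. x \<sqsubseteq> y}"
      using D(4) x U by blast
  qed
qed auto

lemma neg_vimage_open:
  "openin (topol X) U \<Longrightarrow> openin (topol X) {x \<in> carrier X. neg X x \<in> U}"
  using neg_continuous by (simp add: continuous_map_def topspace_eq)

text \<open>A point \<open>x\<close> outside has \<open>x \<oplus> w\<close> outside
  \<open>U\<close> for all \<open>w\<close> in a compact set of summands, and upper continuity makes
  this stable near each pair. The set of admissible summands itself varies with the point, through
  \<open>neg\<close>, so covering the summands of \<open>x\<close> by finitely many boxes is not yet
  enough.\<close>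

lemma closedin_down_set_minus:
  assumes U: "U \<in> clopen_down_sets X" and V: "V \<in> clopen_down_sets X"
  shows "closedin (topol X) (down_set_minus X U V)"
  unfolding closedin_carrier_iff
proof (intro conjI)
  note UD = clopen_down_setsD[OF U] and VD = clopen_down_setsD[OF V]
  show "openin (topol X) (carrier X - down_set_minus X U V)"
  proof (subst openin_subopen, intro ballI)
    fix x assume x: "x \<in> carrier X - down_set_minus X U V"
    let ?K = "{w \<in> carrier X. w \<sqsubseteq> neg X x} \<inter> (carrier X - V)"
    have xn: "x \<in> carrier X" "neg X x \<in> carrier X" using x neg_closed by auto
    have K: "compactin (topol X) ?K"
      using closedin_principal_down[OF xn(2)] VD(5) compact
      by (intro closedin_compact_space closedin_Int)
    let ?\<Q> = "{Q. openin (topol X) Q \<and> (\<exists>P. openin (topol X) P \<and> x \<in> P \<and>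
      (\<forall>x' \<in> P. \<forall>w' \<in> Q. (x', w') \<in> plus_dom X \<longrightarrow> x' \<oplus> w' \<in> carrier X - U))}"
    have "?K \<subseteq> \<Union>?\<Q>"
    proof
      fix w assume w: "w \<in> ?K"
      then have d: "(x, w) \<in> plus_dom X" using xn by (auto simp: plus_dom_def)
      then have "x \<oplus> w \<in> carrier X - U"
        using w x plus_closed[OF d] down_set_minusI[OF d, of V U] by auto
      from plus_upper_nbhd[OF d UD(4,6) this] obtain Q where "Q \<in> ?\<Q>" "w \<in> Q" by auto
      then show "w \<in> \<Union>?\<Q>" by blast
    qed
    then obtain \<F> where \<F>: "finite \<F>" "\<F> \<subseteq> ?\<Q>" "?K \<subseteq> \<Union>\<F>"
      using compactinD[OF K, of ?\<Q>] by blast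
    then have "\<forall>Q \<in> \<F>. \<exists>P. openin (topol X) P \<and> x \<in> P \<and>
      (\<forall>x' \<in> P. \<forall>w' \<in> Q. (x', w') \<in> plus_dom X \<longrightarrow> x' \<oplus> w' \<in> carrier X - U)"
      by blast
    then obtain p where p: "\<And>Q. Q \<in> \<F> \<Longrightarrow> openin (topol X) (p Q) \<and> x \<in> p Q \<and>
      (\<forall>x' \<in> p Q. \<forall>w' \<in> Q. (x', w') \<in> plus_dom X \<longrightarrow> x' \<oplus> w' \<in> carrier X - U)"
      by metis
    have "openin (topol X) (\<Union>\<F>)" using \<F>(2) by blast
    then have C: "closedin (topol X) ((carrier X - V) - \<Union>\<F>)"
      using VD(5) closedin_diff by blast
    have "\<not> y \<sqsubseteq> neg X x" if "y \<in> (carrier X - V) - \<Union>\<F>" for y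
      using \<F>(3) that by blast
    \<comment> \<open>\<open>D\<close> controls the summands of nearby points: if
      \<open>neg X x'\<close> lies in \<open>D\<close>, so do all summands of \<open>x'\<close>, and
      those outside \<open>V\<close> fall into one of the finitely many \<open>Q\<close>.\<close>
    then obtain D where D: "D \<in> clopen_down_sets X" "neg X x \<in> D"
      "D \<inter> ((carrier X - V) - \<Union>\<F>) = {}"
      using clopen_down_separation[OF closedin_singleton[OF xn(2)] C] by auto
    let ?N = "{x' \<in> carrier X. neg X x' \<in> D} \<inter> (\<Inter>Q \<in> \<F>. p Q)"
    have "openin (topol X) (carrier X \<inter> (\<Inter>Q \<in> \<F>. p Q))"
      using \<F>(1) p openin_Int_Inter[of "p ` \<F>" "topol X" "carrier X"] topspace_eq
        openin_topspace[of "topol X"] by auto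
    then have "openin (topol X) ({x' \<in> carrier X. neg X x' \<in> D} \<inter> (carrier X \<inter> (\<Inter>Q \<in> \<F>. p Q)))"
      using neg_vimage_open clopen_down_setsD(1)[OF D(1)] by blast
    moreover have "{x' \<in> carrier X. neg X x' \<in> D} \<inter> (carrier X \<inter> (\<Inter>Q \<in> \<F>. p Q)) = ?N" by blast
    moreover have "x \<in> ?N" using xn D p by auto
    moreover have "?N \<subseteq> carrier X - down_set_minus X U V"
    proof
      fix x' assume x': "x' \<in> ?N"
      have "x' \<notin> down_set_minus X U V"
      proof
        assume "x' \<in> down_set_minus X U V"
        then obtain w where w: "(x', w) \<in> plus_dom X" "w \<notin> V" "x' \<oplus> w \<in> U"
          by (rule down_set_minusD)
        have "w \<in> D" using plus_domD[OF w(1)] x' clopen_down_setsD(7)[OF D(1)] by blast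
        then obtain Q where "Q \<in> \<F>" "w \<in> Q" using D(3) w plus_domD[OF w(1)] by blast
        then show False using p[of Q] x' w by blast
      qed
      then show "x' \<in> carrier X - down_set_minus X U V" using x' by blast
    qed
    ultimately show "\<exists>T. openin (topol X) T \<and> x \<in> T \<and> T \<subseteq> carrier X - down_set_minus X U V"
      by metis
  qed
qed (auto simp: down_set_minus_def)

text \<open>A filtered infimum in a Priestley space is a limit.\<close>

lemma chain_inf_in_down_set:
  assumes U: "U \<in> clopen_down_sets X" and S: "S \<subseteq> carrier X" "S \<noteq> {}"
    and chain: "\<And>x y. \<lbrakk>x \<in> S; y \<in> S\<rbrakk> \<Longrightarrow> x \<sqsubseteq> y \<or> y \<sqsubseteq> x"
    and m: "is_glb X m S" "m \<in> U"
  shows "\<exists>x \<in> S. x \<in> U"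
proof (rule ccontr)
  note UD = clopen_down_setsD[OF U]
  assume "\<not> (\<exists>x \<in> S. x \<in> U)"
  then have SU: "S \<subseteq> carrier X - U" using S by blast
  define K where "K s = {x \<in> carrier X. x \<sqsubseteq> s} \<inter> (carrier X - U)" for s
  have K: "compactin (topol X) (carrier X - U)"
    using UD(5) compact by (rule closedin_compact_space[rotated])
  have K_closed: "closedin (topol X) C" if "C \<in> K ` S" for C
    using that closedin_principal_down UD(5) S unfolding K_def by blast
  have K_fip: "(carrier X - U) \<inter> \<Inter>\<F> \<noteq> {}" if fin: "finite \<F>" "\<F> \<subseteq> K ` S" for \<F>
  proof -
    obtain F where F: "F \<subseteq> S" "finite F" "\<F> = K ` F"
      using finite_subset_image[OF fin] by blast
    from F(2,1) have "\<exists>s \<in> S. \<forall>t \<in> F. s \<sqsubseteq> t"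
    proof (induction F)
      case (insert a F)
      then obtain s where s: "s \<in> S" "\<forall>t \<in> F. s \<sqsubseteq> t" by auto
      have a: "a \<in> S" using insert.prems by simp
      from chain[OF s(1) a] show ?case
      proof
        assume "s \<sqsubseteq> a"
        then show ?thesis using s by auto
      next
        assume le: "a \<sqsubseteq> s"
        have "a \<sqsubseteq> t" if "t \<in> F" for t
          using s that le insert.prems S a by (meson insert_subset le_trans subsetD)
        then show ?thesis using a S by (intro bexI[of _ a]) auto
      qed
    qed (use S in auto)
    then obtain s where "s \<in> S" "\<forall>t \<in> F. s \<sqsubseteq> t" by blast
    then have "s \<in> (carrier X - U) \<inter> \<Inter>\<F>" using F SU by (auto simp: K_def)
    then show ?thesis by blast
  qed
  have "(carrier X - U) \<inter> \<Inter>(K ` S) \<noteq> {}"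
    using K K_closed K_fip compactin_fip[of "topol X" "carrier X - U"] by (metis (no_types, lifting))
  then obtain q where q: "q \<in> carrier X - U" "\<And>s. s \<in> S \<Longrightarrow> q \<in> K s"
    by blast
  \<comment> \<open>A point common to all \<open>K s\<close> is a lower bound of \<open>S\<close>,
    hence below \<open>m\<close>, and would be drawn into the down-set \<open>U\<close>.\<close>
  then have "q \<sqsubseteq> m" using m(1) by (auto simp: K_def greatest_def Lower_def)
  then show False using q(1) m(2) UD(7) by blast
qed

text \<open>The sums in question form a chain with infimum \<open>x \<star> y\<close>, so one of
  them enters any clopen down-set that contains the infimum. The summand \<open>neg X x\<close>
  shows that the chain is not empty.\<close>

lemma star_in_down_set:
  assumes U: "U \<in> clopen_down_sets X" and d: "(x, y) \<in> star_dom X" "x \<star> y \<in> U"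
  shows "\<exists>w. (x, w) \<in> plus_dom X \<and> \<not> w \<sqsubseteq> y \<and> x \<oplus> w \<in> U"
proof -
  let ?S = "{x \<oplus> w | w. (x, w) \<in> plus_dom X \<and> \<not> w \<sqsubseteq> y}"
  have "\<exists>z \<in> ?S. z \<in> U"
  proof (rule chain_inf_in_down_set[OF U _ _ _ star_is_inf[OF d(1)] d(2)])
    show "?S \<subseteq> carrier X" using plus_closed by auto
    have "(x, neg X x) \<in> plus_dom X" "\<not> neg X x \<sqsubseteq> y"
      using d(1) neg_closed by (auto simp: plus_dom_def star_dom_def)
    then show "?S \<noteq> {}" by blast
    show "a \<sqsubseteq> b \<or> b \<sqsubseteq> a" if "a \<in> ?S" "b \<in> ?S" for a b
      using that plus_total by blast
  qed
  then show ?thesis by blast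
qed

lemma openin_down_set_minus:
  assumes U: "U \<in> clopen_down_sets X" and V: "V \<in> clopen_down_sets X"
  shows "openin (topol X) (down_set_minus X U V)"
proof (subst openin_subopen, intro ballI)
  note UD = clopen_down_setsD[OF U] and VD = clopen_down_setsD[OF V]
  have Ud: "down_set X U" using U by (simp add: clopen_down_sets_def)
  fix x assume x: "x \<in> down_set_minus X U V"
  then obtain w where w: "(x, w) \<in> plus_dom X" "w \<notin> V" "x \<oplus> w \<in> U"
    by (rule down_set_minusD)
  note xw = plus_domD[OF w(1)]
  have nx: "neg X x \<in> carrier X" "neg X x \<notin> V"
    using neg_closed xw w(2) VD(7) by blast+
  let ?\<Q> = "{Q. openin (topol X) Q \<and> (\<exists>P. openin (topol X) P \<and> x \<in> P \<and>
    (\<forall>x' \<in> P. \<forall>y \<in> Q. (x', y) \<in> star_dom X \<longrightarrow> x' \<star> y \<in> U))}"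
  have "V \<subseteq> \<Union>?\<Q>"
  proof
    fix y assume y: "y \<in> V"
    have "\<not> neg X x \<sqsubseteq> y" "\<not> w \<sqsubseteq> y" "y \<in> carrier X"
      using nx VD y w xw by blast+
    then have d: "(x, y) \<in> star_dom X" using xw by (simp add: star_dom_def)
    have "x \<star> y \<sqsubseteq> x \<oplus> w"
      using star_is_inf[OF d] w \<open>\<not> w \<sqsubseteq> y\<close> plus_closed[OF w(1)]
      unfolding greatest_def Lower_def by blast
    then have "x \<star> y \<in> U" using w(3) UD(7) star_closed[OF d] by blast
    from star_lower_nbhd[OF d UD(1) Ud this] obtain Q where "Q \<in> ?\<Q>" "y \<in> Q" by auto
    then show "y \<in> \<Union>?\<Q>" by blast
  qed
  moreover have "compactin (topol X) V" using VD(2) compact by (rule closedin_compact_space[rotated])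
  ultimately obtain \<F> where \<F>: "finite \<F>" "\<F> \<subseteq> ?\<Q>" "V \<subseteq> \<Union>\<F>"
    using compactinD[of "topol X" V ?\<Q>] by blast
  then have "\<forall>Q \<in> \<F>. \<exists>P. openin (topol X) P \<and> x \<in> P \<and>
    (\<forall>x' \<in> P. \<forall>y \<in> Q. (x', y) \<in> star_dom X \<longrightarrow> x' \<star> y \<in> U)"
    by blast
  then obtain p where p: "\<And>Q. Q \<in> \<F> \<Longrightarrow> openin (topol X) (p Q) \<and> x \<in> p Q \<and>
    (\<forall>x' \<in> p Q. \<forall>y \<in> Q. (x', y) \<in> star_dom X \<longrightarrow> x' \<star> y \<in> U)"
    by metis
  \<comment> \<open>The first condition puts \<open>(x', y)\<close> into \<open>star_dom X\<close>
    for all \<open>y \<in> V\<close>; membership of \<open>x'\<close> in \<open>U\<close> is what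
    \<open>plus_common_bound_in\<close> asks for.\<close>
  let ?N = "{x' \<in> carrier X. neg X x' \<in> carrier X - V} \<inter> (U \<inter> (\<Inter>Q \<in> \<F>. p Q))"
  have "openin (topol X) (U \<inter> (\<Inter>Q \<in> \<F>. p Q))"
    using \<F>(1) p openin_Int_Inter[of "p ` \<F>" "topol X" U] UD(1) by auto
  then have "openin (topol X) ?N"
    using neg_vimage_open[OF VD(4)] by blast
  moreover have "x \<in> U" using x down_set_minus_subset[OF Ud] by blast
  then have "x \<in> ?N" using xw nx p by auto
  moreover have "?N \<subseteq> down_set_minus X U V"
  proof
    fix x' assume x': "x' \<in> ?N"
    let ?W = "{v. (x', v) \<in> plus_dom X \<and> x' \<oplus> v \<in> U}"
    \<comment> \<open>Each \<open>y\<close> in \<open>V\<close> has its own witness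
      \<open>v\<close>, not below \<open>y\<close>. A clopen down-set that contains \<open>y\<close>
      but not \<open>v\<close> spreads this witness to a neighbourhood of \<open>y\<close>, so by
      compactness finitely many witnesses suffice.\<close>
    let ?\<C> = "{C \<in> clopen_down_sets X. \<exists>v \<in> ?W. v \<notin> C}"
    have "V \<subseteq> \<Union>?\<C>"
    proof
      fix y assume y: "y \<in> V"
      have yc: "y \<in> carrier X" "\<not> neg X x' \<sqsubseteq> y" using y x' VD neg_closed by blast+
      then have d: "(x', y) \<in> star_dom X" using x' by (simp add: star_dom_def)
      obtain Q where "Q \<in> \<F>" "y \<in> Q" using \<F>(3) y by blast
      then have "x' \<star> y \<in> U" using p[of Q] x' d by blast
      then obtain v where v: "(x', v) \<in> plus_dom X" "\<not> v \<sqsubseteq> y" "x' \<oplus> v \<in> U"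
        using star_in_down_set[OF U d] by blast
      obtain C where "C \<in> clopen_down_sets X" "y \<in> C" "v \<notin> C"
        using separation[of v y] v yc plus_domD[OF v(1)] by (auto simp: clopen_down_sets_def)
      then show "y \<in> \<Union>?\<C>" using v by blast
    qed
    moreover have "compactin (topol X) V" using VD(2) compact by (rule closedin_compact_space[rotated])
    ultimately obtain \<G> where G: "finite \<G>" "\<G> \<subseteq> ?\<C>" "V \<subseteq> \<Union>\<G>"
      using compactinD[of "topol X" V ?\<C>] clopen_down_setsD(1) by blast
    then have "\<forall>C \<in> \<G>. \<exists>v. v \<in> ?W \<and> v \<notin> C" by blast
    then obtain v where v: "\<And>C. C \<in> \<G> \<Longrightarrow> v C \<in> ?W \<and> v C \<notin> C" by metis
    obtain u where u: "(x', u) \<in> plus_dom X" "x' \<oplus> u \<in> U" "\<forall>C \<in> \<G>. v C \<sqsubseteq> u"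
      using plus_common_bound_in[OF Ud, of x' "v ` \<G>"] x' G(1) v by auto
    \<comment> \<open>If \<open>u\<close> were in \<open>V\<close>, it would lie in some
      \<open>C\<close> of the finite cover, and the down-set \<open>C\<close> would then contain the
      smaller point \<open>v C\<close>.\<close>
    have "u \<notin> V"
    proof
      assume "u \<in> V"
      then obtain C where C: "C \<in> \<G>" "u \<in> C" using G(3) by blast
      then have "C \<in> clopen_down_sets X" using G(2) by blast
      then have "v C \<in> C"
        using clopen_down_setsD(7)[of C u "v C"] C u(3) v[OF C(1)] plus_domD by blast
      then show False using v[OF C(1)] by blast
    qed
    then show "x' \<in> down_set_minus X U V" using u down_set_minusI by blast
  qed
  ultimately show "\<exists>T. openin (topol X) T \<and> x \<in> T \<and> T \<subseteq> down_set_minus X U V" by blast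
qed

lemma down_set_minus_closed:
  assumes "U \<in> clopen_down_sets X" "V \<in> clopen_down_sets X"
  shows "down_set_minus X U V \<in> clopen_down_sets X"
  using openin_down_set_minus[OF assms] closedin_down_set_minus[OF assms]
    down_set_down_set_minus[of U V] assms
  by (simp add: clopen_down_sets_def)

end

text \<open>These representations are the elements of the span, with no preference for either side.
  Closure of the carrier under \<open>\<ominus>\<close> is stated separately because
  \<open>rep_minus\<close> sees \<open>a \<ominus> b\<close> only through
  \<open>\<phi>\<close>.\<close>

locale dual_pair = set_lattice A \<phi> "clopen_down_sets X" "carrier X" + X: ominus_space X
  for A :: "'a ominus_alg" (structure) and X :: "'s ominus_sp" and \<phi> :: "'a \<Rightarrow> 's set" +
  assumes minus_closed: "\<lbrakk>a \<in> carrier A; b \<in> carrier A\<rbrakk> \<Longrightarrow> a \<ominus> b \<in> carrier A"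
    and rep_minus: "\<lbrakk>a \<in> carrier A; b \<in> carrier A\<rbrakk>
      \<Longrightarrow> \<phi> (a \<ominus> b) = down_set_minus X (\<phi> a) (\<phi> b)"
begin

lemma rep_down_set: "a \<in> carrier A \<Longrightarrow> down_set X (\<phi> a)"
  using rep_closed by (auto simp: clopen_down_sets_def)

text \<open>Through injectivity of \<open>\<phi>\<close>, each axiom becomes an identity between
  down-sets; distributivity is that of sets.\<close>

sublocale A: ominus_algebra A
proof
  show "a \<sqinter> (b \<squnion> c) = (a \<sqinter> b) \<squnion> (a \<sqinter> c)"
    if "a \<in> carrier A" "b \<in> carrier A" "c \<in> carrier A" for a b c
    using that by (auto simp: rep_meet rep_join simp flip: rep_inject)
qed (auto simp: rep_meet rep_join rep_minus minus_closed rep_bottom rep_top rep_down_set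
      X.down_set_minus_Int_left X.down_set_minus_Un_left X.down_set_minus_Int_right
      X.down_set_minus_Un_right X.down_set_minus_empty_left X.down_set_minus_full
      X.down_set_minus_empty_right simp flip: rep_inject)

end

text \<open>\<open>S\<close> is an arbitrary set of names for the clopen down-sets, in whatever type
  the algebra has to inhabit. \<open>inv_into\<close> returns the name of a difference, which exists
  by \<open>down_set_minus_closed\<close>.\<close>

lemma (in ominus_space) dual_pair_down_sets:
  assumes q: "bij_betw q S (clopen_down_sets X)"
  shows "dual_pair \<lparr>carrier = S, eq = (=), le = (\<lambda>a b. q a \<subseteq> q b),
    ominus = (\<lambda>a b. inv_into S q (down_set_minus X (q a) (q b)))\<rparr> X q" (is "dual_pair ?A X q")
proof -
  have inj: "a = b" if "a \<in> S" "b \<in> S" "q a = q b" for a b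
    using q that by (auto simp: bij_betw_def inj_on_def)
  have qc: "q a \<in> clopen_down_sets X" if "a \<in> S" for a
    using q that bij_betwE by blast
  interpret set_lattice ?A q "clopen_down_sets X" "carrier X"
    by unfold_locales (use q inj clopen_down_setsD(3) in auto)
  show ?thesis
    using q qc down_set_minus_closed
    by unfold_locales
      (auto simp: bij_betw_def inv_into_into f_inv_into_f down_set_minus_closed)
qed

section \<open>The space of prime ideals\<close>

text \<open>Alexander's subbase theorem. The work lies in identifying the generated topology with
  the unions of finite intersections for which \<open>Alexander_subbase\<close> is
  formulated.\<close>

lemma compact_space_topology_generated_by:
  assumes fin: "\<And>C. \<lbrakk>C \<subseteq> B; \<Union>C = \<Union>B\<rbrakk> \<Longrightarrow> \<exists>C'. finite C' \<and> C' \<subseteq> C \<and> \<Union>C' = \<Union>B"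
  shows "compact_space (topology_generated_by B)"
proof -
  let ?T = "topology (arbitrary union_of (finite intersection_of (\<lambda>x. x \<in> B) relative_to \<Union>B))"
  have "?T = topology_generated_by B"
    unfolding topology_eq
  proof (intro allI iffI)
    fix S
    have "openin (topology_generated_by B) (\<Union>B)"
      using openin_topspace[of "topology_generated_by B"] by simp
    then show "openin (topology_generated_by B) S" if "openin ?T S"
      using that minimal_topology_subbase[of "\<lambda>x. x \<in> B" "topology_generated_by B" "\<Union>B" S]
      by (simp add: topology_generated_by_Basis)
    have "openin ?T U" if "U \<in> B" for U
      unfolding openin_subbase
      using that by (intro arbitrary_union_of_inc relative_to_subset_inc finite_intersection_of_inc) auto
    then show "openin ?T S" if "openin (topology_generated_by B) S"
      using generate_topology_on_coarsest[of "openin ?T" B S] that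
      by (simp add: istopology_openin openin_topology_generated_by_iff)
  qed
  moreover have "compact_space ?T"
    by (rule Alexander_subbase[OF refl]) (use fin in simp)
  ultimately show ?thesis by simp
qed

text \<open>As equivalences, the conditions say that membership sends joins to conjunctions and
  meets to disjunctions; downward closure is hidden in the forward direction for joins. In this form
  the laws of \<open>\<ominus>\<close> transfer to ideals by rewriting.\<close>

definition prime_ideals :: "('a, 'b) gorder_scheme \<Rightarrow> 'a set set" where
  "prime_ideals A = {I. I \<subseteq> carrier A \<and> \<bottom>\<^bsub>A\<^esub> \<in> I \<and> \<top>\<^bsub>A\<^esub> \<notin> I \<and>
    (\<forall>a \<in> carrier A. \<forall>b \<in> carrier A.
      (a \<squnion>\<^bsub>A\<^esub> b \<in> I \<longleftrightarrow> a \<in> I \<and> b \<in> I) \<and> (a \<sqinter>\<^bsub>A\<^esub> b \<in> I \<longleftrightarrow> a \<in> I \<or> b \<in> I))}"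

lemma prime_idealsI:
  assumes "I \<subseteq> carrier A" "\<bottom>\<^bsub>A\<^esub> \<in> I" "\<top>\<^bsub>A\<^esub> \<notin> I"
    and "\<And>a b. \<lbrakk>a \<in> carrier A; b \<in> carrier A\<rbrakk> \<Longrightarrow> a \<squnion>\<^bsub>A\<^esub> b \<in> I \<longleftrightarrow> a \<in> I \<and> b \<in> I"
    and "\<And>a b. \<lbrakk>a \<in> carrier A; b \<in> carrier A\<rbrakk> \<Longrightarrow> a \<sqinter>\<^bsub>A\<^esub> b \<in> I \<longleftrightarrow> a \<in> I \<or> b \<in> I"
  shows "I \<in> prime_ideals A"
  using assms by (simp add: prime_ideals_def)

lemma prime_idealsD:
  assumes "I \<in> prime_ideals A"
  shows "I \<subseteq> carrier A" "\<bottom>\<^bsub>A\<^esub> \<in> I" "\<top>\<^bsub>A\<^esub> \<notin> I"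
    and "\<And>a b. \<lbrakk>a \<in> carrier A; b \<in> carrier A\<rbrakk> \<Longrightarrow> a \<squnion>\<^bsub>A\<^esub> b \<in> I \<longleftrightarrow> a \<in> I \<and> b \<in> I"
    and "\<And>a b. \<lbrakk>a \<in> carrier A; b \<in> carrier A\<rbrakk> \<Longrightarrow> a \<sqinter>\<^bsub>A\<^esub> b \<in> I \<longleftrightarrow> a \<in> I \<or> b \<in> I"
  using assms by (simp_all add: prime_ideals_def)

lemma (in lattice) prime_ideal_downward:
  assumes "I \<in> prime_ideals L" "a \<in> carrier L" "b \<in> I" "a \<sqsubseteq> b"
  shows "a \<in> I"
proof -
  have "b \<in> carrier L" using assms prime_idealsD(1) by blast
  then have "a \<squnion> b = b" using assms le_iff_meet by blast
  then show ?thesis using prime_idealsD(4)[OF assms(1,2) \<open>b \<in> carrier L\<close>] assms(3) by simp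
qed

context ominus_algebra
begin

lemma join_mono_left:
  assumes "a \<in> carrier A" "a' \<in> carrier A" "b \<in> carrier A" "a \<sqsubseteq> a'"
  shows "a \<squnion> b \<sqsubseteq> a' \<squnion> b"
proof (rule join_le)
  show "a \<sqsubseteq> a' \<squnion> b"
    using assms join_left[of a' b] by (meson join_closed le_trans)
qed (use assms join_right in auto)

lemma join_le_iff:
  assumes "a \<in> carrier A" "b \<in> carrier A" "c \<in> carrier A"
  shows "a \<squnion> b \<sqsubseteq> c \<longleftrightarrow> a \<sqsubseteq> c \<and> b \<sqsubseteq> c"
  using assms join_left[of a b] join_right[of a b] join_le[of a c b] join_closed[of a b]
  by (meson le_trans)

lemma le_meet_iff:
  assumes "a \<in> carrier A" "b \<in> carrier A" "c \<in> carrier A"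
  shows "c \<sqsubseteq> a \<sqinter> b \<longleftrightarrow> c \<sqsubseteq> a \<and> c \<sqsubseteq> b"
  using assms meet_left[of a b] meet_right[of a b] meet_le[of c a b] meet_closed[of a b]
  by (meson le_trans)

text \<open>The axioms contain only the other distributive law; this one moves an element of an
  ideal through a meet in the prime ideal theorem.\<close>

lemma join_meet_distrib:
  assumes "a \<in> carrier A" "b \<in> carrier A" "c \<in> carrier A"
  shows "a \<squnion> (b \<sqinter> c) = (a \<squnion> b) \<sqinter> (a \<squnion> c)"
proof -
  have 1: "(a \<squnion> b) \<sqinter> a = a"
    using assms join_left[of a b] le_iff_join[of a "a \<squnion> b"] meet_comm[of A a "a \<squnion> b"] by simp
  have 2: "(a \<squnion> b) \<sqinter> c = (a \<sqinter> c) \<squnion> (b \<sqinter> c)"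
    using assms meet_join_distrib[of c a b] meet_comm[of A c] by (metis (no_types))
  have 3: "a \<squnion> (a \<sqinter> c) = a"
    using assms meet_left[of a c] le_iff_meet[of "a \<sqinter> c" a] join_comm[of A a "a \<sqinter> c"] by simp
  have "(a \<squnion> b) \<sqinter> (a \<squnion> c) = a \<squnion> ((a \<sqinter> c) \<squnion> (b \<sqinter> c))"
    using assms meet_join_distrib[of "a \<squnion> b" a c] 1 2 by simp
  also have "\<dots> = (a \<squnion> (a \<sqinter> c)) \<squnion> (b \<sqinter> c)"
    using assms weak_join_assoc[of a "a \<sqinter> c" "b \<sqinter> c"] by (simp add: eq_is_equal)
  finally show ?thesis using 3 by simp
qed

text \<open>The equivalences also make \<open>I\<close> downward closed and \<open>F\<close> upward closed.\<close>

lemma prime_ideal_exists: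
  assumes I: "I \<subseteq> carrier A" "\<bottom> \<in> I"
      "\<And>a b. \<lbrakk>a \<in> carrier A; b \<in> carrier A\<rbrakk> \<Longrightarrow> a \<squnion> b \<in> I \<longleftrightarrow> a \<in> I \<and> b \<in> I"
    and F: "F \<subseteq> carrier A" "\<top> \<in> F"
      "\<And>a b. \<lbrakk>a \<in> carrier A; b \<in> carrier A\<rbrakk> \<Longrightarrow> a \<sqinter> b \<in> F \<longleftrightarrow> a \<in> F \<and> b \<in> F"
    and disj: "I \<inter> F = {}"
  shows "\<exists>J \<in> prime_ideals A. I \<subseteq> J \<and> J \<inter> F = {}"
proof -
  \<comment> \<open>Zorn's lemma is applied to the ideals that contain \<open>I\<close> and avoid
    \<open>F\<close>; a maximal one turns out to be prime.\<close>
  define \<A> where "\<A> = {J. I \<subseteq> J \<and> J \<subseteq> carrier A \<and> J \<inter> F = {} \<and>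
    (\<forall>a \<in> carrier A. \<forall>b \<in> carrier A. a \<squnion> b \<in> J \<longleftrightarrow> a \<in> J \<and> b \<in> J)}"
  have "\<exists>M \<in> \<A>. \<forall>J \<in> \<A>. M \<subseteq> J \<longrightarrow> J = M"
  proof (rule subset_Zorn_nonempty)
    show "\<A> \<noteq> {}" using I disj by (auto simp: \<A>_def)
    fix \<C> assume ne: "\<C> \<noteq> {}" and ch: "subset.chain \<A> \<C>"
    have C: "\<And>J. J \<in> \<C> \<Longrightarrow> J \<in> \<A>" and tot: "\<And>J K. \<lbrakk>J \<in> \<C>; K \<in> \<C>\<rbrakk> \<Longrightarrow> J \<subseteq> K \<or> K \<subseteq> J"
      using ch by (auto simp: subset_chain_def)
    have "a \<squnion> b \<in> \<Union>\<C> \<longleftrightarrow> a \<in> \<Union>\<C> \<and> b \<in> \<Union>\<C>" if ab: "a \<in> carrier A" "b \<in> carrier A" for a b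
    proof
      assume "a \<squnion> b \<in> \<Union>\<C>"
      then obtain J where "J \<in> \<C>" "a \<squnion> b \<in> J" by blast
      then show "a \<in> \<Union>\<C> \<and> b \<in> \<Union>\<C>" using C[of J] ab by (auto simp: \<A>_def)
    next
      assume "a \<in> \<Union>\<C> \<and> b \<in> \<Union>\<C>"
      then obtain J K where JK: "J \<in> \<C>" "K \<in> \<C>" "a \<in> J" "b \<in> K" by blast
      then obtain L where "L \<in> \<C>" "a \<in> L" "b \<in> L" using tot[of J K] by blast
      then have "a \<squnion> b \<in> L" using C[of L] ab by (simp add: \<A>_def)
      then show "a \<squnion> b \<in> \<Union>\<C>" using \<open>L \<in> \<C>\<close> by blast
    qed
    moreover have "I \<subseteq> J \<and> J \<subseteq> carrier A \<and> J \<inter> F = {}" if "J \<in> \<C>" for J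
      using C[OF that] by (simp add: \<A>_def)
    then have "I \<subseteq> \<Union>\<C>" "\<Union>\<C> \<subseteq> carrier A" "\<Union>\<C> \<inter> F = {}"
      using ne by blast+
    ultimately show "\<Union>\<C> \<in> \<A>" by (simp add: \<A>_def)
  qed
  then obtain M where "M \<in> \<A>" and max: "\<And>J. \<lbrakk>J \<in> \<A>; M \<subseteq> J\<rbrakk> \<Longrightarrow> J = M"
    by blast
  then have M: "I \<subseteq> M" "M \<subseteq> carrier A" "M \<inter> F = {}"
      "\<And>a b. \<lbrakk>a \<in> carrier A; b \<in> carrier A\<rbrakk> \<Longrightarrow> a \<squnion> b \<in> M \<longleftrightarrow> a \<in> M \<and> b \<in> M"
    by (simp_all add: \<A>_def)
  have M_down: "a \<in> M" if "a \<in> carrier A" "b \<in> M" "a \<sqsubseteq> b" for a b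
    using that M(2) M(4)[of a b] le_iff_meet[of a b] by auto
  have F_up: "b \<in> F" if "a \<in> F" "b \<in> carrier A" "a \<sqsubseteq> b" for a b
    using that F(1) F(3)[of a b] le_iff_join[of a b] by auto
  have extend: "\<exists>m \<in> M. m \<squnion> a \<in> F" if a: "a \<in> carrier A" "a \<notin> M" for a
  proof (rule ccontr)
    assume no: "\<not> (\<exists>m \<in> M. m \<squnion> a \<in> F)"
    \<comment> \<open>The ideal generated by \<open>M\<close> and \<open>a\<close>. Avoiding
      \<open>F\<close>, it would have to equal the maximal \<open>M\<close>, although it contains
      \<open>a\<close>.\<close>
    let ?J = "{c \<in> carrier A. \<exists>m \<in> M. c \<sqsubseteq> m \<squnion> a}"
    have MJ: "M \<subseteq> ?J" using M(2) a(1) join_left by blast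
    have "?J \<inter> F = {}"
      using no F_up M(2) a(1) join_closed by blast
    moreover have "b \<squnion> c \<in> ?J \<longleftrightarrow> b \<in> ?J \<and> c \<in> ?J" if bc: "b \<in> carrier A" "c \<in> carrier A" for b c
    proof
      assume J: "b \<squnion> c \<in> ?J"
      then obtain m where m: "m \<in> M" "b \<squnion> c \<sqsubseteq> m \<squnion> a" by blast
      moreover have "m \<in> carrier A" using m(1) M(2) by blast
      ultimately have "b \<sqsubseteq> m \<squnion> a \<and> c \<sqsubseteq> m \<squnion> a"
        using bc a(1) by (simp add: join_le_iff)
      then show "b \<in> ?J \<and> c \<in> ?J"
        using bc m(1) by blast
    next
      assume "b \<in> ?J \<and> c \<in> ?J"
      then obtain m n where mn: "m \<in> M" "n \<in> M" "b \<sqsubseteq> m \<squnion> a" "c \<sqsubseteq> n \<squnion> a" by blast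
      have c: "m \<in> carrier A" "n \<in> carrier A" using mn M(2) by auto
      have "m \<squnion> a \<sqsubseteq> (m \<squnion> n) \<squnion> a" "n \<squnion> a \<sqsubseteq> (m \<squnion> n) \<squnion> a"
        using c a(1) join_left[of m n] join_right[of m n] by (auto intro: join_mono_left)
      then have "b \<sqsubseteq> (m \<squnion> n) \<squnion> a" "c \<sqsubseteq> (m \<squnion> n) \<squnion> a"
        using mn(3,4) c a(1) bc by (meson join_closed le_trans)+
      then have "b \<squnion> c \<sqsubseteq> (m \<squnion> n) \<squnion> a"
        using c a(1) bc by (simp add: join_le_iff)
      moreover have "m \<squnion> n \<in> M" using M(4)[OF c] mn by simp
      ultimately show "b \<squnion> c \<in> ?J" using bc by auto
    qed
    ultimately have "?J = M" using MJ M(1) by (intro max) (auto simp: \<A>_def)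
    moreover have "\<bottom> \<in> M" using I(2) M(1) by blast
    then have "a \<in> ?J" using a(1) join_right[of \<bottom> a] by auto
    ultimately show False using a(2) by blast
  qed
  have "M \<in> prime_ideals A"
  proof (rule prime_idealsI)
    show "a \<sqinter> b \<in> M \<longleftrightarrow> a \<in> M \<or> b \<in> M" if ab: "a \<in> carrier A" "b \<in> carrier A" for a b
    proof
      assume "a \<in> M \<or> b \<in> M"
      then show "a \<sqinter> b \<in> M"
        using M_down[of "a \<sqinter> b"] ab meet_left meet_right by auto
    next
      assume m: "a \<sqinter> b \<in> M"
      show "a \<in> M \<or> b \<in> M"
      proof (rule ccontr)
        assume "\<not> (a \<in> M \<or> b \<in> M)"
        then obtain m n where mn: "m \<in> M" "m \<squnion> a \<in> F" "n \<in> M" "n \<squnion> b \<in> F"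
          using extend ab by blast
        \<comment> \<open>One element of \<open>M\<close> above both \<open>m\<close> and
          \<open>n\<close>, so that distributivity puts
          \<open>?k \<squnion> (a \<sqinter> b)\<close> into the filter.\<close>
        let ?k = "m \<squnion> n"
        have c: "m \<in> carrier A" "n \<in> carrier A" using mn M(2) by auto
        have k: "?k \<in> M" using M(4)[OF c] mn by simp
        have "m \<squnion> a \<sqsubseteq> ?k \<squnion> a" "n \<squnion> b \<sqsubseteq> ?k \<squnion> b"
          using c ab join_left[of m n] join_right[of m n] by (auto intro: join_mono_left)
        then have "?k \<squnion> a \<in> F" "?k \<squnion> b \<in> F"
          using F_up[OF mn(2), of "?k \<squnion> a"] F_up[OF mn(4), of "?k \<squnion> b"] c ab by simp_all
        then have "?k \<squnion> (a \<sqinter> b) \<in> F"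
          using F(3) c ab by (simp add: join_meet_distrib)
        moreover have "?k \<squnion> (a \<sqinter> b) \<in> M" using M(4)[of ?k "a \<sqinter> b"] k m c ab by simp
        ultimately show False using M(3) by blast
      qed
    qed
  qed (use M I F in auto)
  then show ?thesis using M by blast
qed

section \<open>Subtraction relative to a prime ideal\<close>

context
  fixes I assumes I: "I \<in> prime_ideals A"
begin

text \<open>Modulo a prime ideal the four distributive laws become propositional:
  \<open>a \<ominus> b \<in> I\<close> is a relation that exchanges the roles of join and meet in
  its second argument. The primality of all ideals built from \<open>I\<close> is a calculation with
  these equivalences.\<close>

lemma prime_minus_simps:
  assumes "a \<in> carrier A" "b \<in> carrier A" "c \<in> carrier A"
  shows "(a \<squnion> b) \<ominus> c \<in> I \<longleftrightarrow> a \<ominus> c \<in> I \<and> b \<ominus> c \<in> I"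
    and "(a \<sqinter> b) \<ominus> c \<in> I \<longleftrightarrow> a \<ominus> c \<in> I \<or> b \<ominus> c \<in> I"
    and "a \<ominus> (b \<squnion> c) \<in> I \<longleftrightarrow> a \<ominus> b \<in> I \<or> a \<ominus> c \<in> I"
    and "a \<ominus> (b \<sqinter> c) \<in> I \<longleftrightarrow> a \<ominus> b \<in> I \<and> a \<ominus> c \<in> I"
  using assms prime_idealsD[OF I]
  by (simp_all add: join_ominus meet_ominus ominus_join ominus_meet ominus_closed)

text \<open>Monotonicity in disguise: the distributive laws are applied to
  \<open>a \<ominus> (\<bottom> \<sqinter> b)\<close>, which is \<open>a\<close>, and to
  \<open>(a \<sqinter> \<top>) \<ominus> b\<close>.\<close>

lemma prime_minus_le:
  assumes "a \<in> carrier A" "b \<in> carrier A"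
  shows "a \<in> I \<Longrightarrow> a \<ominus> b \<in> I" "\<top> \<ominus> b \<in> I \<Longrightarrow> a \<ominus> b \<in> I"
proof -
  have "a \<ominus> (\<bottom> \<sqinter> b) = a" using assms by (metis bottom_closed bottom_lower le_iff_join ominus_bottom)
  then show "a \<in> I \<Longrightarrow> a \<ominus> b \<in> I" using prime_minus_simps(4)[of a \<bottom> b] assms by simp
  have "a \<sqinter> \<top> = a" using assms by (metis le_iff_join top_closed top_higher)
  then show "\<top> \<ominus> b \<in> I \<Longrightarrow> a \<ominus> b \<in> I" using prime_minus_simps(2)[of a \<top> b] assms by simp
qed

text \<open>\<open>\<ominus>\<close> exchanges join and meet in its second argument, and the negated
  membership exchanges them back.\<close>

lemma prime_neg: "{b \<in> carrier A. \<top> \<ominus> b \<notin> I} \<in> prime_ideals A"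
  by (rule prime_idealsI)
    (use prime_idealsD[OF I] in \<open>auto simp: prime_minus_simps ominus_bottom ominus_top\<close>)

text \<open>The inclusion of \<open>J\<close> in the ideal of \<open>prime_neg\<close> says exactly
  that \<open>\<top>\<close> stays out. Witnesses \<open>b\<close> and \<open>b'\<close> for the two
  parts of a join are merged into \<open>b \<squnion> b'\<close>, which belongs to the ideal
  \<open>J\<close>.\<close>

lemma prime_plus:
  assumes J: "J \<in> prime_ideals A" and "J \<subseteq> {b \<in> carrier A. \<top> \<ominus> b \<notin> I}"
  shows "{a \<in> carrier A. \<exists>b \<in> J. a \<ominus> b \<in> I} \<in> prime_ideals A"
proof (rule prime_idealsI)
  have Jc: "\<And>b. b \<in> J \<Longrightarrow> b \<in> carrier A" using prime_idealsD(1)[OF J] by blast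
  show "\<bottom> \<in> {a \<in> carrier A. \<exists>b \<in> J. a \<ominus> b \<in> I}"
    using prime_idealsD(2)[OF I] prime_idealsD(2)[OF J] by (auto simp: ominus_bottom intro!: bexI[of _ \<bottom>])
  fix a a' assume a: "a \<in> carrier A" "a' \<in> carrier A"
  show "a \<sqinter> a' \<in> {a \<in> carrier A. \<exists>b \<in> J. a \<ominus> b \<in> I} \<longleftrightarrow>
      a \<in> {a \<in> carrier A. \<exists>b \<in> J. a \<ominus> b \<in> I} \<or> a' \<in> {a \<in> carrier A. \<exists>b \<in> J. a \<ominus> b \<in> I}"
    using a Jc by (auto simp: prime_minus_simps)
  have "a \<squnion> a' \<in> {a \<in> carrier A. \<exists>b \<in> J. a \<ominus> b \<in> I}"
    if "b \<in> J" "b' \<in> J" "a \<ominus> b \<in> I" "a' \<ominus> b' \<in> I" for b b'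
    using that a Jc prime_idealsD(4)[OF J]
    by (auto simp: prime_minus_simps intro!: bexI[of _ "b \<squnion> b'"])
  then show "a \<squnion> a' \<in> {a \<in> carrier A. \<exists>b \<in> J. a \<ominus> b \<in> I} \<longleftrightarrow>
      a \<in> {a \<in> carrier A. \<exists>b \<in> J. a \<ominus> b \<in> I} \<and> a' \<in> {a \<in> carrier A. \<exists>b \<in> J. a \<ominus> b \<in> I}"
    using a Jc by (auto simp: prime_minus_simps)
qed (use assms(2) in auto)

text \<open>\<open>c\<close> shows that the ideal of \<open>prime_neg\<close> is not included in
  \<open>J\<close>, which keeps \<open>\<top>\<close> out. For primality, two witnesses outside
  \<open>J\<close> are merged into their meet, which stays outside because \<open>J\<close> is
  prime.\<close>

lemma prime_star:
  assumes J: "J \<in> prime_ideals A" and "c \<in> carrier A" "c \<notin> J" "\<top> \<ominus> c \<notin> I"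
  shows "{a \<in> carrier A. \<forall>b \<in> carrier A - J. a \<ominus> b \<in> I} \<in> prime_ideals A" (is "?S \<in> _")
proof (rule prime_idealsI)
  show "\<bottom> \<in> ?S" using prime_idealsD(2)[OF I] by (auto simp: bottom_ominus)
  fix a a' assume a: "a \<in> carrier A" "a' \<in> carrier A"
  show "a \<squnion> a' \<in> ?S \<longleftrightarrow> a \<in> ?S \<and> a' \<in> ?S"
    using a by (auto simp: prime_minus_simps)
  have "a \<sqinter> a' \<notin> ?S"
    if b: "b \<in> carrier A - J" "b' \<in> carrier A - J" "a \<ominus> b \<notin> I" "a' \<ominus> b' \<notin> I" for b b'
  proof -
    have "b \<sqinter> b' \<in> carrier A - J" using b prime_idealsD(5)[OF J] by auto
    moreover have "(a \<sqinter> a') \<ominus> (b \<sqinter> b') \<notin> I"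
      using a b by (simp add: prime_minus_simps(2)) (simp add: prime_minus_simps(4))
    ultimately show ?thesis by blast
  qed
  then show "a \<sqinter> a' \<in> ?S \<longleftrightarrow> a \<in> ?S \<or> a' \<in> ?S"
    using a by (auto simp: prime_minus_simps)
qed (use assms(2-) in auto)

text \<open>This is the largest \<open>J\<close> whose sum with \<open>I\<close> misses
  \<open>M\<close>. The choice \<open>M = {a}\<close> gives the summand behind
  \<open>a \<ominus> b \<notin> I\<close>, the complement of an ideal gives the upper adjoint, and
  an image under a homomorphism gives the lift demanded of morphisms.\<close>

lemma prime_residual:
  assumes M: "M \<subseteq> carrier A" "M \<noteq> {}" "\<And>a b. \<lbrakk>a \<in> M; b \<in> M\<rbrakk> \<Longrightarrow> a \<sqinter> b \<in> M" "M \<inter> I = {}"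
  shows "{c \<in> carrier A. \<forall>a \<in> M. a \<ominus> c \<notin> I} \<in> prime_ideals A" (is "?R \<in> _")
    and "{c \<in> carrier A. \<forall>a \<in> M. a \<ominus> c \<notin> I} \<subseteq> {b \<in> carrier A. \<top> \<ominus> b \<notin> I}"
proof -
  have Mc: "\<And>a. a \<in> M \<Longrightarrow> a \<in> carrier A" using M(1) by blast
  show "?R \<in> prime_ideals A"
  proof (rule prime_idealsI)
    show "\<bottom> \<in> ?R" using M(4) Mc by (auto simp: ominus_bottom)
    show "\<top> \<notin> ?R" using M(2) Mc prime_idealsD(2)[OF I] by (auto simp: ominus_top)
    fix c c' assume c: "c \<in> carrier A" "c' \<in> carrier A"
    show "c \<squnion> c' \<in> ?R \<longleftrightarrow> c \<in> ?R \<and> c' \<in> ?R"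
      using c Mc by (auto simp: prime_minus_simps)
    have "c \<sqinter> c' \<notin> ?R" if a: "a \<in> M" "a' \<in> M" "a \<ominus> c \<in> I" "a' \<ominus> c' \<in> I" for a a'
    proof -
      have "(a \<sqinter> a') \<ominus> (c \<sqinter> c') \<in> I" using a c Mc by (simp add: prime_minus_simps)
      then show ?thesis using M(3)[OF a(1,2)] by blast
    qed
    then show "c \<sqinter> c' \<in> ?R \<longleftrightarrow> c \<in> ?R \<or> c' \<in> ?R"
      using c Mc by (auto simp: prime_minus_simps)
  qed auto
  show "?R \<subseteq> {b \<in> carrier A. \<top> \<ominus> b \<notin> I}"
    using M(2) Mc prime_minus_le(2) by blast
qed

text \<open>Suppose \<open>a\<close> is only in the first ideal, by \<open>b\<close>, and
  \<open>a'\<close> only in the second, by \<open>b'\<close>. Then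
  \<open>(a \<sqinter> a') \<ominus> (b \<sqinter> b')\<close> is in \<open>I\<close>, and primality
  in the first argument leaves \<open>a \<ominus> b'\<close> or \<open>a' \<ominus> b\<close> in
  \<open>I\<close>, against the choice of \<open>a\<close> and \<open>a'\<close>.\<close>

lemma prime_plus_total:
  assumes "J \<subseteq> carrier A" "J' \<subseteq> carrier A"
  shows "{a \<in> carrier A. \<exists>b \<in> J. a \<ominus> b \<in> I} \<subseteq> {a \<in> carrier A. \<exists>b \<in> J'. a \<ominus> b \<in> I} \<or>
    {a \<in> carrier A. \<exists>b \<in> J'. a \<ominus> b \<in> I} \<subseteq> {a \<in> carrier A. \<exists>b \<in> J. a \<ominus> b \<in> I}"
proof (rule ccontr)
  assume "\<not> ?thesis"
  then obtain a a' where a: "a \<in> carrier A" "\<exists>b \<in> J. a \<ominus> b \<in> I" "\<forall>b \<in> J'. a \<ominus> b \<notin> I"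
    and a': "a' \<in> carrier A" "\<exists>b \<in> J'. a' \<ominus> b \<in> I" "\<forall>b \<in> J. a' \<ominus> b \<notin> I"
    by blast
  then obtain b b' where b: "b \<in> J" "a \<ominus> b \<in> I" "b' \<in> J'" "a' \<ominus> b' \<in> I" by blast
  have c: "b \<in> carrier A" "b' \<in> carrier A" using b assms by auto
  have "(a \<sqinter> a') \<ominus> (b \<sqinter> b') \<in> I"
    using a(1) a'(1) b c prime_minus_simps(4)[of "a \<sqinter> a'" b b'] by (simp add: prime_minus_simps(2))
  then have "a \<ominus> (b \<sqinter> b') \<in> I \<or> a' \<ominus> (b \<sqinter> b') \<in> I"
    using a(1) a'(1) c prime_minus_simps(2)[of a a' "b \<sqinter> b'"] by simp
  then show False
    using a a' b c by (auto simp: prime_minus_simps(4))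
qed

end

end

text \<open>Subbasic sets come with their complements, as in the patch topology, which makes them
  clopen. For points of \<open>S\<close> off the domains of the partial operations, the set
  described contains \<open>\<top>\<close> and is not a prime ideal, so \<open>inv_into\<close>
  yields an arbitrary value there.\<close>

definition prime_space :: "'a ominus_alg \<Rightarrow> 's set \<Rightarrow> ('s \<Rightarrow> 'a set) \<Rightarrow> 's ominus_sp" where
  "prime_space A S p =
    \<lparr>carrier = S, eq = (=), le = (\<lambda>x y. p x \<subseteq> p y),
     topol = topology_generated_by
       ((\<lambda>a. {x \<in> S. a \<notin> p x}) ` carrier A \<union> (\<lambda>a. {x \<in> S. a \<in> p x}) ` carrier A),
     neg = (\<lambda>x. inv_into S p {b \<in> carrier A. \<top>\<^bsub>A\<^esub> \<ominus>\<^bsub>A\<^esub> b \<notin> p x}),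
     splus = (\<lambda>x y. inv_into S p {a \<in> carrier A. \<exists>b \<in> p y. a \<ominus>\<^bsub>A\<^esub> b \<in> p x}),
     sstar = (\<lambda>x y. inv_into S p
       {a \<in> carrier A. \<forall>b \<in> carrier A - p y. a \<ominus>\<^bsub>A\<^esub> b \<in> p x})\<rparr>"

text \<open>The indexing of the prime ideals by \<open>S\<close> allows the dual space to live on any large enough type.\<close>

locale prime_spectrum = ominus_algebra A for A :: "'a ominus_alg" (structure) +
  fixes S :: "'s set" and p :: "'s \<Rightarrow> 'a set"
  assumes p_bij: "bij_betw p S (prime_ideals A)"
begin

abbreviation "X \<equiv> prime_space A S p"

definition "\<phi> a = {x \<in> S. a \<notin> p x}"

lemma p_prime: "x \<in> S \<Longrightarrow> p x \<in> prime_ideals A"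
  using p_bij bij_betwE by blast

lemma p_inject: "\<lbrakk>x \<in> S; y \<in> S\<rbrakk> \<Longrightarrow> p x = p y \<longleftrightarrow> x = y"
  using p_bij by (auto simp: bij_betw_def inj_on_def)

lemma p_subset: "x \<in> S \<Longrightarrow> p x \<subseteq> carrier A"
  using p_prime prime_idealsD(1) by blast

lemma
  assumes "I \<in> prime_ideals A"
  shows inv_p_closed: "inv_into S p I \<in> S" and p_inv_p: "p (inv_into S p I) = I"
  using assms p_bij by (auto simp: bij_betw_def inv_into_into f_inv_into_f)

lemma X_simps [simp]:
  "carrier X = S" "(.=\<^bsub>X\<^esub>) = (=)" "x \<sqsubseteq>\<^bsub>X\<^esub> y \<longleftrightarrow> p x \<subseteq> p y"
  by (simp_all add: prime_space_def)

lemma neg_X: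
  assumes "x \<in> S"
  shows "neg X x \<in> S" "p (neg X x) = {b \<in> carrier A. \<top> \<ominus> b \<notin> p x}"
  using inv_p_closed[OF prime_neg[OF p_prime[OF assms]]] p_inv_p[OF prime_neg[OF p_prime[OF assms]]]
  by (simp_all add: prime_space_def)

lemma plus_dom_X:
  "(x, y) \<in> plus_dom X \<longleftrightarrow> x \<in> S \<and> y \<in> S \<and> p y \<subseteq> {b \<in> carrier A. \<top> \<ominus> b \<notin> p x}"
  by (auto simp: plus_dom_def neg_X)

lemma star_dom_X:
  "(x, y) \<in> star_dom X \<longleftrightarrow> x \<in> S \<and> y \<in> S \<and> (\<exists>c \<in> carrier A. c \<notin> p y \<and> \<top> \<ominus> c \<notin> p x)"
  by (auto simp: star_dom_def neg_X)

lemma plus_X: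
  assumes "(x, y) \<in> plus_dom X"
  shows "x \<oplus>\<^bsub>X\<^esub> y \<in> S" "p (x \<oplus>\<^bsub>X\<^esub> y) = {a \<in> carrier A. \<exists>b \<in> p y. a \<ominus> b \<in> p x}"
proof -
  have "{a \<in> carrier A. \<exists>b \<in> p y. a \<ominus> b \<in> p x} \<in> prime_ideals A"
    using assms by (intro prime_plus p_prime) (auto simp: plus_dom_X)
  from inv_p_closed[OF this] p_inv_p[OF this] show "x \<oplus>\<^bsub>X\<^esub> y \<in> S"
    "p (x \<oplus>\<^bsub>X\<^esub> y) = {a \<in> carrier A. \<exists>b \<in> p y. a \<ominus> b \<in> p x}"
    by (simp_all add: prime_space_def)
qed

lemma star_X:
  assumes "(x, y) \<in> star_dom X"
  shows "x \<star>\<^bsub>X\<^esub> y \<in> S" "p (x \<star>\<^bsub>X\<^esub> y) = {a \<in> carrier A. \<forall>b \<in> carrier A - p y. a \<ominus> b \<in> p x}"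
proof -
  obtain c where "x \<in> S" "y \<in> S" "c \<in> carrier A" "c \<notin> p y" "\<top> \<ominus> c \<notin> p x"
    using assms by (auto simp: star_dom_X)
  then have "{a \<in> carrier A. \<forall>b \<in> carrier A - p y. a \<ominus> b \<in> p x} \<in> prime_ideals A"
    by (intro prime_star[of _ _ c] p_prime) auto
  from inv_p_closed[OF this] p_inv_p[OF this] show "x \<star>\<^bsub>X\<^esub> y \<in> S"
    "p (x \<star>\<^bsub>X\<^esub> y) = {a \<in> carrier A. \<forall>b \<in> carrier A - p y. a \<ominus> b \<in> p x}"
    by (simp_all add: prime_space_def)
qed

lemma topol_X: "topol X = topology_generated_by (\<phi> ` carrier A \<union> (\<lambda>a. S - \<phi> a) ` carrier A)"
proof -
  have "{x \<in> S. a \<in> p x} = S - \<phi> a" for a by (auto simp: \<phi>_def)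
  then show ?thesis by (simp add: prime_space_def \<phi>_def)
qed

lemma \<phi>_simps:
  "\<phi> \<top> = S" "\<phi> \<bottom> = {}"
  "\<lbrakk>a \<in> carrier A; b \<in> carrier A\<rbrakk> \<Longrightarrow> \<phi> (a \<squnion> b) = \<phi> a \<union> \<phi> b"
  "\<lbrakk>a \<in> carrier A; b \<in> carrier A\<rbrakk> \<Longrightarrow> \<phi> (a \<sqinter> b) = \<phi> a \<inter> \<phi> b"
  "\<phi> a \<subseteq> S"
  using prime_idealsD[OF p_prime] by (auto simp: \<phi>_def)

text \<open>The nontrivial half is the prime ideal theorem for the principal ideal of
  \<open>b\<close> and the principal filter of \<open>a\<close>: a prime ideal separating them is a
  point of \<open>\<phi> a\<close> outside \<open>\<phi> b\<close>.\<close>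

lemma \<phi>_le_iff:
  assumes "a \<in> carrier A" "b \<in> carrier A"
  shows "a \<sqsubseteq> b \<longleftrightarrow> \<phi> a \<subseteq> \<phi> b"
proof
  assume "a \<sqsubseteq> b"
  then show "\<phi> a \<subseteq> \<phi> b"
    using prime_ideal_downward[OF p_prime] assms by (auto simp: \<phi>_def)
next
  assume le: "\<phi> a \<subseteq> \<phi> b"
  show "a \<sqsubseteq> b"
  proof (rule ccontr)
    assume n: "\<not> a \<sqsubseteq> b"
    have "\<exists>J \<in> prime_ideals A. {c \<in> carrier A. c \<sqsubseteq> b} \<subseteq> J \<and> J \<inter> {c \<in> carrier A. a \<sqsubseteq> c} = {}"
    proof (rule prime_ideal_exists)
      show "c \<squnion> d \<in> {c \<in> carrier A. c \<sqsubseteq> b} \<longleftrightarrow>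
          c \<in> {c \<in> carrier A. c \<sqsubseteq> b} \<and> d \<in> {c \<in> carrier A. c \<sqsubseteq> b}"
        if "c \<in> carrier A" "d \<in> carrier A" for c d
        using that assms by (simp add: join_le_iff)
      show "c \<sqinter> d \<in> {c \<in> carrier A. a \<sqsubseteq> c} \<longleftrightarrow>
          c \<in> {c \<in> carrier A. a \<sqsubseteq> c} \<and> d \<in> {c \<in> carrier A. a \<sqsubseteq> c}"
        if "c \<in> carrier A" "d \<in> carrier A" for c d
        using that assms by (simp add: le_meet_iff)
      show "{c \<in> carrier A. c \<sqsubseteq> b} \<inter> {c \<in> carrier A. a \<sqsubseteq> c} = {}"
        using n assms le_trans by blast
    qed (use assms in auto)
    then obtain J where J: "J \<in> prime_ideals A" "b \<in> J" "a \<notin> J" using assms by auto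
    then have "inv_into S p J \<in> \<phi> a - \<phi> b" by (simp add: \<phi>_def inv_p_closed p_inv_p)
    then show False using le by blast
  qed
qed

lemma topspace_X: "topspace (topol X) = S"
  using \<phi>_simps(1,5) top_closed by (auto simp: topol_X)

lemma \<phi>_clopen:
  assumes "a \<in> carrier A"
  shows "openin (topol X) (\<phi> a)" "openin (topol X) (S - \<phi> a)" "closedin (topol X) (\<phi> a)"
    "down_set X (\<phi> a)" "up_set X (S - \<phi> a)"
proof -
  show "openin (topol X) (\<phi> a)" "openin (topol X) (S - \<phi> a)"
    using assms by (auto simp: topol_X intro!: topology_generated_by_Basis)
  then show "closedin (topol X) (\<phi> a)"
    using \<phi>_simps(5) by (simp add: closedin_def topspace_X)
qed (auto simp: \<phi>_def down_set_def up_set_def)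

lemma compact_X: "compact_space (topol X)"
  unfolding topol_X
proof (rule compact_space_topology_generated_by)
  let ?B = "\<phi> ` carrier A \<union> (\<lambda>a. S - \<phi> a) ` carrier A"
  have UB: "\<Union>?B = S" using topspace_X by (simp add: topol_X)
  fix C assume C: "C \<subseteq> ?B" "\<Union>C = \<Union>?B"
  have CS: "\<Union>C = S" using C(2) UB by simp
  define N where "N = {a \<in> carrier A. \<phi> a \<in> C}"
  define M where "M = {b \<in> carrier A. S - \<phi> b \<in> C}"
  \<comment> \<open>\<open>I\<close> collects the elements \<open>c\<close> for which finitely many
    members of \<open>C\<close> from \<open>N\<close> cover \<open>\<phi> c\<close>, and
    \<open>F\<close> those for which finitely many from \<open>M\<close> cover
    \<open>S - \<phi> c\<close>. Were they disjoint, a prime ideal separating them would be a point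
    outside every member of \<open>C\<close>; a common element gives a finite cover of
    \<open>S\<close>.\<close>
  define I where "I = {c \<in> carrier A. \<exists>N'. finite N' \<and> N' \<subseteq> N \<and> \<phi> c \<subseteq> (\<Union>a \<in> N'. \<phi> a)}"
  define F where "F = {c \<in> carrier A. \<exists>M'. finite M' \<and> M' \<subseteq> M \<and> S - \<phi> c \<subseteq> (\<Union>b \<in> M'. S - \<phi> b)}"
  have "I \<inter> F \<noteq> {}"
  proof
    assume disj: "I \<inter> F = {}"
    have "\<exists>J \<in> prime_ideals A. I \<subseteq> J \<and> J \<inter> F = {}"
    proof (rule prime_ideal_exists[OF _ _ _ _ _ _ disj])
      show "a \<squnion> b \<in> I \<longleftrightarrow> a \<in> I \<and> b \<in> I" if ab: "a \<in> carrier A" "b \<in> carrier A" for a b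
      proof
        assume "a \<squnion> b \<in> I"
        then obtain N' where "finite N'" "N' \<subseteq> N" "\<phi> a \<union> \<phi> b \<subseteq> (\<Union>a \<in> N'. \<phi> a)"
          using ab by (auto simp: I_def \<phi>_simps)
        then show "a \<in> I \<and> b \<in> I" using ab unfolding I_def by blast
      next
        assume "a \<in> I \<and> b \<in> I"
        then obtain N1 N2 where "finite N1" "N1 \<subseteq> N" "\<phi> a \<subseteq> (\<Union>a \<in> N1. \<phi> a)"
          "finite N2" "N2 \<subseteq> N" "\<phi> b \<subseteq> (\<Union>a \<in> N2. \<phi> a)"
          by (auto simp: I_def)
        then show "a \<squnion> b \<in> I"
          using ab unfolding I_def by (auto simp: \<phi>_simps intro!: exI[of _ "N1 \<union> N2"])
      qed
      show "a \<sqinter> b \<in> F \<longleftrightarrow> a \<in> F \<and> b \<in> F" if ab: "a \<in> carrier A" "b \<in> carrier A" for a b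
      proof
        assume "a \<sqinter> b \<in> F"
        then obtain M' where "finite M'" "M' \<subseteq> M" "S - \<phi> a \<inter> \<phi> b \<subseteq> (\<Union>b \<in> M'. S - \<phi> b)"
          using ab by (auto simp: F_def \<phi>_simps)
        then show "a \<in> F \<and> b \<in> F" using ab unfolding F_def by blast
      next
        assume "a \<in> F \<and> b \<in> F"
        then obtain M1 M2 where "finite M1" "M1 \<subseteq> M" "S - \<phi> a \<subseteq> (\<Union>b \<in> M1. S - \<phi> b)"
          "finite M2" "M2 \<subseteq> M" "S - \<phi> b \<subseteq> (\<Union>b \<in> M2. S - \<phi> b)"
          unfolding F_def by blast
        moreover from this have "S - \<phi> a \<inter> \<phi> b \<subseteq> (\<Union>b \<in> M1 \<union> M2. S - \<phi> b)" by blast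
        ultimately show "a \<sqinter> b \<in> F"
          using ab unfolding F_def
          by (simp add: \<phi>_simps) (rule exI[of _ "M1 \<union> M2"], simp)
      qed
    qed (auto simp: I_def F_def \<phi>_simps)
    then obtain J where J: "J \<in> prime_ideals A" "I \<subseteq> J" "J \<inter> F = {}" by blast
    define x where "x = inv_into S p J"
    have x: "x \<in> S" "p x = J" using J by (auto simp: x_def inv_p_closed p_inv_p)
    have "x \<notin> \<phi> a" if "a \<in> N" for a
    proof -
      have "a \<in> I" using that unfolding I_def N_def by (auto intro!: exI[of _ "{a}"])
      then show ?thesis using J x by (auto simp: \<phi>_def)
    qed
    moreover have "x \<in> \<phi> b" if "b \<in> M" for b
    proof -
      have "b \<in> F" using that unfolding F_def M_def by (auto intro!: exI[of _ "{b}"])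
      then show ?thesis using J x by (auto simp: \<phi>_def)
    qed
    ultimately have "x \<notin> \<Union>C" using C(1) unfolding N_def M_def by blast
    then show False using CS x(1) by simp
  qed
  then obtain c where "c \<in> I" "c \<in> F" by blast
  then obtain N' M' where c: "c \<in> carrier A" "finite N'" "N' \<subseteq> N" "\<phi> c \<subseteq> (\<Union>a \<in> N'. \<phi> a)"
    "finite M'" "M' \<subseteq> M" "S - \<phi> c \<subseteq> (\<Union>b \<in> M'. S - \<phi> b)"
    unfolding I_def F_def by (elim CollectE conjE exE) blast
  let ?C = "\<phi> ` N' \<union> (\<lambda>b. S - \<phi> b) ` M'"
  have sub: "?C \<subseteq> C" using c by (auto simp: N_def M_def)
  have "\<Union>?C \<subseteq> S" using Union_mono[OF sub] CS by simp
  moreover have "S \<subseteq> \<Union>?C" using c(4,7) by auto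
  ultimately have "\<Union>?C = \<Union>?B" unfolding UB by (rule subset_antisym)
  with sub show "\<exists>C'. finite C' \<and> C' \<subseteq> C \<and> \<Union>C' = \<Union>?B"
    using c by (intro exI[of _ ?C]) simp
qed

lemma priestley_X: "priestley_space X"
proof unfold_locales
  show "x .=\<^bsub>X\<^esub> y" if "x \<sqsubseteq>\<^bsub>X\<^esub> y" "y \<sqsubseteq>\<^bsub>X\<^esub> x" "x \<in> carrier X" "y \<in> carrier X" for x y
  proof -
    have "p x = p y" using that(1,2) unfolding X_simps by (rule subset_antisym)
    then show ?thesis using that(3,4) p_inject[of x y] unfolding X_simps by blast
  qed
  show "\<exists>U. openin (topol X) U \<and> closedin (topol X) U \<and> down_set X U \<and> y \<in> U \<and> x \<notin> U"
    if xy: "x \<in> carrier X" "y \<in> carrier X" "\<not> x \<sqsubseteq>\<^bsub>X\<^esub> y" for x y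
  proof -
    obtain a where "a \<in> p x" "a \<notin> p y" using xy by auto
    moreover from this have "a \<in> carrier A" using p_subset[of x] xy by auto
    ultimately show ?thesis
      using \<phi>_clopen[of a] xy by (intro exI[of _ "\<phi> a"]) (auto simp: \<phi>_def)
  qed
qed (auto simp: topspace_X compact_X)

sublocale X: priestley_space X
  by (rule priestley_X)

text \<open>The sets \<open>\<phi> a\<close> are closed under union and intersection and separate
  each point of a clopen down-set from each point outside, so by compactness one of them separates
  the set from its whole complement.\<close>

lemma clopen_down_sets_X: "clopen_down_sets X = \<phi> ` carrier A"
proof
  show "\<phi> ` carrier A \<subseteq> clopen_down_sets X"
    using \<phi>_clopen by (auto simp: clopen_down_sets_def)
  show "clopen_down_sets X \<subseteq> \<phi> ` carrier A"
  proof
    fix U assume U: "U \<in> clopen_down_sets X"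
    note D = X.clopen_down_setsD[OF U]
    have "\<exists>V \<in> \<phi> ` carrier A. U \<subseteq> V \<and> V \<inter> (carrier X - U) = {}"
    proof (rule compact_space_separation[OF compact_X D(2,5)])
      show "{} \<in> \<phi> ` carrier A" "topspace (topol X) \<in> \<phi> ` carrier A"
        using \<phi>_simps(1,2) bottom_closed top_closed by (auto simp: topspace_X image_iff)
      show "V \<union> W \<in> \<phi> ` carrier A" "V \<inter> W \<in> \<phi> ` carrier A"
        if "V \<in> \<phi> ` carrier A" "W \<in> \<phi> ` carrier A" for V W
        using that by (auto simp flip: \<phi>_simps(3,4))
      fix x y assume xy: "x \<in> U" "y \<in> carrier X - U"
      then have "\<not> p y \<subseteq> p x" using D(7)[of x y] by auto
      then obtain a where "a \<in> p y" "a \<notin> p x" by blast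
      moreover from this have "a \<in> carrier A" using p_subset[of y] xy by auto
      ultimately show "\<exists>V \<in> \<phi> ` carrier A. x \<in> V \<and> y \<notin> V"
        using xy D(3) by (intro bexI[of _ "\<phi> a"]) (auto simp: \<phi>_def)
    qed (use \<phi>_clopen in auto)
    then obtain a where "a \<in> carrier A" "U \<subseteq> \<phi> a" "\<phi> a \<inter> (carrier X - U) = {}" by blast
    moreover from this have "\<phi> a = U" using \<phi>_simps(5)[of a] by auto
    ultimately show "U \<in> \<phi> ` carrier A" by blast
  qed
qed

text \<open>The sets \<open>S - \<phi> a\<close> form a base of the upper topology. As
  \<open>W\<close> is only open, the element \<open>a\<close> comes from separating the closed set
  \<open>S - W\<close> from \<open>z\<close>.\<close>

lemma up_nbhd:
  assumes W: "openin (topol X) W" "up_set X W" and z: "z \<in> W"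
  obtains a where "a \<in> carrier A" "a \<in> p z" "\<And>x. \<lbrakk>x \<in> S; a \<in> p x\<rbrakk> \<Longrightarrow> x \<in> W"
proof -
  have WS: "W \<subseteq> S" using W by (simp add: up_set_def)
  have "closedin (topol X) (S - W)"
    using W WS by (simp add: closedin_def topspace_X double_diff)
  moreover have "closedin (topol X) {z}" using X.closedin_singleton[of z] z WS by auto
  moreover have "\<not> z \<sqsubseteq>\<^bsub>X\<^esub> x" if "x \<in> S - W" for x
    using that W(2) z unfolding up_set_def by (metis Diff_iff X_simps(1))
  ultimately obtain U where "U \<in> clopen_down_sets X" "S - W \<subseteq> U" "U \<inter> {z} = {}"
    using X.clopen_down_separation[of "S - W" "{z}"] by blast
  then obtain a where "a \<in> carrier A" "S - W \<subseteq> \<phi> a" "z \<notin> \<phi> a"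
    unfolding clopen_down_sets_X by blast
  then show thesis using z WS that[of a] by (auto simp: \<phi>_def)
qed

text \<open>Likewise the sets \<open>\<phi> a\<close> form a base of the lower topology; now the
  separating down-set surrounds \<open>z\<close>.\<close>

lemma down_nbhd:
  assumes W: "openin (topol X) W" "down_set X W" and z: "z \<in> W"
  obtains a where "a \<in> carrier A" "a \<notin> p z" "\<And>x. \<lbrakk>x \<in> S; a \<notin> p x\<rbrakk> \<Longrightarrow> x \<in> W"
proof -
  have WS: "W \<subseteq> S" using W by (simp add: down_set_def)
  have "closedin (topol X) (S - W)"
    using W WS by (simp add: closedin_def topspace_X double_diff)
  moreover have "closedin (topol X) {z}" using X.closedin_singleton[of z] z WS by auto
  moreover have "\<not> x \<sqsubseteq>\<^bsub>X\<^esub> z" if "x \<in> S - W" for x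
    using that W(2) z unfolding down_set_def by (metis Diff_iff X_simps(1))
  ultimately obtain U where "U \<in> clopen_down_sets X" "{z} \<subseteq> U" "U \<inter> (S - W) = {}"
    using X.clopen_down_separation[of "{z}" "S - W"] by blast
  then obtain a where "a \<in> carrier A" "\<phi> a \<inter> (S - W) = {}" "z \<in> \<phi> a"
    unfolding clopen_down_sets_X by blast
  then show thesis using z WS that[of a] by (auto simp: \<phi>_def)
qed

lemma ominus_space_X: "ominus_space X"
proof (intro ominus_space.intro priestley_X ominus_space_axioms.intro)
  show "continuous_map (topol X) (topol X) (neg X)"
  proof (subst (2) topol_X, rule continuous_on_generated_topo)
    show "neg X ` topspace (topol X) \<subseteq> \<Union>(\<phi> ` carrier A \<union> (\<lambda>a. S - \<phi> a) ` carrier A)"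
      using neg_X(1) topspace_X by (simp add: topol_X image_subset_iff)
    fix U assume "U \<in> \<phi> ` carrier A \<union> (\<lambda>a. S - \<phi> a) ` carrier A"
    then obtain a where a: "a \<in> carrier A" "U = \<phi> a \<or> U = S - \<phi> a" by blast
    have "neg X -` \<phi> a \<inter> S = S - \<phi> (\<top> \<ominus> a)" "neg X -` (S - \<phi> a) \<inter> S = \<phi> (\<top> \<ominus> a)"
      using a neg_X by (auto simp: \<phi>_def)
    then show "openin (topol X) (neg X -` U \<inter> topspace (topol X))"
      using a \<phi>_clopen[of "\<top> \<ominus> a"] by (auto simp: topspace_X ominus_closed)
  qed
next
  show "neg X y \<sqsubseteq>\<^bsub>X\<^esub> neg X x" if "x \<in> carrier X" "y \<in> carrier X" "x \<sqsubseteq>\<^bsub>X\<^esub> y" for x y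
    using that by (auto simp: neg_X)
next
  show "continuous_map (subtopology (prod_topology (up_topology X) (up_topology X)) (plus_dom X))
      (up_topology X) (\<lambda>(x, y). x \<oplus>\<^bsub>X\<^esub> y)"
    unfolding continuous_map_rectangles
  proof (intro conjI ballI allI impI)
    show "(case q of (x, y) \<Rightarrow> x \<oplus>\<^bsub>X\<^esub> y) \<in> topspace (up_topology X)"
      if "q \<in> topspace (up_topology X) \<times> topspace (up_topology X) \<inter> plus_dom X" for q
      using that plus_X by (auto simp: X.topspace_up_topology)
    fix W x y
    assume "openin (up_topology X) W \<and> x \<in> topspace (up_topology X) \<and>
      y \<in> topspace (up_topology X) \<and> (x, y) \<in> plus_dom X \<and> (case (x, y) of (x, y) \<Rightarrow> x \<oplus>\<^bsub>X\<^esub> y) \<in> W"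
    then have W: "openin (topol X) W" "up_set X W" "x \<oplus>\<^bsub>X\<^esub> y \<in> W" and d: "(x, y) \<in> plus_dom X"
      by (auto simp: openin_up_topology)
    then obtain a where a: "a \<in> carrier A" "a \<in> p (x \<oplus>\<^bsub>X\<^esub> y)" "\<And>x. \<lbrakk>x \<in> S; a \<in> p x\<rbrakk> \<Longrightarrow> x \<in> W"
      using up_nbhd by blast
    \<comment> \<open>A single \<open>b\<close> certifies that \<open>a\<close> is in the sum, and
      it keeps doing so on a box of basic up-sets. For \<open>\<star>\<close> it is non-membership
      that has a single certificate, whence the lower topology there.\<close>
    then obtain b where b: "b \<in> p y" "a \<ominus> b \<in> p x" using plus_X(2)[OF d] by auto
    have xy: "x \<in> S" "y \<in> S" "b \<in> carrier A" using d b by (auto simp: plus_dom_X)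
    have "x' \<oplus>\<^bsub>X\<^esub> y' \<in> W"
      if "x' \<in> S - \<phi> (a \<ominus> b)" "y' \<in> S - \<phi> b" "(x', y') \<in> plus_dom X" for x' y'
      using that a(1,3) plus_X[OF that(3)] by (auto simp: \<phi>_def)
    then show "\<exists>U V. openin (up_topology X) U \<and> openin (up_topology X) V \<and> x \<in> U \<and> y \<in> V \<and>
        (\<forall>x' \<in> U. \<forall>y' \<in> V. (x', y') \<in> plus_dom X \<longrightarrow> (case (x', y') of (x, y) \<Rightarrow> x \<oplus>\<^bsub>X\<^esub> y) \<in> W)"
      using \<phi>_clopen[of "a \<ominus> b"] \<phi>_clopen[of b] a(1) b xy
      by - (rule exI[of _ "S - \<phi> (a \<ominus> b)"], rule exI[of _ "S - \<phi> b"],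
          auto simp: openin_up_topology ominus_closed \<phi>_def)
  qed
next
  show "continuous_map (subtopology (prod_topology (down_topology X) (down_topology X)) (star_dom X))
      (down_topology X) (\<lambda>(x, y). x \<star>\<^bsub>X\<^esub> y)"
    unfolding continuous_map_rectangles
  proof (intro conjI ballI allI impI)
    show "(case q of (x, y) \<Rightarrow> x \<star>\<^bsub>X\<^esub> y) \<in> topspace (down_topology X)"
      if "q \<in> topspace (down_topology X) \<times> topspace (down_topology X) \<inter> star_dom X" for q
      using that star_X by (auto simp: X.topspace_down_topology)
    fix W x y
    assume "openin (down_topology X) W \<and> x \<in> topspace (down_topology X) \<and>
      y \<in> topspace (down_topology X) \<and> (x, y) \<in> star_dom X \<and> (case (x, y) of (x, y) \<Rightarrow> x \<star>\<^bsub>X\<^esub> y) \<in> W"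
    then have W: "openin (topol X) W" "down_set X W" "x \<star>\<^bsub>X\<^esub> y \<in> W" and d: "(x, y) \<in> star_dom X"
      by (auto simp: openin_down_topology)
    then obtain a where a: "a \<in> carrier A" "a \<notin> p (x \<star>\<^bsub>X\<^esub> y)" "\<And>x. \<lbrakk>x \<in> S; a \<notin> p x\<rbrakk> \<Longrightarrow> x \<in> W"
      using down_nbhd by blast
    then obtain b where b: "b \<in> carrier A" "b \<notin> p y" "a \<ominus> b \<notin> p x" using star_X(2)[OF d] by auto
    have xy: "x \<in> S" "y \<in> S" using d by (auto simp: star_dom_X)
    have "x' \<star>\<^bsub>X\<^esub> y' \<in> W"
      if "x' \<in> \<phi> (a \<ominus> b)" "y' \<in> \<phi> b" "(x', y') \<in> star_dom X" for x' y'
      using that a(1,3) b(1) star_X[OF that(3)] by (auto simp: \<phi>_def)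
    then show "\<exists>U V. openin (down_topology X) U \<and> openin (down_topology X) V \<and> x \<in> U \<and> y \<in> V \<and>
        (\<forall>x' \<in> U. \<forall>y' \<in> V. (x', y') \<in> star_dom X \<longrightarrow> (case (x', y') of (x, y) \<Rightarrow> x \<star>\<^bsub>X\<^esub> y) \<in> W)"
      using \<phi>_clopen[of "a \<ominus> b"] \<phi>_clopen[of b] a(1) b xy
      by - (rule exI[of _ "\<phi> (a \<ominus> b)"], rule exI[of _ "\<phi> b"],
          auto simp: openin_down_topology ominus_closed \<phi>_def)
  qed
next
  show "mono_on_dom X (plus_dom X) (\<oplus>\<^bsub>X\<^esub>)"
    unfolding mono_on_dom_def by (auto simp: plus_X)
  show "mono_on_dom X (star_dom X) (\<star>\<^bsub>X\<^esub>)"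
    unfolding mono_on_dom_def by (auto simp: star_X)
next
  fix x y assume d: "(x, y) \<in> star_dom X"
  have xy: "x \<in> S" "y \<in> S" using d by (auto simp: star_dom_X)
  let ?G = "{x \<oplus>\<^bsub>X\<^esub> w | w. (x, w) \<in> plus_dom X \<and> \<not> w \<sqsubseteq>\<^bsub>X\<^esub> y}"
  have lower: "p (x \<star>\<^bsub>X\<^esub> y) \<subseteq> p (x \<oplus>\<^bsub>X\<^esub> w)" if w: "(x, w) \<in> plus_dom X" "\<not> p w \<subseteq> p y" for w
  proof -
    obtain b where "b \<in> p w" "b \<notin> p y" using w by blast
    moreover from this have "b \<in> carrier A" using w p_subset by (auto simp: plus_dom_X)
    ultimately show ?thesis using plus_X[OF w(1)] star_X[OF d] by auto
  qed
  have greatest: "p z \<subseteq> p (x \<star>\<^bsub>X\<^esub> y)"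
    if z: "z \<in> S" "\<And>w. \<lbrakk>(x, w) \<in> plus_dom X; \<not> p w \<subseteq> p y\<rbrakk> \<Longrightarrow> p z \<subseteq> p (x \<oplus>\<^bsub>X\<^esub> w)" for z
  proof
    fix a assume a: "a \<in> p z"
    then have ac: "a \<in> carrier A" using p_subset z by blast
    show "a \<in> p (x \<star>\<^bsub>X\<^esub> y)"
    proof (rule ccontr)
      assume "a \<notin> p (x \<star>\<^bsub>X\<^esub> y)"
      then obtain b where b: "b \<in> carrier A" "b \<notin> p y" "a \<ominus> b \<notin> p x"
        using star_X[OF d] ac by auto
      \<comment> \<open>The largest summand that keeps \<open>a\<close> out of the sum with
        \<open>x\<close>. It contains \<open>b\<close>, so it is not below \<open>y\<close>, and the
        hypothesis on \<open>z\<close> would put \<open>a\<close> into the sum.\<close>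
      let ?R = "{c \<in> carrier A. \<forall>a' \<in> {a}. a' \<ominus> c \<notin> p x}"
      have R: "?R \<in> prime_ideals A" "?R \<subseteq> {b \<in> carrier A. \<top> \<ominus> b \<notin> p x}"
        using prime_residual[OF p_prime[OF xy(1)], of "{a}"] ac
          prime_minus_le(1)[OF p_prime[OF xy(1)] ac b(1)] b(3) le_iff_join[OF ac ac]
        by auto
      define w where "w = inv_into S p ?R"
      have w: "w \<in> S" "p w = ?R" using R(1) by (simp_all only: w_def inv_p_closed p_inv_p)
      have dw: "(x, w) \<in> plus_dom X" using R w xy by (simp add: plus_dom_X)
      have "b \<in> p w" using w b by simp
      then have "a \<in> p (x \<oplus>\<^bsub>X\<^esub> w)" using z(2)[OF dw] b(2) a by blast
      then show False using plus_X[OF dw] w by auto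
    qed
  qed
  show "is_glb X (x \<star>\<^bsub>X\<^esub> y) ?G"
    unfolding greatest_def Lower_def
    using lower greatest star_X(1)[OF d] plus_X(1) by auto blast
next
  show "x \<sqsubseteq>\<^bsub>X\<^esub> x \<oplus>\<^bsub>X\<^esub> w" if d: "(x, w) \<in> plus_dom X" for x w
  proof -
    have "\<bottom> \<in> p w" "p x \<subseteq> carrier A"
      using d prime_idealsD(2)[OF p_prime] p_subset by (auto simp: plus_dom_X)
    then show ?thesis using plus_X[OF d] by (auto intro!: bexI[of _ \<bottom>] simp: ominus_bottom)
  qed
  show "x \<oplus>\<^bsub>X\<^esub> w \<sqsubseteq>\<^bsub>X\<^esub> x \<oplus>\<^bsub>X\<^esub> w' \<or> x \<oplus>\<^bsub>X\<^esub> w' \<sqsubseteq>\<^bsub>X\<^esub> x \<oplus>\<^bsub>X\<^esub> w"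
    if "(x, w) \<in> plus_dom X" "(x, w') \<in> plus_dom X" for x w w'
    using that prime_plus_total[OF p_prime[of x] p_subset[of w] p_subset[of w']]
    by (simp add: plus_X plus_dom_X)
next
  fix x assume "x \<in> carrier X"
  then have x: "x \<in> S" by simp
  \<comment> \<open>The largest ideal whose sum with \<open>p x\<close> stays inside
    \<open>p z\<close>; the adjunction is then a rearrangement of quantifiers.\<close>
  define R where "R z = {c \<in> carrier A. \<forall>a \<in> carrier A - p z. a \<ominus> c \<notin> p x}" for z
  have R: "R z \<in> prime_ideals A" "R z \<subseteq> {b \<in> carrier A. \<top> \<ominus> b \<notin> p x}" if z: "z \<in> S" "p x \<subseteq> p z" for z
  proof -
    have "carrier A - p z \<noteq> {}" using prime_idealsD(3)[OF p_prime[OF z(1)]] top_closed by blast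
    moreover have "a \<sqinter> b \<in> carrier A - p z" if "a \<in> carrier A - p z" "b \<in> carrier A - p z" for a b
      using that prime_idealsD(5)[OF p_prime[OF z(1)]] by auto
    ultimately show "R z \<in> prime_ideals A" "R z \<subseteq> {b \<in> carrier A. \<top> \<ominus> b \<notin> p x}"
      using prime_residual[OF p_prime[OF x], of "carrier A - p z"] z(2) unfolding R_def by blast+
  qed
  show "\<exists>R \<in> {z \<in> carrier X. x \<sqsubseteq>\<^bsub>X\<^esub> z} \<rightarrow> {w \<in> carrier X. w \<sqsubseteq>\<^bsub>X\<^esub> neg X x}.
      \<forall>w \<in> {w \<in> carrier X. w \<sqsubseteq>\<^bsub>X\<^esub> neg X x}. \<forall>z \<in> {z \<in> carrier X. x \<sqsubseteq>\<^bsub>X\<^esub> z}.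
        x \<oplus>\<^bsub>X\<^esub> w \<sqsubseteq>\<^bsub>X\<^esub> z \<longleftrightarrow> w \<sqsubseteq>\<^bsub>X\<^esub> R z"
  proof (intro bexI[of _ "\<lambda>z. inv_into S p (R z)"] ballI)
    show "(\<lambda>z. inv_into S p (R z)) \<in> {z \<in> carrier X. x \<sqsubseteq>\<^bsub>X\<^esub> z} \<rightarrow> {w \<in> carrier X. w \<sqsubseteq>\<^bsub>X\<^esub> neg X x}"
      using R x by (auto simp: inv_p_closed p_inv_p neg_X)
    fix w z assume w: "w \<in> {w \<in> carrier X. w \<sqsubseteq>\<^bsub>X\<^esub> neg X x}" and z: "z \<in> {z \<in> carrier X. x \<sqsubseteq>\<^bsub>X\<^esub> z}"
    then have d: "(x, w) \<in> plus_dom X" using x by (simp add: plus_dom_def)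
    have "x \<oplus>\<^bsub>X\<^esub> w \<sqsubseteq>\<^bsub>X\<^esub> z \<longleftrightarrow> p w \<subseteq> R z"
      using w p_subset[of w] plus_X[OF d] by (auto simp: R_def)
    then show "x \<oplus>\<^bsub>X\<^esub> w \<sqsubseteq>\<^bsub>X\<^esub> z \<longleftrightarrow> w \<sqsubseteq>\<^bsub>X\<^esub> inv_into S p (R z)"
      using z R(1)[of z] by (simp add: p_inv_p)
  qed
qed

text \<open>Only the inclusion from left to right needs a construction: if
  \<open>a \<ominus> b \<notin> p x\<close>, the ideal of all \<open>c\<close> with
  \<open>a \<ominus> c \<notin> p x\<close> is a summand that contains \<open>b\<close> and keeps
  \<open>a\<close> out of the sum.\<close>

lemma \<phi>_minus:
  assumes a: "a \<in> carrier A" and b: "b \<in> carrier A"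
  shows "\<phi> (a \<ominus> b) = down_set_minus X (\<phi> a) (\<phi> b)"
proof (intro equalityI subsetI)
  fix x assume "x \<in> \<phi> (a \<ominus> b)"
  then have x: "x \<in> S" "a \<ominus> b \<notin> p x" by (auto simp: \<phi>_def)
  let ?R = "{c \<in> carrier A. \<forall>a' \<in> {a}. a' \<ominus> c \<notin> p x}"
  have R: "?R \<in> prime_ideals A" "?R \<subseteq> {b \<in> carrier A. \<top> \<ominus> b \<notin> p x}"
    using prime_residual[OF p_prime[OF x(1)], of "{a}"] a
      prime_minus_le(1)[OF p_prime[OF x(1)] a b] x(2) le_iff_join[OF a a]
    by auto
  define w where "w = inv_into S p ?R"
  have w: "w \<in> S" "p w = ?R" using R(1) by (simp_all only: w_def inv_p_closed p_inv_p)
  have d: "(x, w) \<in> plus_dom X" using R w x by (simp add: plus_dom_X)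
  have "w \<notin> \<phi> b" using w b x by (simp add: \<phi>_def)
  moreover have "x \<oplus>\<^bsub>X\<^esub> w \<in> \<phi> a" using plus_X[OF d] w by (auto simp: \<phi>_def)
  ultimately show "x \<in> down_set_minus X (\<phi> a) (\<phi> b)"
    using d x by (auto simp: down_set_minus_def)
next
  fix x assume "x \<in> down_set_minus X (\<phi> a) (\<phi> b)"
  then obtain w where d: "(x, w) \<in> plus_dom X" "w \<notin> \<phi> b" "x \<oplus>\<^bsub>X\<^esub> w \<in> \<phi> a"
    by (auto simp: down_set_minus_def)
  then have "x \<in> S" "b \<in> p w" "a \<notin> p (x \<oplus>\<^bsub>X\<^esub> w)" by (auto simp: plus_dom_X \<phi>_def)
  then show "x \<in> \<phi> (a \<ominus> b)" using plus_X[OF d(1)] a by (auto simp: \<phi>_def)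
qed

theorem dual_pair_prime_space: "dual_pair A X \<phi>"
proof -
  interpret X': ominus_space X by (rule ominus_space_X)
  have "inj_on \<phi> (carrier A)"
  proof (rule inj_onI)
    fix a b assume "a \<in> carrier A" "b \<in> carrier A" "\<phi> a = \<phi> b"
    then show "a = b" using \<phi>_le_iff[of a b] \<phi>_le_iff[of b a] le_antisym[of a b] by simp
  qed
  then have "bij_betw \<phi> (carrier A) (clopen_down_sets X)"
    by (simp add: bij_betw_def clopen_down_sets_X)
  then show ?thesis
    by unfold_locales (auto simp: \<phi>_le_iff \<phi>_minus ominus_closed X.clopen_down_setsD simp del: X_simps(1))
qed

end

section \<open>Duality of arrows\<close>

context dual_pair
begin

lemma rep_subset: "a \<in> carrier A \<Longrightarrow> \<phi> a \<subseteq> carrier X"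
  using rep_closed X.clopen_down_setsD(3) by blast

lemma point_le_iff:
  assumes "x \<in> carrier X" "y \<in> carrier X"
  shows "y \<sqsubseteq>\<^bsub>X\<^esub> x \<longleftrightarrow> (\<forall>a \<in> carrier A. x \<in> \<phi> a \<longrightarrow> y \<in> \<phi> a)"
proof
  assume "y \<sqsubseteq>\<^bsub>X\<^esub> x"
  then show "\<forall>a \<in> carrier A. x \<in> \<phi> a \<longrightarrow> y \<in> \<phi> a"
    using rep_down_set assms unfolding down_set_def by blast
next
  assume le: "\<forall>a \<in> carrier A. x \<in> \<phi> a \<longrightarrow> y \<in> \<phi> a"
  show "y \<sqsubseteq>\<^bsub>X\<^esub> x"
  proof (rule ccontr)
    assume "\<not> y \<sqsubseteq>\<^bsub>X\<^esub> x"
    then obtain U where "U \<in> clopen_down_sets X" "x \<in> U" "y \<notin> U"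
      using X.separation[of y x] assms by (auto simp: clopen_down_sets_def)
    then show False using le rep_surj by metis
  qed
qed

lemma point_eqI:
  assumes "x \<in> carrier X" "y \<in> carrier X" "\<And>a. a \<in> carrier A \<Longrightarrow> x \<in> \<phi> a \<longleftrightarrow> y \<in> \<phi> a"
  shows "x = y"
  using assms X.le_antisym[of x y] by (simp add: point_le_iff)

lemma prime_ideal_of_point:
  assumes "x \<in> carrier X" shows "{a \<in> carrier A. x \<notin> \<phi> a} \<in> prime_ideals A"
  by (rule prime_idealsI) (use assms in \<open>auto simp: rep_bottom rep_top rep_join rep_meet\<close>)

text \<open>Together with \<open>prime_ideal_of_point\<close>, this identifies the points of any
  space in a pair with prime ideals. The conditions on \<open>x\<close> are closed and have the
  finite intersection property: finitely many elements outside \<open>I\<close> have a meet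
  \<open>a\<close> outside, finitely many in \<open>I\<close> have a join \<open>b\<close> inside,
  and \<open>a \<sqsubseteq> b\<close> is impossible.\<close>

lemma point_of_prime_ideal:
  assumes I: "I \<in> prime_ideals A"
  shows "\<exists>x \<in> carrier X. \<forall>a \<in> carrier A. x \<in> \<phi> a \<longleftrightarrow> a \<notin> I"
proof -
  note D = prime_idealsD[OF I]
  let ?\<U> = "\<phi> ` (carrier A - I) \<union> (\<lambda>b. carrier X - \<phi> b) ` I"
  have Ic: "\<And>b. b \<in> I \<Longrightarrow> b \<in> carrier A" using D(1) by blast
  have K: "compactin (topol X) (carrier X)"
    using X.compact X.topspace_eq by (simp add: compact_space_def)
  have closed: "closedin (topol X) C" if "C \<in> ?\<U>" for C
    using that Ic rep_closed X.clopen_down_setsD(2,5) by blast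
  have fip: "carrier X \<inter> \<Inter>\<F> \<noteq> {}" if \<F>: "finite \<F>" "\<F> \<subseteq> ?\<U>" for \<F>
  proof -
    obtain \<F>1 \<F>2 where F12: "\<F>1 \<subseteq> \<phi> ` (carrier A - I)" "\<F>2 \<subseteq> (\<lambda>b. carrier X - \<phi> b) ` I"
      "\<F> = \<F>1 \<union> \<F>2"
      using \<F>(2) subset_UnE by metis
    obtain F1 where F1: "F1 \<subseteq> carrier A - I" "finite F1" "\<F>1 = \<phi> ` F1"
      using finite_subset_image[OF _ F12(1)] \<F>(1) F12(3) by blast
    obtain F2 where F2: "F2 \<subseteq> I" "finite F2" "\<F>2 = (\<lambda>b. carrier X - \<phi> b) ` F2"
      using finite_subset_image[OF _ F12(2)] \<F>(1) F12(3) by blast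
    have "carrier X \<inter> \<Inter>(\<phi> ` F1) \<in> \<phi> ` (carrier A - I)"
    proof (rule finite_Int_closed)
      show "carrier X \<in> \<phi> ` (carrier A - I)" using D(3) rep_top top_closed by blast
      fix U V assume "U \<in> \<phi> ` (carrier A - I)" "V \<in> \<phi> ` (carrier A - I)"
      then obtain a b where "a \<in> carrier A - I" "U = \<phi> a" "b \<in> carrier A - I" "V = \<phi> b" by blast
      then show "U \<inter> V \<in> \<phi> ` (carrier A - I)"
        using D(5)[of a b] by (intro image_eqI[of _ _ "a \<sqinter> b"]) (auto simp: rep_meet)
    qed (use F1 in auto)
    then obtain a where a: "a \<in> carrier A" "a \<notin> I" "carrier X \<inter> \<Inter>(\<phi> ` F1) = \<phi> a" by blast
    have "\<Union>(\<phi> ` F2) \<in> \<phi> ` I"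
    proof (rule finite_Un_closed)
      show "{} \<in> \<phi> ` I" using D(2) rep_bottom by blast
      fix U V assume "U \<in> \<phi> ` I" "V \<in> \<phi> ` I"
      then obtain a b where "a \<in> I" "U = \<phi> a" "b \<in> I" "V = \<phi> b" by blast
      then show "U \<union> V \<in> \<phi> ` I"
        using D(4)[of a b] Ic by (intro image_eqI[of _ _ "a \<squnion> b"]) (auto simp: rep_join)
    qed (use F2 in auto)
    then obtain b where b: "b \<in> I" "\<Union>(\<phi> ` F2) = \<phi> b" by blast
    have "\<not> a \<sqsubseteq> b" using prime_ideal_downward[OF I a(1) b(1)] a(2) by blast
    then obtain x where x: "x \<in> \<phi> a" "x \<notin> \<phi> b" using le_iff a(1) Ic[OF b(1)] by blast
    then have "x \<in> carrier X" "\<forall>c \<in> F1. x \<in> \<phi> c" "\<forall>c \<in> F2. x \<notin> \<phi> c"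
      using a(3) b(2) by blast+
    then have "x \<in> carrier X \<inter> \<Inter>\<F>" unfolding F12(3) F1(3) F2(3) by blast
    then show ?thesis by blast
  qed
  have "carrier X \<inter> \<Inter>?\<U> \<noteq> {}"
    using K closed fip compactin_fip[of "topol X" "carrier X"] by (metis (no_types, lifting))
  then obtain x where x: "x \<in> carrier X \<inter> \<Inter>?\<U>" by (metis (no_types) ex_in_conv)
  then have "x \<in> \<phi> a" if "a \<in> carrier A - I" for a
    using that by (metis IntD2 InterD UnI1 image_eqI)
  moreover from x have "x \<in> carrier X - \<phi> a" if "a \<in> I" for a
    using that by (metis IntD2 InterD UnI2 image_eqI)
  ultimately show ?thesis using x by (intro bexI[of _ x]) auto
qed

text \<open>In terms of ideals this is the formula for \<open>I + J\<close>, so the algebra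
  determines the sum. The element \<open>b\<close> comes from upper continuity: on an open up-set
  around \<open>y\<close>, sums with \<open>x\<close> still avoid \<open>\<phi> a\<close>, and a
  clopen down-set missing \<open>y\<close> contains all remaining points.\<close>

lemma plus_notin_rep_iff:
  assumes d: "(x, y) \<in> plus_dom X" and a: "a \<in> carrier A"
  shows "x \<oplus>\<^bsub>X\<^esub> y \<notin> \<phi> a \<longleftrightarrow> (\<exists>b \<in> carrier A. y \<notin> \<phi> b \<and> x \<notin> \<phi> (a \<ominus> b))"
proof
  assume "\<exists>b \<in> carrier A. y \<notin> \<phi> b \<and> x \<notin> \<phi> (a \<ominus> b)"
  then show "x \<oplus>\<^bsub>X\<^esub> y \<notin> \<phi> a" using X.down_set_minusI[OF d] a by (auto simp: rep_minus)
next
  assume n: "x \<oplus>\<^bsub>X\<^esub> y \<notin> \<phi> a"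
  note aD = X.clopen_down_setsD[OF rep_closed[OF a]]
  have xy: "y \<in> carrier X" using X.plus_domD[OF d] by blast
  have "x \<oplus>\<^bsub>X\<^esub> y \<in> carrier X - \<phi> a" using n X.plus_closed[OF d] by blast
  from X.plus_upper_nbhd[OF d aD(4,6) this]
  obtain P Q where PQ: "openin (topol X) Q" "up_set X Q" "x \<in> P" "y \<in> Q"
    "\<forall>x' \<in> P. \<forall>w \<in> Q. (x', w) \<in> plus_dom X \<longrightarrow> x' \<oplus>\<^bsub>X\<^esub> w \<in> carrier X - \<phi> a"
    by blast
  have "closedin (topol X) (carrier X - Q)"
    using PQ(1) X.openin_subset_carrier by (simp add: X.closedin_carrier_iff double_diff)
  moreover have "\<not> y \<sqsubseteq>\<^bsub>X\<^esub> z" if "z \<in> carrier X - Q" for z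
    using that PQ(2,4) unfolding up_set_def by blast
  ultimately obtain U where U: "U \<in> clopen_down_sets X" "carrier X - Q \<subseteq> U" "y \<notin> U"
    using X.clopen_down_separation[OF _ X.closedin_singleton[OF xy], of "carrier X - Q"] by auto
  then obtain b where b: "b \<in> carrier A" "\<phi> b = U" using rep_surj by metis
  have "x \<notin> \<phi> (a \<ominus> b)"
  proof
    assume "x \<in> \<phi> (a \<ominus> b)"
    then obtain w where w: "(x, w) \<in> plus_dom X" "w \<notin> U" "x \<oplus>\<^bsub>X\<^esub> w \<in> \<phi> a"
      using a b by (auto simp: rep_minus elim: X.down_set_minusD)
    then have "w \<in> Q" using X.plus_domD[OF w(1)] U(2) by blast
    then show False using PQ(3,5) w by blast
  qed
  then show "\<exists>b \<in> carrier A. y \<notin> \<phi> b \<and> x \<notin> \<phi> (a \<ominus> b)" using b U by blast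
qed

text \<open>\<open>\<phi> (\<top> \<ominus> b)\<close> asks for some summand of \<open>x\<close>
  outside \<open>\<phi> b\<close>, and \<open>neg X x\<close> is the largest summand.\<close>

lemma neg_in_rep_iff:
  assumes x: "x \<in> carrier X" and b: "b \<in> carrier A"
  shows "neg X x \<in> \<phi> b \<longleftrightarrow> x \<notin> \<phi> (\<top> \<ominus> b)"
proof
  assume n: "neg X x \<in> \<phi> b"
  have "w \<in> \<phi> b" if "(x, w) \<in> plus_dom X" for w
    using X.plus_domD[OF that] n rep_down_set[OF b] unfolding down_set_def by blast
  then show "x \<notin> \<phi> (\<top> \<ominus> b)"
    using b by (auto simp: rep_minus elim: X.down_set_minusD)
next
  assume n: "x \<notin> \<phi> (\<top> \<ominus> b)"
  have d: "(x, neg X x) \<in> plus_dom X" using x X.neg_closed by (simp add: plus_dom_def)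
  then show "neg X x \<in> \<phi> b"
    using n b X.down_set_minusI[OF d, of "\<phi> b" "carrier X"] X.plus_closed[OF d]
    by (auto simp: rep_minus rep_top)
qed

end

text \<open>\<open>h\<close> acts as inverse image along \<open>f\<close>. This is a relation rather
  than a function, so that either arrow can be recovered from the other.\<close>

definition dual_arrows :: "'a ominus_alg \<Rightarrow> ('a \<Rightarrow> 's set) \<Rightarrow> 't ominus_sp \<Rightarrow> ('b \<Rightarrow> 't set) \<Rightarrow>
    ('a \<Rightarrow> 'b) \<Rightarrow> ('t \<Rightarrow> 's) \<Rightarrow> bool" where
  "dual_arrows A \<phi> Y \<psi> h f \<longleftrightarrow> (\<forall>a \<in> carrier A. \<psi> (h a) = {y \<in> carrier Y. f y \<in> \<phi> a})"

lemma ominus_alg_homD: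
  assumes "ominus_alg_hom A B h"
  shows "\<And>a. a \<in> carrier A \<Longrightarrow> h a \<in> carrier B" "h \<bottom>\<^bsub>A\<^esub> = \<bottom>\<^bsub>B\<^esub>" "h \<top>\<^bsub>A\<^esub> = \<top>\<^bsub>B\<^esub>"
    and "\<And>a b. \<lbrakk>a \<in> carrier A; b \<in> carrier A\<rbrakk> \<Longrightarrow> h (a \<sqinter>\<^bsub>A\<^esub> b) = h a \<sqinter>\<^bsub>B\<^esub> h b"
    and "\<And>a b. \<lbrakk>a \<in> carrier A; b \<in> carrier A\<rbrakk> \<Longrightarrow> h (a \<squnion>\<^bsub>A\<^esub> b) = h a \<squnion>\<^bsub>B\<^esub> h b"
    and "\<And>a b. \<lbrakk>a \<in> carrier A; b \<in> carrier A\<rbrakk> \<Longrightarrow> h (a \<ominus>\<^bsub>A\<^esub> b) = h a \<ominus>\<^bsub>B\<^esub> h b"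
  using assms by (auto simp: ominus_alg_hom_def)

section \<open>Passage between homomorphisms and morphisms of spaces\<close>

locale dual_pairs = A: dual_pair A X \<phi> + B: dual_pair B Y \<psi>
  for A :: "'a ominus_alg" and X :: "'s ominus_sp" and \<phi>
    and B :: "'b ominus_alg" and Y :: "'t ominus_sp" and \<psi>
begin

lemma dual_map_exists:
  assumes h: "ominus_alg_hom A B h"
  shows "\<exists>f. f \<in> extensional (carrier Y) \<and> ominus_sp_hom Y X f \<and> dual_arrows A \<phi> Y \<psi> h f"
proof -
  note hD = ominus_alg_homD[OF h]
  have "\<exists>x \<in> carrier X. \<forall>a \<in> carrier A. x \<in> \<phi> a \<longleftrightarrow> y \<in> \<psi> (h a)" if y: "y \<in> carrier Y" for y
  proof -
    \<comment> \<open>Prime ideals pull back along \<open>h\<close>, and every prime ideal of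
      \<open>A\<close> is realised by a point of \<open>X\<close>; this point is the value of
      \<open>f\<close> at \<open>y\<close>.\<close>
    have "{a \<in> carrier A. y \<notin> \<psi> (h a)} \<in> prime_ideals A"
      by (rule prime_idealsI)
        (use y in \<open>auto simp: hD B.rep_bottom B.rep_top B.rep_join B.rep_meet\<close>)
    from A.point_of_prime_ideal[OF this] show ?thesis by auto
  qed
  then obtain g where g: "\<And>y. y \<in> carrier Y \<Longrightarrow> g y \<in> carrier X \<and>
      (\<forall>a \<in> carrier A. g y \<in> \<phi> a \<longleftrightarrow> y \<in> \<psi> (h a))"
    by metis
  define f where "f = restrict g (carrier Y)"
  have fc: "f y \<in> carrier X" if "y \<in> carrier Y" for y
    using g that by (simp add: f_def)
  have f_iff: "f y \<in> \<phi> a \<longleftrightarrow> y \<in> \<psi> (h a)" if "y \<in> carrier Y" "a \<in> carrier A" for y a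
    using g that by (simp add: f_def)
  have "ominus_sp_hom Y X f"
    unfolding ominus_sp_hom_def
  proof (intro conjI ballI allI impI)
    show "continuous_map (topol Y) (topol X) f"
      unfolding continuous_map_def
    proof (intro conjI allI impI)
      show "f \<in> topspace (topol Y) \<rightarrow> topspace (topol X)"
        using fc by (simp add: A.X.topspace_eq B.X.topspace_eq)
      fix W assume W: "openin (topol X) W"
      \<comment> \<open>Having a clopen preimage survives Boolean operations, and the preimage of a
        clopen down-set \<open>\<phi> a\<close> is \<open>\<psi> (h a)\<close>, so
        \<open>clopen_basis\<close> applies.\<close>
      let ?\<B> = "{U. openin (topol X) U \<and> closedin (topol X) U \<and>
        openin (topol Y) {y \<in> carrier Y. f y \<in> U} \<and> closedin (topol Y) {y \<in> carrier Y. f y \<in> U}}"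
      have pre: "{y \<in> carrier Y. f y \<in> U \<union> V} = {y \<in> carrier Y. f y \<in> U} \<union> {y \<in> carrier Y. f y \<in> V}"
        "{y \<in> carrier Y. f y \<in> U \<inter> V} = {y \<in> carrier Y. f y \<in> U} \<inter> {y \<in> carrier Y. f y \<in> V}"
        "{y \<in> carrier Y. f y \<in> carrier X - U} = carrier Y - {y \<in> carrier Y. f y \<in> U}" for U V
        using fc by blast+
      have "\<exists>T. openin (topol Y) T \<and> y \<in> T \<and> T \<subseteq> {y \<in> carrier Y. f y \<in> W}"
        if y: "y \<in> carrier Y" "f y \<in> W" for y
      proof -
        have "\<exists>U \<in> ?\<B>. f y \<in> U \<and> U \<subseteq> W"
        proof (rule A.X.clopen_basis[OF W y(2)])
          show "clopen_down_sets X \<subseteq> ?\<B>"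
          proof
            fix U assume U: "U \<in> clopen_down_sets X"
            then obtain a where a: "a \<in> carrier A" "U = \<phi> a" using A.rep_surj by metis
            have "{y \<in> carrier Y. f y \<in> U} = \<psi> (h a)"
              using a f_iff B.rep_subset[OF hD(1)[OF a(1)]] by auto
            then show "U \<in> ?\<B>"
              using A.X.clopen_down_setsD(1,2)[OF U]
                B.X.clopen_down_setsD(1,2)[OF B.rep_closed[OF hD(1)[OF a(1)]]] by simp
          qed
          fix U assume "U \<in> ?\<B>"
          then show "carrier X - U \<in> ?\<B>"
            unfolding mem_Collect_eq pre by (auto simp: A.X.closedin_carrier_iff B.X.closedin_carrier_iff double_diff)
        qed (unfold mem_Collect_eq pre, auto)
        then obtain U where "openin (topol Y) {y \<in> carrier Y. f y \<in> U}" "f y \<in> U" "U \<subseteq> W" by blast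
        then show ?thesis using y(1) by (intro exI[of _ "{y \<in> carrier Y. f y \<in> U}"]) auto
      qed
      then show "openin (topol Y) {y \<in> topspace (topol Y). f y \<in> W}"
        unfolding B.X.topspace_eq by (subst openin_subopen) blast
    qed
  next
    fix x y assume "x \<in> carrier Y" "y \<in> carrier Y" "x \<sqsubseteq>\<^bsub>Y\<^esub> y"
    then show "f x \<sqsubseteq>\<^bsub>X\<^esub> f y"
      using hD(1) by (simp add: A.point_le_iff fc f_iff B.point_le_iff)
  next
    fix y assume y: "y \<in> carrier Y"
    show "f (neg Y y) = neg X (f y)"
    proof (rule A.point_eqI)
      fix a assume a: "a \<in> carrier A"
      have "f (neg Y y) \<in> \<phi> a \<longleftrightarrow> y \<notin> \<psi> (\<top>\<^bsub>B\<^esub> \<ominus>\<^bsub>B\<^esub> h a)"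
        using y a B.X.neg_closed by (simp add: f_iff B.neg_in_rep_iff hD(1))
      also have "\<dots> \<longleftrightarrow> neg X (f y) \<in> \<phi> a"
        using y a A.minus_closed[OF A.top_closed a]
        by (simp add: A.neg_in_rep_iff fc f_iff hD(3,6))
      finally show "f (neg Y y) \<in> \<phi> a \<longleftrightarrow> neg X (f y) \<in> \<phi> a" .
    qed (use y fc A.X.neg_closed B.X.neg_closed in auto)
  next
    fix x y assume d: "(x, y) \<in> plus_dom Y"
    then have xy: "x \<in> carrier Y" "y \<in> carrier Y" using B.X.plus_domD by blast+
    \<comment> \<open>\<open>f\<close> is not yet known to be a morphism, so the domain condition is
      read off from the algebras.\<close>
    have fd: "(f x, f y) \<in> plus_dom X"
    proof -
      have "x \<oplus>\<^bsub>Y\<^esub> y \<in> carrier Y" using B.X.plus_closed[OF d] .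
      have "f y \<sqsubseteq>\<^bsub>X\<^esub> neg X (f x)"
      proof (subst A.point_le_iff)
        show "\<forall>a \<in> carrier A. neg X (f x) \<in> \<phi> a \<longrightarrow> f y \<in> \<phi> a"
        proof (intro ballI impI)
          fix a assume a: "a \<in> carrier A" and n: "neg X (f x) \<in> \<phi> a"
          then have "x \<notin> \<psi> (\<top>\<^bsub>B\<^esub> \<ominus>\<^bsub>B\<^esub> h a)"
            using A.minus_closed[OF A.top_closed a] xy
            by (simp add: A.neg_in_rep_iff fc f_iff hD(3,6))
          then have "neg Y x \<in> \<psi> (h a)" using B.neg_in_rep_iff xy hD(1)[OF a] by blast
          then have "y \<in> \<psi> (h a)"
            using B.rep_down_set[OF hD(1)[OF a]] B.X.plus_domD[OF d] unfolding down_set_def by blast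
          then show "f y \<in> \<phi> a" using f_iff xy a by simp
        qed
      qed (use xy fc A.X.neg_closed in auto)
      then show ?thesis using xy fc by (simp add: plus_dom_def)
    qed
    show "f x \<oplus>\<^bsub>X\<^esub> f y \<sqsubseteq>\<^bsub>X\<^esub> f (x \<oplus>\<^bsub>Y\<^esub> y)"
    proof (subst A.point_le_iff)
      show "\<forall>a \<in> carrier A. f (x \<oplus>\<^bsub>Y\<^esub> y) \<in> \<phi> a \<longrightarrow> f x \<oplus>\<^bsub>X\<^esub> f y \<in> \<phi> a"
      proof (intro ballI impI, rule ccontr)
        fix a assume a: "a \<in> carrier A" and fxy: "f (x \<oplus>\<^bsub>Y\<^esub> y) \<in> \<phi> a" and "f x \<oplus>\<^bsub>X\<^esub> f y \<notin> \<phi> a"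
        then obtain b where b: "b \<in> carrier A" "f y \<notin> \<phi> b" "f x \<notin> \<phi> (a \<ominus>\<^bsub>A\<^esub> b)"
          using A.plus_notin_rep_iff[OF fd a] by blast
        then have "y \<notin> \<psi> (h b)" "x \<notin> \<psi> (h a \<ominus>\<^bsub>B\<^esub> h b)"
          using xy a A.minus_closed[OF a b(1)] by (simp_all add: f_iff hD(6))
        then have "x \<oplus>\<^bsub>Y\<^esub> y \<notin> \<psi> (h a)"
          using B.plus_notin_rep_iff[OF d hD(1)[OF a]] hD(1)[OF b(1)] by blast
        then show False using fxy f_iff B.X.plus_closed[OF d] a by simp
      qed
    qed (use fc B.X.plus_closed[OF d] A.X.plus_closed[OF fd] in auto)
  next
    fix y z assume y: "y \<in> carrier Y" and z: "z \<in> carrier X" and d: "(f y, z) \<in> plus_dom X"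
    \<comment> \<open>\<open>w\<close> is to be the largest summand of \<open>y\<close> with
      \<open>f (y \<oplus> w) \<sqsubseteq> f y \<oplus> z\<close>. In terms of ideals: the sum of
      \<open>y\<close> and \<open>w\<close> contains no \<open>h a\<close> for which
      \<open>f y \<oplus> z\<close> lies in \<open>\<phi> a\<close>.\<close>
    define M where "M = h ` {a \<in> carrier A. f y \<oplus>\<^bsub>X\<^esub> z \<in> \<phi> a}"
    let ?I = "{b \<in> carrier B. y \<notin> \<psi> b}"
    let ?R = "{c \<in> carrier B. \<forall>m \<in> M. m \<ominus>\<^bsub>B\<^esub> c \<notin> ?I}"
    have pc: "f y \<oplus>\<^bsub>X\<^esub> z \<in> carrier X" by (rule A.X.plus_closed[OF d])
    have M_closed: "m \<sqinter>\<^bsub>B\<^esub> m' \<in> M" if m: "m \<in> M" "m' \<in> M" for m m'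
    proof -
      obtain a a' where "a \<in> carrier A" "a' \<in> carrier A" "m = h a" "m' = h a'"
        "f y \<oplus>\<^bsub>X\<^esub> z \<in> \<phi> a" "f y \<oplus>\<^bsub>X\<^esub> z \<in> \<phi> a'"
        using m by (auto simp: M_def)
      then show ?thesis unfolding M_def
        by (intro image_eqI[of _ _ "a \<sqinter>\<^bsub>A\<^esub> a'"]) (auto simp: hD(4) A.rep_meet)
    qed
    have MI: "M \<inter> ?I = {}"
    proof -
      have "f y \<in> \<phi> a" if "a \<in> carrier A" "f y \<oplus>\<^bsub>X\<^esub> z \<in> \<phi> a" for a
        using A.rep_down_set[OF that(1)] that(2) A.X.plus_above[OF d] fc[OF y]
        unfolding down_set_def by blast
      then show ?thesis using f_iff[OF y] by (auto simp: M_def)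
    qed
    have "\<top>\<^bsub>B\<^esub> \<in> M"
      unfolding M_def using hD(3) pc A.rep_top by (intro image_eqI[of _ _ "\<top>\<^bsub>A\<^esub>"]) auto
    then have "M \<noteq> {}" by blast
    moreover have "M \<subseteq> carrier B" using hD(1) by (auto simp: M_def)
    ultimately have R: "?R \<in> prime_ideals B" "?R \<subseteq> {b \<in> carrier B. \<top>\<^bsub>B\<^esub> \<ominus>\<^bsub>B\<^esub> b \<notin> ?I}"
      using B.A.prime_residual[OF B.prime_ideal_of_point[OF y] _ _ M_closed MI] by blast+
    obtain w where w: "w \<in> carrier Y" "\<And>c. c \<in> carrier B \<Longrightarrow> w \<in> \<psi> c \<longleftrightarrow> c \<notin> ?R"
      using B.point_of_prime_ideal[OF R(1)] by blast
    have w_iff: "w \<in> \<psi> c \<longleftrightarrow>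
        (\<exists>a \<in> carrier A. f y \<oplus>\<^bsub>X\<^esub> z \<in> \<phi> a \<and> y \<notin> \<psi> (h a \<ominus>\<^bsub>B\<^esub> c))" if "c \<in> carrier B" for c
      using w(2)[OF that] that B.minus_closed[OF hD(1) that] by (auto simp: M_def)
    have "w \<sqsubseteq>\<^bsub>Y\<^esub> neg Y y"
    proof (subst B.point_le_iff)
      show "\<forall>b \<in> carrier B. neg Y y \<in> \<psi> b \<longrightarrow> w \<in> \<psi> b"
      proof (intro ballI impI)
        fix b assume b: "b \<in> carrier B" "neg Y y \<in> \<psi> b"
        then have "y \<notin> \<psi> (\<top>\<^bsub>B\<^esub> \<ominus>\<^bsub>B\<^esub> b)" using B.neg_in_rep_iff y by blast
        then show "w \<in> \<psi> b"
          using w(2)[OF b(1)] R(2) b(1) B.minus_closed[OF B.top_closed b(1)] by blast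
      qed
    qed (use w y B.X.neg_closed in auto)
    then have dw: "(y, w) \<in> plus_dom Y" using y w by (simp add: plus_dom_def)
    have "z \<sqsubseteq>\<^bsub>X\<^esub> f w"
    proof (subst A.point_le_iff)
      show "\<forall>b \<in> carrier A. f w \<in> \<phi> b \<longrightarrow> z \<in> \<phi> b"
      proof (intro ballI impI)
        fix b assume b: "b \<in> carrier A" "f w \<in> \<phi> b"
        then obtain a where a: "a \<in> carrier A" "f y \<oplus>\<^bsub>X\<^esub> z \<in> \<phi> a" "y \<notin> \<psi> (h a \<ominus>\<^bsub>B\<^esub> h b)"
          using w_iff[OF hD(1)[OF b(1)]] f_iff[OF w(1) b(1)] by blast
        then have "f y \<notin> \<phi> (a \<ominus>\<^bsub>A\<^esub> b)"
          using f_iff[OF y A.minus_closed[OF a(1) b(1)]] b(1) by (simp add: hD(6))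
        then show "z \<in> \<phi> b" using A.plus_notin_rep_iff[OF d a(1)] a(2) b(1) by blast
      qed
    qed (use w z fc in auto)
    moreover have "f (y \<oplus>\<^bsub>Y\<^esub> w) = f y \<oplus>\<^bsub>X\<^esub> z"
    proof (rule A.point_eqI)
      fix a assume a: "a \<in> carrier A"
      have "y \<oplus>\<^bsub>Y\<^esub> w \<notin> \<psi> (h a)" if n: "f y \<oplus>\<^bsub>X\<^esub> z \<notin> \<phi> a"
      proof -
        \<comment> \<open>This is the inequality not built into the choice of \<open>w\<close>: the
          witness \<open>b\<close> is carried by \<open>h\<close> to a witness in \<open>B\<close>,
          because \<open>z \<sqsubseteq> f w\<close> keeps \<open>w\<close> out of
          \<open>\<psi> (h b)\<close>.\<close>
        obtain b where b: "b \<in> carrier A" "z \<notin> \<phi> b" "f y \<notin> \<phi> (a \<ominus>\<^bsub>A\<^esub> b)"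
          using n A.plus_notin_rep_iff[OF d a] by blast
        have "y \<notin> \<psi> (h a \<ominus>\<^bsub>B\<^esub> h b)"
          using b f_iff[OF y A.minus_closed[OF a b(1)]] a by (simp add: hD(6))
        moreover have "w \<notin> \<psi> (h b)"
        proof
          assume "w \<in> \<psi> (h b)"
          then have "f w \<in> \<phi> b" using f_iff w b(1) by blast
          then show False
            using \<open>z \<sqsubseteq>\<^bsub>X\<^esub> f w\<close> b z A.rep_down_set[OF b(1)] unfolding down_set_def by blast
        qed
        ultimately show ?thesis
          using B.plus_notin_rep_iff[OF dw hD(1)[OF a]] hD(1)[OF b(1)] by blast
      qed
      moreover have "y \<oplus>\<^bsub>Y\<^esub> w \<in> \<psi> (h a)" if p: "f y \<oplus>\<^bsub>X\<^esub> z \<in> \<phi> a"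
      proof (rule ccontr)
        assume "y \<oplus>\<^bsub>Y\<^esub> w \<notin> \<psi> (h a)"
        then obtain c where c: "c \<in> carrier B" "w \<notin> \<psi> c" "y \<notin> \<psi> (h a \<ominus>\<^bsub>B\<^esub> c)"
          using B.plus_notin_rep_iff[OF dw hD(1)[OF a]] by blast
        then show False using w_iff[OF c(1)] p a by blast
      qed
      ultimately show "f (y \<oplus>\<^bsub>Y\<^esub> w) \<in> \<phi> a \<longleftrightarrow> f y \<oplus>\<^bsub>X\<^esub> z \<in> \<phi> a"
        using f_iff[OF B.X.plus_closed[OF dw] a] by blast
    qed (use fc B.X.plus_closed[OF dw] pc in auto)
    ultimately show "\<exists>w \<in> carrier Y. (y, w) \<in> plus_dom Y \<and> z \<sqsubseteq>\<^bsub>X\<^esub> f w \<and>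
        f (y \<oplus>\<^bsub>Y\<^esub> w) = f y \<oplus>\<^bsub>X\<^esub> z"
      using w(1) dw by blast
  qed
  moreover have "f \<in> extensional (carrier Y)" by (simp add: f_def)
  moreover have "dual_arrows A \<phi> Y \<psi> h f"
    unfolding dual_arrows_def using f_iff B.rep_subset[OF hD(1)] by blast
  ultimately show ?thesis by blast
qed

lemma dual_map_unique:
  assumes "dual_arrows A \<phi> Y \<psi> h f" "f \<in> extensional (carrier Y)" "ominus_sp_hom Y X f"
    and "dual_arrows A \<phi> Y \<psi> h g" "g \<in> extensional (carrier Y)" "ominus_sp_hom Y X g"
  shows "f = g"
proof (rule extensionalityI[OF assms(2,5)])
  fix y assume y: "y \<in> carrier Y"
  show "f y = g y"
  proof (rule A.point_eqI)
    show "f y \<in> carrier X" "g y \<in> carrier X"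
      by (rule ominus_sp_hom_closed[OF B.X.ominus_space_axioms A.X.ominus_space_axioms _ y];
          fact assms)+
    show "f y \<in> \<phi> a \<longleftrightarrow> g y \<in> \<phi> a" if a: "a \<in> carrier A" for a
    proof -
      have "{y \<in> carrier Y. f y \<in> \<phi> a} = {y \<in> carrier Y. g y \<in> \<phi> a}"
        using assms(1,4) a by (simp add: dual_arrows_def)
      then show ?thesis using y by blast
    qed
  qed
qed

lemma dual_hom_exists:
  assumes f: "ominus_sp_hom Y X f"
  shows "\<exists>h. h \<in> extensional (carrier A) \<and> ominus_alg_hom A B h \<and> dual_arrows A \<phi> Y \<psi> h f"
proof -
  note fc = ominus_sp_hom_closed[OF B.X.ominus_space_axioms A.X.ominus_space_axioms f]
  note fd = ominus_sp_hom_plus_dom[OF B.X.ominus_space_axioms A.X.ominus_space_axioms f]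
  have cont: "continuous_map (topol Y) (topol X) f"
    and mono: "\<And>x y. \<lbrakk>x \<in> carrier Y; y \<in> carrier Y; x \<sqsubseteq>\<^bsub>Y\<^esub> y\<rbrakk> \<Longrightarrow> f x \<sqsubseteq>\<^bsub>X\<^esub> f y"
    and sub: "\<And>x y. (x, y) \<in> plus_dom Y \<Longrightarrow> f x \<oplus>\<^bsub>X\<^esub> f y \<sqsubseteq>\<^bsub>X\<^esub> f (x \<oplus>\<^bsub>Y\<^esub> y)"
    and lift: "\<And>x z. \<lbrakk>x \<in> carrier Y; z \<in> carrier X; (f x, z) \<in> plus_dom X\<rbrakk> \<Longrightarrow>
      \<exists>w \<in> carrier Y. (x, w) \<in> plus_dom Y \<and> z \<sqsubseteq>\<^bsub>X\<^esub> f w \<and> f (x \<oplus>\<^bsub>Y\<^esub> w) = f x \<oplus>\<^bsub>X\<^esub> z"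
    using f unfolding ominus_sp_hom_def by simp_all
  define pre where "pre U = {y \<in> carrier Y. f y \<in> U}" for U
  have pre_closed: "pre U \<in> clopen_down_sets Y" if U: "U \<in> clopen_down_sets X" for U
  proof -
    note D = A.X.clopen_down_setsD[OF U]
    have "openin (topol Y) (pre U)" "closedin (topol Y) (pre U)"
      using D(1,2) openin_continuous_map_preimage[OF cont, of U]
        closedin_continuous_map_preimage[OF cont, of U]
      by (simp_all add: pre_def B.X.topspace_eq)
    moreover have "down_set Y (pre U)"
      using D(7)[OF _ fc mono] by (auto simp: down_set_def pre_def)
    ultimately show ?thesis by (simp add: clopen_down_sets_def)
  qed
  \<comment> \<open>The two conditions on \<open>\<oplus>\<close> for morphisms give the two
    inclusions. From left to right a summand \<open>z\<close> is lifted to \<open>w\<close>: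
    \<open>z \<sqsubseteq> f w\<close> keeps \<open>w\<close> outside \<open>pre V\<close>, and
    equality of the sums transfers membership in \<open>U\<close>. From right to left the inequality
    for \<open>f y \<oplus> f w\<close> suffices, as \<open>U\<close> is a down-set.\<close>
  have pre_minus: "pre (down_set_minus X U V) = down_set_minus Y (pre U) (pre V)"
    if U: "U \<in> clopen_down_sets X" and V: "V \<in> clopen_down_sets X" for U V
  proof (intro equalityI subsetI)
    fix y assume "y \<in> pre (down_set_minus X U V)"
    then obtain z where y: "y \<in> carrier Y" and z: "(f y, z) \<in> plus_dom X" "z \<notin> V" "f y \<oplus>\<^bsub>X\<^esub> z \<in> U"
      by (auto simp: pre_def elim: A.X.down_set_minusD)
    have zc: "z \<in> carrier X" using A.X.plus_domD[OF z(1)] by blast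
    obtain w where w: "w \<in> carrier Y" "(y, w) \<in> plus_dom Y" "z \<sqsubseteq>\<^bsub>X\<^esub> f w" "f (y \<oplus>\<^bsub>Y\<^esub> w) = f y \<oplus>\<^bsub>X\<^esub> z"
      using lift[OF y zc z(1)] by blast
    have "w \<notin> pre V"
      using z(2) zc w A.X.clopen_down_setsD(7)[OF V] by (auto simp: pre_def)
    moreover have "y \<oplus>\<^bsub>Y\<^esub> w \<in> pre U"
      using w(4) z(3) B.X.plus_closed[OF w(2)] by (simp add: pre_def)
    ultimately show "y \<in> down_set_minus Y (pre U) (pre V)"
      using B.X.down_set_minusI[OF w(2)] by blast
  next
    fix y assume "y \<in> down_set_minus Y (pre U) (pre V)"
    then obtain w where y: "y \<in> carrier Y" and w: "(y, w) \<in> plus_dom Y" "w \<notin> pre V" "y \<oplus>\<^bsub>Y\<^esub> w \<in> pre U"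
      by (rule B.X.down_set_minusD)
    have "w \<in> carrier Y" using B.X.plus_domD[OF w(1)] by blast
    then have "f w \<notin> V" using w(2) by (simp add: pre_def)
    moreover have "f y \<oplus>\<^bsub>X\<^esub> f w \<in> U"
      using A.X.clopen_down_setsD(7)[OF U _ _ sub[OF w(1)]] w(3) A.X.plus_closed[OF fd[OF w(1)]]
      by (simp add: pre_def)
    ultimately show "y \<in> pre (down_set_minus X U V)"
      using A.X.down_set_minusI[OF fd[OF w(1)]] y by (simp add: pre_def)
  qed
  have "\<exists>b \<in> carrier B. \<psi> b = pre (\<phi> a)" if "a \<in> carrier A" for a
    using B.rep_surj[OF pre_closed[OF A.rep_closed[OF that]]] by blast
  then obtain k where k: "\<And>a. a \<in> carrier A \<Longrightarrow> k a \<in> carrier B \<and> \<psi> (k a) = pre (\<phi> a)"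
    by metis
  define h where "h = restrict k (carrier A)"
  have h: "h a \<in> carrier B" "\<psi> (h a) = pre (\<phi> a)" if "a \<in> carrier A" for a
    using k that by (simp_all add: h_def)
  have pre_simps: "pre {} = {}" "pre (carrier X) = carrier Y" "pre (U \<inter> V) = pre U \<inter> pre V"
    "pre (U \<union> V) = pre U \<union> pre V" for U V
    using fc by (auto simp: pre_def)
  have "ominus_alg_hom A B h"
    unfolding ominus_alg_hom_def
  proof (intro conjI ballI)
    show "h \<in> carrier A \<rightarrow> carrier B" using h(1) by blast
    show "h \<bottom>\<^bsub>A\<^esub> = \<bottom>\<^bsub>B\<^esub>" "h \<top>\<^bsub>A\<^esub> = \<top>\<^bsub>B\<^esub>"
      by (simp_all add: h A.rep_bottom A.rep_top B.rep_bottom B.rep_top pre_simps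
          flip: B.rep_inject)
    fix a b assume ab: "a \<in> carrier A" "b \<in> carrier A"
    have "\<psi> (h (a \<sqinter>\<^bsub>A\<^esub> b)) = \<psi> (h a \<sqinter>\<^bsub>B\<^esub> h b)" "\<psi> (h (a \<squnion>\<^bsub>A\<^esub> b)) = \<psi> (h a \<squnion>\<^bsub>B\<^esub> h b)"
      "\<psi> (h (a \<ominus>\<^bsub>A\<^esub> b)) = \<psi> (h a \<ominus>\<^bsub>B\<^esub> h b)"
      using ab A.minus_closed[OF ab]
      by (simp_all add: h A.rep_meet B.rep_meet A.rep_join B.rep_join A.rep_minus B.rep_minus
          A.rep_closed pre_simps pre_minus)
    then show "h (a \<sqinter>\<^bsub>A\<^esub> b) = h a \<sqinter>\<^bsub>B\<^esub> h b" "h (a \<squnion>\<^bsub>A\<^esub> b) = h a \<squnion>\<^bsub>B\<^esub> h b"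
      "h (a \<ominus>\<^bsub>A\<^esub> b) = h a \<ominus>\<^bsub>B\<^esub> h b"
      using ab A.minus_closed[OF ab] B.minus_closed[OF h(1) h(1)]
      by (simp_all add: h(1) B.rep_inject)
  qed
  moreover have "h \<in> extensional (carrier A)" by (simp add: h_def)
  moreover have "dual_arrows A \<phi> Y \<psi> h f" using h(2) by (simp add: dual_arrows_def pre_def)
  ultimately show ?thesis by blast
qed

lemma dual_hom_unique:
  assumes "dual_arrows A \<phi> Y \<psi> h f" "h \<in> extensional (carrier A)" "ominus_alg_hom A B h"
    and "dual_arrows A \<phi> Y \<psi> k f" "k \<in> extensional (carrier A)" "ominus_alg_hom A B k"
  shows "h = k"
proof (rule extensionalityI[OF assms(2,5)])
  fix a assume a: "a \<in> carrier A"
  then have "\<psi> (h a) = \<psi> (k a)" using assms(1,4) by (simp add: dual_arrows_def)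
  then show "h a = k a"
    using B.rep_inject ominus_alg_homD(1)[OF assms(3) a] ominus_alg_homD(1)[OF assms(6) a] by blast
qed

end

text \<open>Common core of both readings of the theorem. Size enters only through the two hypotheses
  that every admissible object has an admissible partner; the duality of arrows is blind to
  it.\<close>

lemma dually_equivalent_full_subcats:
  fixes P :: "'a ominus_alg \<Rightarrow> bool" and Q :: "'s ominus_sp \<Rightarrow> bool"
  assumes P: "\<And>A. \<lbrakk>ominus_algebra A; P A\<rbrakk> \<Longrightarrow> \<exists>X \<phi>. dual_pair A X \<phi> \<and> Q X"
    and Q: "\<And>X. \<lbrakk>ominus_space X; Q X\<rbrakk> \<Longrightarrow> \<exists>A \<phi>. dual_pair A X \<phi> \<and> P A"
  shows "dually_equivalent (full_subcat ominus_alg_cat P) (full_subcat ominus_sp_cat Q)"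
    (is "dually_equivalent ?C ?D")
proof -
  define D where "D = {(A, X, \<phi>). P A \<and> Q X \<and> dual_pair A X \<phi>}"
  define T :: "'a ominus_alg \<times> 's ominus_sp \<times> ('a \<Rightarrow> 's set) \<Rightarrow>
      'a ominus_alg \<times> 's ominus_sp \<times> ('a \<Rightarrow> 's set) \<Rightarrow> ('a \<Rightarrow> 'a) \<Rightarrow> ('s \<Rightarrow> 's) \<Rightarrow> bool"
    where "T = (\<lambda>(A, X, \<phi>) (B, Y, \<psi>). dual_arrows A \<phi> Y \<psi>)"
  have C_simps: "Ob ?C = {A. ominus_algebra A \<and> P A}"
    "Hom ?C A B = {h \<in> extensional (carrier A). ominus_alg_hom A B h}"
    "Ident ?C A = (\<lambda>x \<in> carrier A. x)" "Comp ?C A B E k h = compose (carrier A) k h" for A B E k h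
    by (simp_all add: full_subcat_def ominus_alg_cat_def)
  have D_simps: "Ob ?D = {X. ominus_space X \<and> Q X}"
    "Hom ?D X Y = {f \<in> extensional (carrier X). ominus_sp_hom X Y f}"
    "Ident ?D X = (\<lambda>x \<in> carrier X. x)" "Comp ?D X Y Z g f = compose (carrier X) g f" for X Y Z g f
    by (simp_all add: full_subcat_def ominus_sp_cat_def)
  have pair: "ominus_algebra A" "ominus_space X" if "dual_pair A X \<phi>"
    for A :: "'a ominus_alg" and X :: "'s ominus_sp" and \<phi>
  proof -
    interpret dual_pair A X \<phi> by (rule that)
    show "ominus_algebra A" "ominus_space X"
      by (rule A.ominus_algebra_axioms X.ominus_space_axioms)+
  qed
  have "duality_span ?C ?D D fst (\<lambda>p. fst (snd p)) T"
  proof (intro duality_span.intro duality_span_axioms.intro)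
    show "category ?C" "category ?D"
      by (intro category_full_subcat category_ominus_alg category_ominus_sp)+
  next
    fix p assume "p \<in> D"
    then show "fst p \<in> Ob ?C" "fst (snd p) \<in> Ob ?D"
      using pair by (auto simp: D_def C_simps D_simps)
  next
    show "\<exists>p \<in> D. fst p = A" if "A \<in> Ob ?C" for A
      using that P[of A] by (fastforce simp: C_simps D_def)
    show "\<exists>p \<in> D. fst (snd p) = X" if "X \<in> Ob ?D" for X
      using that Q[of X] by (fastforce simp: D_simps D_def)
  next
    fix p q h assume "p \<in> D" "q \<in> D" and h: "h \<in> Hom ?C (fst p) (fst q)"
    then obtain A X \<phi> B Y \<psi> where pq: "p = (A, X, \<phi>)" "q = (B, Y, \<psi>)"
      "dual_pair A X \<phi>" "dual_pair B Y \<psi>" by (auto simp: D_def)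
    then interpret dual_pairs A X \<phi> B Y \<psi> by (simp add: dual_pairs_def)
    show "\<exists>!f. f \<in> Hom ?D (fst (snd q)) (fst (snd p)) \<and> T p q h f"
      using h dual_map_exists[of h] dual_map_unique[of h] by (auto simp: pq C_simps D_simps T_def)
  next
    fix p q f assume "p \<in> D" "q \<in> D" and f: "f \<in> Hom ?D (fst (snd q)) (fst (snd p))"
    then obtain A X \<phi> B Y \<psi> where pq: "p = (A, X, \<phi>)" "q = (B, Y, \<psi>)"
      "dual_pair A X \<phi>" "dual_pair B Y \<psi>" by (auto simp: D_def)
    then interpret dual_pairs A X \<phi> B Y \<psi> by (simp add: dual_pairs_def)
    show "\<exists>!h. h \<in> Hom ?C (fst p) (fst q) \<and> T p q h f"
      using f dual_hom_exists[of f] dual_hom_unique[of _ f] by (auto simp: pq C_simps D_simps T_def)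
  next
    fix p assume "p \<in> D"
    then obtain A X \<phi> where p: "p = (A, X, \<phi>)" "dual_pair A X \<phi>" by (auto simp: D_def)
    interpret dual_pair A X \<phi> by (rule p(2))
    show "T p p (Ident ?C (fst p)) (Ident ?D (fst (snd p)))"
      using rep_subset by (auto simp: p T_def C_simps D_simps dual_arrows_def)
  next
    fix p q r h k f g
    assume "p \<in> D" "q \<in> D" "r \<in> D" and h: "h \<in> Hom ?C (fst p) (fst q)"
      and g: "g \<in> Hom ?D (fst (snd r)) (fst (snd q))" and T: "T p q h f" "T q r k g"
    then obtain A X \<phi> B Y \<psi> E Z \<xi> where pqr: "p = (A, X, \<phi>)" "q = (B, Y, \<psi>)" "r = (E, Z, \<xi>)"
      "dual_pair A X \<phi>" "dual_pair B Y \<psi>" "dual_pair E Z \<xi>" by (auto simp: D_def)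
    have "g z \<in> carrier Y" if "z \<in> carrier Z" for z
      using ominus_sp_hom_closed[of Z Y g z] pair g pqr that by (auto simp: D_simps)
    moreover have "h a \<in> carrier B" if "a \<in> carrier A" for a
      using ominus_alg_homD(1)[of A B h a] h pqr that by (auto simp: C_simps)
    ultimately show "T p r (Comp ?C (fst p) (fst q) (fst r) k h)
        (Comp ?D (fst (snd r)) (fst (snd q)) (fst (snd p)) f g)"
      using T by (auto simp: pqr T_def C_simps D_simps dual_arrows_def compose_def)
  qed
  then show ?thesis by (rule duality_span.dually_equivalent)
qed

section \<open>Size\<close>

text \<open>Supplies names in a prescribed type for the points of a spectrum or the elements of an
  algebra of sets. \<open>S \<approx> F\<close> is recorded because the universe reading has to
  bound the new carrier.\<close>

lemma lepoll_indexed: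
  assumes "F \<lesssim> (UNIV :: 'b set)"
  obtains S :: "'b set" and p where "bij_betw p S F" "S \<approx> F"
proof -
  obtain e :: "'a \<Rightarrow> 'b" where "inj_on e F" using assms by (auto simp: lepoll_def)
  then have "bij_betw e F (e ` F)" by (simp add: bij_betw_def)
  then have "bij_betw (inv_into F e) (e ` F) F" by (rule bij_betw_inv_into)
  then show thesis using that by (auto simp: eqpoll_def)
qed

text \<open>Prime ideals of an algebra and clopen down-sets of a space are both subsets of a small
  carrier, so one appeal to closure under power sets serves both directions.\<close>

lemma power_closed_universe_indexed:
  fixes F :: "'u set set"
  assumes U: "power_closed_universe (UNIV :: 'u set)" and S: "S \<prec> (UNIV :: 'u set)" and F: "F \<subseteq> Pow S"
  obtains R :: "'u set" and p where "bij_betw p R F" "R \<prec> (UNIV :: 'u set)"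
proof -
  have "Pow S \<prec> (UNIV :: 'u set)" using U S by (simp add: power_closed_universe_def)
  then have small: "F \<prec> (UNIV :: 'u set)"
    using subset_imp_lepoll[OF F] lesspoll_trans1 by blast
  then obtain R :: "'u set" and p where R: "bij_betw p R F" "R \<approx> F"
    using lepoll_indexed lesspoll_imp_lepoll by metis
  then have "R \<prec> (UNIV :: 'u set)" using small eq_lesspoll_trans by blast
  then show thesis using R(1) that by blast
qed

lemma clopen_up_sets_eq_complements:
  "priestley_space X \<Longrightarrow> clopen_up_sets X = (\<lambda>U. carrier X - U) ` clopen_down_sets X"
  "priestley_space X \<Longrightarrow> clopen_down_sets X = (\<lambda>U. carrier X - U) ` clopen_up_sets X"
proof -
  assume "priestley_space X"
  then interpret priestley_space X .
  have 1: "carrier X - U \<in> clopen_up_sets X" if "U \<in> clopen_down_sets X" for U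
    using clopen_down_setsD[OF that] by (simp add: clopen_up_sets_def)
  have 2: "carrier X - U \<in> clopen_down_sets X \<and> U \<subseteq> carrier X" if "U \<in> clopen_up_sets X" for U
    using that
    by (auto simp: clopen_up_sets_def clopen_down_sets_def up_set_def down_set_def
        closedin_carrier_iff double_diff)
  show "clopen_up_sets X = (\<lambda>U. carrier X - U) ` clopen_down_sets X"
  proof (intro equalityI subsetI)
    fix U assume "U \<in> clopen_up_sets X"
    with 2[of U] show "U \<in> (\<lambda>U. carrier X - U) ` clopen_down_sets X"
      by (intro image_eqI[of _ _ "carrier X - U"]) auto
  qed (use 1 in auto)
  show "clopen_down_sets X = (\<lambda>U. carrier X - U) ` clopen_up_sets X"
  proof (intro equalityI subsetI)
    fix U assume "U \<in> clopen_down_sets X"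
    with 1[of U] clopen_down_setsD(3)[of U] show "U \<in> (\<lambda>U. carrier X - U) ` clopen_up_sets X"
      by (intro image_eqI[of _ _ "carrier X - U"]) auto
  qed (use 2 in auto)
qed

theorem theorem3p27:
  shows "(power_closed_universe (UNIV :: 'u set) \<longrightarrow>
      dually_equivalent
        (full_subcat (ominus_alg_cat :: ('u ominus_alg, 'u \<Rightarrow> 'u) cat) small_carrier)
        (full_subcat (ominus_sp_cat :: ('u ominus_sp, 'u \<Rightarrow> 'u) cat) small_carrier)) \<and>
    dually_equivalent
      (ominus_alg_cat :: ('a ominus_alg, 'a \<Rightarrow> 'a) cat)
      (full_subcat (ominus_sp_cat :: ('a set ominus_sp, 'a set \<Rightarrow> 'a set) cat)
        (\<lambda>X. clopen_up_sets X \<lesssim> (UNIV :: 'a set)))"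
proof (intro conjI impI)
  assume U: "power_closed_universe (UNIV :: 'u set)"
  show "dually_equivalent
      (full_subcat (ominus_alg_cat :: ('u ominus_alg, 'u \<Rightarrow> 'u) cat) small_carrier)
      (full_subcat (ominus_sp_cat :: ('u ominus_sp, 'u \<Rightarrow> 'u) cat) small_carrier)"
  proof (rule dually_equivalent_full_subcats)
    fix A :: "'u ominus_alg" assume A: "ominus_algebra A" "small_carrier A"
    have "prime_ideals A \<subseteq> Pow (carrier A)" by (auto simp: prime_ideals_def)
    then obtain R :: "'u set" and p where R: "bij_betw p R (prime_ideals A)" "R \<prec> (UNIV :: 'u set)"
      using power_closed_universe_indexed[OF U] A(2) unfolding small_carrier_def by metis
    interpret prime_spectrum A R p
      using A(1) R(1) by (simp add: prime_spectrum_def prime_spectrum_axioms_def)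
    show "\<exists>(X :: 'u ominus_sp) \<phi>. dual_pair A X \<phi> \<and> small_carrier X"
      using dual_pair_prime_space R(2) by (auto simp: small_carrier_def intro!: exI[of _ X])
  next
    fix X :: "'u ominus_sp" assume X: "ominus_space X" "small_carrier X"
    interpret ominus_space X by (rule X(1))
    have "clopen_down_sets X \<subseteq> Pow (carrier X)" using clopen_down_setsD(3) by blast
    then obtain R :: "'u set" and q where R: "bij_betw q R (clopen_down_sets X)" "R \<prec> (UNIV :: 'u set)"
      using power_closed_universe_indexed[OF U] X(2) unfolding small_carrier_def by metis
    then show "\<exists>(A :: 'u ominus_alg) \<phi>. dual_pair A X \<phi> \<and> small_carrier A"
      using dual_pair_down_sets[OF R(1)] by (fastforce simp: small_carrier_def)
  qed
next
  have "dually_equivalent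
      (full_subcat (ominus_alg_cat :: ('a ominus_alg, 'a \<Rightarrow> 'a) cat) (\<lambda>_. True))
      (full_subcat (ominus_sp_cat :: ('a set ominus_sp, 'a set \<Rightarrow> 'a set) cat)
        (\<lambda>X. clopen_up_sets X \<lesssim> (UNIV :: 'a set)))"
  proof (rule dually_equivalent_full_subcats)
    fix A :: "'a ominus_alg" assume A: "ominus_algebra A"
    \<comment> \<open>The index map is the identity: the prime ideals themselves are the points,
      which is why the spaces live on \<open>'a set\<close>.\<close>
    interpret prime_spectrum A "prime_ideals A" id
      using A by (simp add: prime_spectrum_def prime_spectrum_axioms_def)
    \<comment> \<open>Every clopen up-set of the spectrum is the complement of some
      \<open>\<phi> a\<close>, so the elements of \<open>A\<close> bound their number.\<close>
    have "clopen_up_sets X \<lesssim> carrier A"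
      unfolding clopen_up_sets_eq_complements(1)[OF priestley_X] clopen_down_sets_X
      by (meson image_lepoll lepoll_trans)
    then have "clopen_up_sets X \<lesssim> (UNIV :: 'a set)"
      using subset_imp_lepoll[OF subset_UNIV] lepoll_trans by blast
    then show "\<exists>(X :: 'a set ominus_sp) \<phi>. dual_pair A X \<phi> \<and> clopen_up_sets X \<lesssim> (UNIV :: 'a set)"
      using dual_pair_prime_space by blast
  next
    fix X :: "'a set ominus_sp" assume X: "ominus_space X" "clopen_up_sets X \<lesssim> (UNIV :: 'a set)"
    interpret ominus_space X by (rule X(1))
    have "clopen_down_sets X \<lesssim> (UNIV :: 'a set)"
      unfolding clopen_up_sets_eq_complements(2)[OF priestley_space_axioms]
      using X(2) by (meson image_lepoll lepoll_trans)
    \<comment> \<open>The size bound on the space pays off here: it lets the clopen down-sets be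
      named by elements of \<open>'a\<close>.\<close>
    then obtain R :: "'a set" and q where "bij_betw q R (clopen_down_sets X)"
      by (rule lepoll_indexed)
    then show "\<exists>(A :: 'a ominus_alg) \<phi>. dual_pair A X \<phi> \<and> True"
      using dual_pair_down_sets by blast
  qed
  moreover have "full_subcat (ominus_alg_cat :: ('a ominus_alg, 'a \<Rightarrow> 'a) cat) (\<lambda>_. True) = ominus_alg_cat"
    by (simp add: full_subcat_def ominus_alg_cat_def)
  ultimately show "dually_equivalent
      (ominus_alg_cat :: ('a ominus_alg, 'a \<Rightarrow> 'a) cat)
      (full_subcat (ominus_sp_cat :: ('a set ominus_sp, 'a set \<Rightarrow> 'a set) cat)
        (\<lambda>X. clopen_up_sets X \<lesssim> (UNIV :: 'a set)))"
    by simp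
qed

end
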